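(* Let $k\ge1$. The density for the sorted sequence of ages of the vertices of $H$ on the chamber $A_k=\{(a_1,\dots,a_k)\in\mathbb{R}^k: 0<a_1<a_2<\dots<a_k\}$ (that is, the density of the measure $\mathbb{P}(|H|=k,\ \text{sorted vertex ages}\in\cdot)$) is $$2^{-k}\left(\prod_{j=1}^{k-1}\left((k-j+1)a_j+\sum_{m=1}^{j-1}a_m\right)\right)\prod_{i=1}^k e^{-a_i}\,da_i.$$ Conditional on $|H|=k$, the sum of the ages of the vertices is a $\Gamma(2k-1,1)$ random variable. Conditioned on the vertex ages $a_1<\dots<a_k$, $H$ is a random weighted spanning tree of the complete graph on the vertices, with edge weights $w_{ij}=a_i\wedge a_j$ (i.e. each spanning tree has conditional probability proportional to the product of the weights of its edges).
   Context: $H$ is the multitype Galton--Watson tree with type space $[0,\infty)$ (types are called ages) defined as follows. The root $\rho$ has random age $a(\rho)$ with law $\pi(dx)=\tfrac12\operatorname{sech}^2(x/2)\,dx$ on $[0,\infty)$. Independently for each vertex, the multiset of ages of the children of a vertex of age $s$ is a Poisson random measure on $[0,\infty)$ with intensity $\lambda_s(dx)=(x\wedge s)\,\pi(dx)$. $H$ is almost surely finite and its vertex ages are almost surely distinct, so vertices can be identified with their ages. $|H|$ is the number of vertices of $H$. *)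

theory Defs
  imports "HOL-Probability.Probability" "HOL-Library.More_List"
begin

section \<open>Trees with typed vertices\<close>

text \<open>
  A realisation of a rooted tree with types in \<open>'t\<close> is a partial function on finite words
  (Ulam--Harris labels): its domain is the set of vertices, the root is the empty word, the
  children of the vertex \<open>u\<close> are the vertices \<open>u @ [i]\<close>, and the value at a vertex is its type.
  The numbering of siblings carries no information; it need not be an initial segment of the
  naturals.
\<close>

definition typed_tree :: "'t set \<Rightarrow> (nat list \<rightharpoonup> 't) \<Rightarrow> bool" where
  "typed_tree S t \<longleftrightarrow>
     [] \<in> dom t \<and>
     (\<forall>u i. u @ [i] \<in> dom t \<longrightarrow> u \<in> dom t) \<and>
     (\<forall>u. finite {i. u @ [i] \<in> dom t}) \<and>
     ran t \<subseteq> S"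

text \<open>The point process of the types of the children of \<open>u\<close>, evaluated at \<open>B\<close>.\<close>

definition children_count :: "(nat list \<rightharpoonup> 't) \<Rightarrow> nat list \<Rightarrow> 't set \<Rightarrow> nat" where
  "children_count t u B = card {i. \<exists>x\<in>B. t (u @ [i]) = Some x}"

section \<open>Multitype Galton--Watson trees with Poisson offspring\<close>

text \<open>
  In contrast to \<^const>\<open>poisson_pmf\<close>, the rate may be 0, which gives the unit mass at 0.
\<close>

definition poisson_prob :: "real \<Rightarrow> nat \<Rightarrow> real" where
  "poisson_prob r n = r ^ n / fact n * exp (- r)"

text \<open>The information contained in generations \<open>0, \<dots>, n\<close>.\<close>

definition generation_algebra ::
    "'w measure \<Rightarrow> 't measure \<Rightarrow> ('w \<Rightarrow> nat list \<rightharpoonup> 't) \<Rightarrow> nat \<Rightarrow> 'w measure" where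
  "generation_algebra M \<mu> H n =
     sigma (space M)
       {{\<omega> \<in> space M. \<exists>x\<in>B. H \<omega> u = Some x} | u B. length u \<le> n \<and> B \<in> sets \<mu>}"

text \<open>
  \<open>H\<close> is a random tree whose root type has law \<open>\<mu>\<close> and in which, independently for each
  vertex, the types of the children of a vertex of type \<open>s\<close> form a Poisson random measure
  with the finite intensity \<open>\<kappa> s\<close>.  That is: conditionally on generations \<open>0, \<dots>, n\<close>, the
  numbers of children with types in \<open>B u j\<close>, for vertices \<open>u\<close> of generation \<open>n\<close> and
  sets \<open>B u j\<close> disjoint in \<open>j\<close>, are independent Poisson variables with
  means \<open>\<kappa> s (B u j)\<close>, where \<open>s\<close> is the type of \<open>u\<close>.
  The type space is the underlying measurable space of \<open>\<mu>\<close>.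
\<close>

definition poisson_galton_watson ::
    "'w measure \<Rightarrow> 't measure \<Rightarrow> ('t \<Rightarrow> 't measure) \<Rightarrow> ('w \<Rightarrow> nat list \<rightharpoonup> 't) \<Rightarrow> bool" where
  "poisson_galton_watson M \<mu> \<kappa> H \<longleftrightarrow>
     prob_space M \<and>
     (\<forall>\<omega>\<in>space M. typed_tree (space \<mu>) (H \<omega>)) \<and>
     (\<forall>u. \<forall>B\<in>sets \<mu>. {\<omega> \<in> space M. \<exists>x\<in>B. H \<omega> u = Some x} \<in> sets M) \<and>
     distr M \<mu> (\<lambda>\<omega>. the (H \<omega> [])) = \<mu> \<and>
     (\<forall>n U J B c.
        finite U \<and> (\<forall>u\<in>U. length u = n) \<and> finite J \<and>
        (\<forall>u\<in>U. \<forall>j\<in>J. B u j \<in> sets \<mu>) \<and> (\<forall>u\<in>U. disjoint_family_on (B u) J) \<longrightarrow>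
        (AE \<omega> in M. U \<subseteq> dom (H \<omega>) \<longrightarrow>
           real_cond_exp M (generation_algebra M \<mu> H n)
             (indicator {\<omega> \<in> space M. \<forall>u\<in>U. \<forall>j\<in>J. children_count (H \<omega>) u (B u j) = c u j}) \<omega>
           = (\<Prod>u\<in>U. \<Prod>j\<in>(J::nat set).
                poisson_prob (measure (\<kappa> (the (H \<omega> u))) (B u j)) (c u j))))"

section \<open>Ages\<close>

definition age_law :: "real measure" where
  "age_law = density (restrict_space lborel {0..}) (\<lambda>x. ennreal (1 / 2 * (1 / cosh (x / 2))\<^sup>2))"

definition age_intensity :: "real \<Rightarrow> real measure" where
  "age_intensity s = density age_law (\<lambda>x. ennreal (min x s))"

text \<open>
  The vector \<open>(a\<^sub>1, \<dots>, a\<^sub>k)\<close> of the ages of all vertices in increasing order.  It is meant for trees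
  with exactly \<open>k\<close> vertices; the default 0 only makes it total.
\<close>

definition sorted_ages :: "nat \<Rightarrow> (nat list \<rightharpoonup> real) \<Rightarrow> nat \<Rightarrow> real" where
  "sorted_ages k t =
     (\<lambda>i\<in>{1..k}.
        nth_default 0
          (sorted_list_of_multiset (image_mset (\<lambda>u. the (t u)) (mset_set (dom t)))) (i - 1))"

definition age_chamber :: "nat \<Rightarrow> (nat \<Rightarrow> real) set" where
  "age_chamber k = {a. (\<forall>i\<in>{1..k}. 0 < a i) \<and> strict_mono_on {1..k} a}"

section \<open>Spanning trees\<close>

text \<open>Edge sets of spanning trees of the complete graph on the vertex set \<open>V\<close>.\<close>

definition spanning_tree_on :: "'v set \<Rightarrow> 'v set set \<Rightarrow> bool" where
  "spanning_tree_on V T \<longleftrightarrow>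
     T \<subseteq> {{x, y} | x y. x \<in> V \<and> y \<in> V \<and> x \<noteq> y} \<and>
     (\<forall>x\<in>V. \<forall>y\<in>V. (x, y) \<in> {(v, w). {v, w} \<in> T}\<^sup>*) \<and>
     \<not> (\<exists>vs. 3 \<le> length vs \<and> distinct vs \<and>
          (\<forall>i<length vs. {vs ! i, vs ! (Suc i mod length vs)} \<in> T))"

text \<open>The weight of the edge \<open>{i, j}\<close> is the minimum of \<open>a i\<close> and \<open>a j\<close>.\<close>

definition tree_weight :: "('v \<Rightarrow> real) \<Rightarrow> 'v set set \<Rightarrow> real" where
  "tree_weight a T = (\<Prod>e\<in>T. Min (a ` e))"

text \<open>The edges of a rooted tree, with vertices identified with their types.\<close>

definition tree_edges :: "(nat list \<rightharpoonup> 't) \<Rightarrow> 't set set" where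
  "tree_edges t = {{the (t u), the (t (u @ [i]))} | u i. u @ [i] \<in> dom t}"

end

theory Submission
  imports Defs
begin

text \<open>
Fix a rooted tree on the labels \<open>1, \<dots>, k\<close>, given by its root \<open>r\<close> and its parent map \<open>p\<close>, and
disjoint sets \<open>I\<^sub>1, \<dots>, I\<^sub>k\<close> of ages.  Say that the random tree matches if its vertices can be
labelled by \<open>1, \<dots>, k\<close> so that parents are given by \<open>p\<close> and the age of vertex \<open>i\<close> lies in \<open>I\<^sub>i\<close>.
A matching vertex of age \<open>s\<close> must have exactly one child in \<open>I\<^sub>j\<close> for each child \<open>j\<close> of its label
and no other children.  The Poisson counts on disjoint sets are independent, and their factors
\<open>exp (- \<lambda>\<^sub>s)\<close> multiply to a single void probability, so this happens with probability
\<open>exp (- \<Lambda>(s)) \<Prod>\<^sub>j \<lambda>\<^sub>s(I\<^sub>j)\<close>, where \<open>\<Lambda>(s)\<close> is the total mass of \<open>\<lambda>\<^sub>s\<close>.  Generation by generation this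
gives the matched ages the density \<open>\<Prod>\<^sub>i h(a\<^sub>i) exp (- \<Lambda>(a\<^sub>i)) \<Prod>\<^sub>j min(a\<^sub>j, a\<^sub>p\<^sub>(\<^sub>j\<^sub>))\<close>
(\<open>match_law_eq\<close>, \<open>emeasure_full_match\<close>), where \<open>h\<close> is the density of the age law.  The law is chosen
so that \<open>h(s) exp (- \<Lambda>(s)) = exp (- s) / 2\<close> (\<open>void_probability_times_age_density\<close>), which turns the
density into \<open>2\<^sup>-\<^sup>k exp (- \<Sum> a\<^sub>i)\<close> times the weight of the tree.

This does not depend on the root.  Hence, if the sets \<open>I\<^sub>i\<close> are increasing, so that labels are ranks of
ages, the event that the vertices identified with their ranks form a given spanning tree \<open>T\<close> has density
\<open>k 2\<^sup>-\<^sup>k exp (- \<Sum> a\<^sub>i)\<close> times the weight of \<open>T\<close> on the chamber (\<open>ordered_box_law\<close>,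
\<open>tree_event_law\<close>).  Ages are almost surely distinct because two vertices rarely fall into the same cell of
a fine partition (\<open>AE_distinct\<close>), so these events exhaust the trees with \<open>k\<close> vertices.  The conditional
law of the tree given the ages is then a ratio of densities (\<open>conditional_tree_law\<close>).

The density of the ages itself is obtained by summing over \<open>T\<close>.  With weights \<open>min(a\<^sub>i, a\<^sub>j)\<close> the youngest
vertex is joined to all others by edges of one constant weight; removing it leaves the same problem for
rooted forests in which being a root has a larger weight (\<open>forest_sum_insert\<close>).  Iterating gives the product
formula (\<open>forest_sum_min\<close>, \<open>sum_tree_weight\<close>).

Finally, the density is \<open>exp (- \<Sum> a\<^sub>i)\<close> times a function that is homogeneous of degree \<open>k - 1\<close> and supported
on a cone in \<open>k\<close> dimensions.  Under the measure with the homogeneous factor as its density, the set where the sum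
is at most \<open>t\<close> has mass proportional to \<open>t\<^sup>2\<^sup>k\<^sup>-\<^sup>1\<close>; this yields the Gamma law of the sum
(\<open>homogeneous_sum_law\<close>).
\<close>

section \<open>Rooted forests as acyclic parent maps\<close>

text \<open>
Rooted trees on \<open>insert r W\<close> with root \<open>r\<close>, or equally rooted forests on \<open>W\<close>, where \<open>r\<close> stands for
the absence of a parent.  Acyclicity is expressed by the absence of a non-empty set of vertices that is closed
under taking parents; both directions of its use are then a choice of a suitable set.
\<close>

definition parent_maps :: "'a set \<Rightarrow> 'a \<Rightarrow> ('a \<Rightarrow> 'a) set" where
  "parent_maps W r = {p \<in> W \<rightarrow>\<^sub>E insert r W. \<forall>S\<subseteq>W. S \<noteq> {} \<longrightarrow> (\<exists>i\<in>S. p i \<notin> S)}"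

definition forest_sum :: "('a \<Rightarrow> 'a \<Rightarrow> real) \<Rightarrow> 'a set \<Rightarrow> 'a \<Rightarrow> real" where
  "forest_sum w W r = (\<Sum>p\<in>parent_maps W r. \<Prod>i\<in>W. w i (p i))"

definition depth :: "'a \<Rightarrow> ('a \<Rightarrow> 'a) \<Rightarrow> 'a \<Rightarrow> nat" where
  "depth r p i = (LEAST n. (p ^^ n) i = r)"

text \<open>
The root, in \<open>W\<close>, of the tree of the forest that contains \<open>i\<close>.
\<close>

definition top_ancestor :: "'a \<Rightarrow> ('a \<Rightarrow> 'a) \<Rightarrow> 'a \<Rightarrow> 'a" where
  "top_ancestor r p i = (p ^^ (depth r p i - 1)) i"

lemma finite_parent_maps: "finite W \<Longrightarrow> finite (parent_maps W r)"
  unfolding parent_maps_def by (rule finite_subset[OF _ finite_PiE[of W "\<lambda>_. insert r W"]]) auto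

lemma parent_maps_mem: "p \<in> parent_maps W r \<Longrightarrow> i \<in> W \<Longrightarrow> p i \<in> insert r W"
  by (auto simp: parent_maps_def)

lemma parent_maps_exit:
  assumes "p \<in> parent_maps W r" "S \<subseteq> W" "S \<noteq> {}"
  shows "\<exists>i\<in>S. p i \<notin> S"
  using assms unfolding parent_maps_def by blast

lemma parent_maps_reaches_root:
  assumes p: "p \<in> parent_maps W r" and i: "i \<in> insert r W"
  shows "\<exists>n. (p ^^ n) i = r"
proof (rule ccontr)
  assume c: "\<not> ?thesis"
  let ?S = "{j \<in> W. \<forall>n. (p ^^ n) j \<noteq> r}"
  have "(p ^^ 0) i \<noteq> r" using c by blast
  with c i have "?S \<noteq> {}" by auto
  then obtain j where j: "j \<in> ?S" "p j \<notin> ?S"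
    using parent_maps_exit[OF p, of ?S] by blast
  have "(p ^^ n) (p j) \<noteq> r" for n
  proof -
    have "(p ^^ Suc n) j \<noteq> r" using j(1) by blast
    then show ?thesis unfolding funpow_Suc_right o_apply .
  qed
  moreover from this[of 0] have "p j \<in> W" using parent_maps_mem[OF p, of j] j by auto
  ultimately show False using j(2) by auto
qed

lemma depth_root [simp]: "depth r p r = 0"
  unfolding depth_def by (rule Least_eq_0) simp

lemma depth_step:
  assumes p: "p \<in> parent_maps W r" and i: "i \<in> W" and r: "r \<notin> W"
  shows "depth r p i = Suc (depth r p (p i))"
proof -
  obtain n where n: "(p ^^ n) i = r" using parent_maps_reaches_root[OF p] i by blast
  have "(LEAST n. (p ^^ n) i = r) = Suc (LEAST m. (p ^^ Suc m) i = r)"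
    by (rule Least_Suc[where P = "\<lambda>n. (p ^^ n) i = r", OF n]) (use i r in auto)
  then show ?thesis by (simp only: depth_def funpow_Suc_right o_apply)
qed

lemma top_ancestor_props:
  assumes p: "p \<in> parent_maps W r" and r: "r \<notin> W" and i: "i \<in> W"
  shows "p i = r \<Longrightarrow> top_ancestor r p i = i"
    and "p i \<noteq> r \<Longrightarrow> top_ancestor r p i = top_ancestor r p (p i)"
proof -
  show "p i = r \<Longrightarrow> top_ancestor r p i = i"
    unfolding top_ancestor_def depth_step[OF p i r] by simp
  assume "p i \<noteq> r"
  with parent_maps_mem[OF p i] have "p i \<in> W" by auto
  then have "depth r p i - 1 = Suc (depth r p (p i) - 1)"
    using depth_step[OF p i r] depth_step[OF p _ r, of "p i"] by simp
  then show "top_ancestor r p i = top_ancestor r p (p i)"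
    by (simp only: top_ancestor_def funpow_Suc_right o_apply)
qed

lemma parent_maps_induct [consumes 3, case_names step]:
  assumes p: "p \<in> parent_maps W r" and r: "r \<notin> W" and i: "i \<in> W"
    and step: "\<And>i. i \<in> W \<Longrightarrow> (p i \<noteq> r \<Longrightarrow> p i \<in> W \<Longrightarrow> P (p i)) \<Longrightarrow> P i"
  shows "P i"
  using i
proof (induction "depth r p i" arbitrary: i rule: less_induct)
  case less
  have "depth r p (p i) < depth r p i" using depth_step[OF p less.prems r] by linarith
  with less.hyps show ?case by (intro step[OF less.prems]) blast
qed

lemma top_ancestor_root:
  assumes p: "p \<in> parent_maps W r" and r: "r \<notin> W" and i: "i \<in> W"
  shows "top_ancestor r p i \<in> {j \<in> W. p j = r}"
  using p r i
proof (induction rule: parent_maps_induct)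
  case (step i)
  show ?case
  proof (cases "p i = r")
    case True
    then show ?thesis using top_ancestor_props(1)[OF p r step(1)] step(1) by simp
  next
    case False
    then have "p i \<in> W" using parent_maps_mem[OF p step(1)] by auto
    then show ?thesis using step False top_ancestor_props(2)[OF p r step(1) False] by simp
  qed
qed

text \<open>
A forest on \<open>insert v W\<close> is a forest \<open>q\<close> on \<open>W\<close>, a set \<open>Z\<close> of roots of \<open>q\<close> that are hung below
\<open>v\<close>, and a parent \<open>y\<close> of \<open>v\<close>.  A cycle has to pass through \<open>v\<close>, and it exists precisely if \<open>y\<close> lies
in one of the trees hung below \<open>v\<close>.
\<close>

lemma graft_parent_maps_iff:
  assumes q: "q \<in> parent_maps W r" and r: "r \<notin> W" and v: "v \<notin> W" "v \<noteq> r"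
    and Z: "Z \<subseteq> {i \<in> W. q i = r}" and y: "y \<in> insert r W"
  defines "p \<equiv> (\<lambda>i\<in>insert v W. if i = v then y else if i \<in> Z then v else q i)"
  shows "p \<in> parent_maps (insert v W) r \<longleftrightarrow> y = r \<or> top_ancestor r q y \<notin> Z"
proof -
  have pW: "p i = (if i \<in> Z then v else q i)" if "i \<in> W" for i
    using that v by (auto simp: p_def)
  have pv: "p v = y" by (simp add: p_def)
  have PiE: "p \<in> insert v W \<rightarrow>\<^sub>E insert r (insert v W)"
  proof
    show "p i \<in> insert r (insert v W)" if "i \<in> insert v W" for i
      using that y parent_maps_mem[OF q, of i] pW[of i] pv by auto
  qed (auto simp: p_def)
  show ?thesis
  proof
    assume pp: "p \<in> parent_maps (insert v W) r"
    show "y = r \<or> top_ancestor r q y \<notin> Z"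
    proof (rule ccontr)
      assume "\<not> ?thesis"
      then have yW: "y \<in> W" and yZ: "top_ancestor r q y \<in> Z" using y by auto
      let ?S = "insert v {i \<in> W. top_ancestor r q i = top_ancestor r q y}"
      have "p i \<in> ?S" if i: "i \<in> ?S" for i
      proof (cases "i = v")
        case True then show ?thesis using pv yW by auto
      next
        case False
        then have iW: "i \<in> W" and ti: "top_ancestor r q i = top_ancestor r q y" using i by auto
        show ?thesis
        proof (cases "q i = r")
          case True
          then have "i \<in> Z" using top_ancestor_props(1)[OF q r iW] ti yZ by simp
          then show ?thesis using pW[OF iW] by simp
        next
          case False
          then have "i \<notin> Z" "q i \<in> W" using Z parent_maps_mem[OF q iW] by auto
          then show ?thesis
            using pW[OF iW] top_ancestor_props(2)[OF q r iW False] ti by simp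
        qed
      qed
      moreover have "?S \<subseteq> insert v W" "?S \<noteq> {}" by auto
      ultimately show False using parent_maps_exit[OF pp, of ?S] by blast
    qed
  next
    assume y': "y = r \<or> top_ancestor r q y \<notin> Z"
    have "\<exists>i\<in>S. p i \<notin> S" if S: "S \<subseteq> insert v W" "S \<noteq> {}" for S
    proof (rule ccontr)
      assume "\<not> ?thesis"
      then have cl: "\<And>i. i \<in> S \<Longrightarrow> p i \<in> S" by auto
      have rS: "r \<notin> S" using S r v by auto
      show False
      proof (cases "v \<in> S")
        case False
        then have SW: "S \<subseteq> W" using S by auto
        then obtain i where i: "i \<in> S" "q i \<notin> S" using parent_maps_exit[OF q _ S(2)] by blast
        then show False using cl[OF i(1)] pW[of i] SW False by (auto split: if_splits)
      next
        case True
        have "top_ancestor r q i \<in> Z" if "i \<in> W" "i \<in> S" for i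
          using q r that
        proof (induction rule: parent_maps_induct)
          case (step i)
          show ?case
          proof (cases "q i = r")
            case True
            then have "i \<in> Z" using cl[OF step.prems] pW[OF step.hyps(1)] rS by (auto split: if_splits)
            then show ?thesis using top_ancestor_props(1)[OF q r step.hyps(1) True] by simp
          next
            case False
            then have "i \<notin> Z" using Z by auto
            then have "q i \<in> S" using cl[OF step.prems] pW[OF step.hyps(1)] by simp
            moreover have "q i \<in> W" using False parent_maps_mem[OF q step.hyps(1)] by auto
            ultimately show ?thesis using step False top_ancestor_props(2)[OF q r step.hyps(1) False] by simp
          qed
        qed
        moreover have "y \<in> S" using cl[OF True] pv by simp
        ultimately show False using y' y rS by auto
      qed
    qed
    then show "p \<in> parent_maps (insert v W) r" using PiE by (auto simp: parent_maps_def)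
  qed
qed

lemma collapse_parent_maps:
  assumes p: "p \<in> parent_maps (insert v W) r" and r: "r \<notin> W" and v: "v \<notin> W" "v \<noteq> r"
  shows "(\<lambda>i\<in>W. if p i = v then r else p i) \<in> parent_maps W r"
proof -
  have "\<exists>i\<in>S. (\<lambda>i\<in>W. if p i = v then r else p i) i \<notin> S" if S: "S \<subseteq> W" "S \<noteq> {}" for S
  proof -
    have "S \<subseteq> insert v W" using S by auto
    then obtain i where "i \<in> S" "p i \<notin> S" using parent_maps_exit[OF p _ S(2)] by blast
    then show ?thesis using S r by (intro bexI[of _ i]) auto
  qed
  moreover have "(\<lambda>i\<in>W. if p i = v then r else p i) \<in> W \<rightarrow>\<^sub>E insert r W"
    using parent_maps_mem[OF p] by fastforce
  ultimately show ?thesis unfolding parent_maps_def by blast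
qed

lemma sum_over_Sigma:
  fixes g :: "'a \<times> 'b \<Rightarrow> 'c::comm_monoid_add"
  assumes "finite A" "\<And>x. x \<in> A \<Longrightarrow> finite (B x)"
  shows "sum g (Sigma A B) = (\<Sum>x\<in>A. \<Sum>y\<in>B x. g (x, y))"
  using sum.Sigma[of A B "\<lambda>x y. g (x, y)"] assms by simp

text \<open>
Decompose a forest on \<open>insert v W\<close> as in \<open>graft_parent_maps_iff\<close>.  Each of the \<open>m\<close> roots of \<open>q\<close> is hung
either below \<open>r\<close>, with weight \<open>x\<close>, or below \<open>v\<close>, with weight \<open>c\<close>.  If \<open>v\<close> is a child of \<open>r\<close> the
roots contribute \<open>x (x + c)\<^sup>m\<close> in total.  If \<open>v\<close> is a child of \<open>y \<in> W\<close>, the root above \<open>y\<close> must stay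
below \<open>r\<close>, which leaves \<open>c x (x + c)\<^sup>m\<^sup>-\<^sup>1\<close> for each \<open>y\<close>.  Thus up to the factor \<open>x + c\<close> the sum is
the one over forests on \<open>W\<close> with root weight \<open>x + c\<close>.
\<close>

lemma forest_sum_insert:
  fixes c x :: real
  assumes fin: "finite W" and r: "r \<notin> W" and v: "v \<notin> W" "v \<noteq> r"
    and wv: "\<And>i. i \<in> W \<Longrightarrow> w i v = c" "\<And>i. i \<in> W \<Longrightarrow> w v i = c"
    and wr: "\<And>i. i \<in> W \<Longrightarrow> w i r = x" "w v r = x"
  shows "(x + c) * forest_sum w (insert v W) r =
         x * (x + (real (card W) + 1) * c) * forest_sum (\<lambda>i j. if j = r then x + c else w i j) W r"
proof -
  \<comment> \<open>\<open>?g\<close> grafts and \<open>?f\<close> recovers \<open>(q, Z, y)\<close> from the grafted forest.\<close>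
  let ?R = "\<lambda>q. {i \<in> W. q i = r}"
  let ?Y = "\<lambda>q Z. insert r {y \<in> W. top_ancestor r q y \<notin> Z}"
  let ?in = "\<lambda>q. \<Prod>i\<in>W - ?R q. w i (q i)"
  let ?D = "SIGMA q:parent_maps W r. SIGMA Z:Pow (?R q). ?Y q Z"
  let ?g = "\<lambda>(q, Z, y). \<lambda>i\<in>insert v W. if i = v then y else if i \<in> Z then v else q i"
  let ?f = "\<lambda>p. (\<lambda>i\<in>W. if p i = v then r else p i, {i \<in> W. p i = v}, p v)"
  let ?wt = "\<lambda>(q, Z, y). ?in q * (c ^ card Z * x ^ card (?R q - Z)) * (if y = r then x else c)"
  have g_mem: "?g t \<in> parent_maps (insert v W) r" if "t \<in> ?D" for t
  proof -
    obtain q Z y where t: "t = (q, Z, y)" by (cases t) auto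
    have "q \<in> parent_maps W r" "Z \<subseteq> ?R q" "y \<in> insert r W" "y = r \<or> top_ancestor r q y \<notin> Z"
      using that t by auto
    from graft_parent_maps_iff[OF this(1) r v this(2,3)] this(4) show ?thesis using t by simp
  qed
  have f_mem: "?f p \<in> ?D" and gf: "?g (?f p) = p" if p: "p \<in> parent_maps (insert v W) r" for p
  proof -
    let ?q = "\<lambda>i\<in>W. if p i = v then r else p i" and ?Z = "{i \<in> W. p i = v}"
    have q: "?q \<in> parent_maps W r" by (rule collapse_parent_maps[OF p r v])
    have Z: "?Z \<subseteq> ?R ?q" by auto
    have pv: "p v \<noteq> v" using p unfolding parent_maps_def by (auto dest!: spec[of _ "{v}"])
    then have y: "p v \<in> insert r W" using parent_maps_mem[OF p, of v] by auto
    have "p \<in> extensional (insert v W)" using p by (auto simp: parent_maps_def PiE_def)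
    then have eq: "(\<lambda>i\<in>insert v W. if i = v then p v else if i \<in> ?Z then v else ?q i) = p"
      using v by (intro ext) (auto simp: extensional_def)
    show "?g (?f p) = p" using eq by simp
    have "p v = r \<or> top_ancestor r ?q (p v) \<notin> ?Z"
      by (rule iffD1[OF graft_parent_maps_iff[OF q r v Z y]]) (unfold eq, rule p)
    then have "p v \<in> ?Y ?q ?Z" using y by blast
    then have "(?q, ?Z, p v) \<in> ?D"
      by (intro SigmaI q PowI Z)
    then show "?f p \<in> ?D" .
  qed
  have fg: "?f (?g t) = t" if "t \<in> ?D" for t
  proof -
    obtain q Z y where t: "t = (q, Z, y)" by (cases t) auto
    have q: "q \<in> parent_maps W r" and Z: "Z \<subseteq> ?R q" using that t by auto
    have qv: "q i \<noteq> v" if "i \<in> W" for i using parent_maps_mem[OF q that] v by auto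
    have qext: "q \<in> extensional W" using q by (auto simp: parent_maps_def PiE_def)
    have "(\<lambda>i\<in>W. if ?g t i = v then r else ?g t i) = q"
      using qext Z v qv by (auto simp: t extensional_def fun_eq_iff)
    moreover have "{i \<in> W. ?g t i = v} = Z" using Z v qv by (auto simp: t)
    ultimately show ?thesis by (simp add: t)
  qed
  have wt: "?wt t = (\<Prod>i\<in>insert v W. w i (?g t i))" if "t \<in> ?D" for t
  proof -
    obtain q Z y where t: "t = (q, Z, y)" by (cases t) auto
    have q: "q \<in> parent_maps W r" and Z: "Z \<subseteq> ?R q" and y: "y \<in> insert r W" using that t by auto
    have finR: "finite (?R q)" using fin by auto
    have "(\<Prod>i\<in>insert v W. w i (?g t i)) = w v y * (\<Prod>i\<in>W. w i (if i \<in> Z then v else q i))"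
      using fin v by (simp add: t cong: prod.cong) (intro disjI2 prod.cong, auto)
    also have "w v y = (if y = r then x else c)" using y r wv wr by auto
    also have "(\<Prod>i\<in>W. w i (if i \<in> Z then v else q i)) =
        (\<Prod>i\<in>W - ?R q. w i (if i \<in> Z then v else q i)) * (\<Prod>i\<in>?R q. w i (if i \<in> Z then v else q i))"
      by (rule prod.subset_diff) (use fin in auto)
    also have "(\<Prod>i\<in>W - ?R q. w i (if i \<in> Z then v else q i)) = ?in q"
      using Z by (intro prod.cong) auto
    also have "(\<Prod>i\<in>?R q. w i (if i \<in> Z then v else q i)) =
       (\<Prod>i\<in>?R q - Z. w i (if i \<in> Z then v else q i)) * (\<Prod>i\<in>Z. w i (if i \<in> Z then v else q i))"
      by (rule prod.subset_diff) (use finR Z in auto)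
    also have "(\<Prod>i\<in>?R q - Z. w i (if i \<in> Z then v else q i)) = (\<Prod>i\<in>?R q - Z. x)"
      by (intro prod.cong) (auto simp: wr)
    also have "(\<Prod>i\<in>Z. w i (if i \<in> Z then v else q i)) = (\<Prod>i\<in>Z. c)"
      using Z by (intro prod.cong) (auto simp: wv)
    finally show ?thesis by (simp add: t mult_ac)
  qed
  have inner: "(x + c) * (\<Sum>Z\<in>Pow (?R q). \<Sum>y\<in>?Y q Z. ?wt (q, Z, y)) =
      x * (x + (real (card W) + 1) * c) * (\<Prod>i\<in>W. if q i = r then x + c else w i (q i))"
    if q: "q \<in> parent_maps W r" for q
  proof -
    let ?R' = "?R q" and ?top = "top_ancestor r q"
    let ?m = "\<lambda>Z. c ^ card Z * x ^ card (?R' - Z)"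
    have finR: "finite ?R'" using fin by auto
    have binom: "(\<Sum>Z\<in>Pow A. c ^ card Z * x ^ card (A - Z)) = (x + c) ^ card A" if "finite A" for A :: "'a set"
      using prod_add[OF that, of "\<lambda>_. c" "\<lambda>_. x"] by (simp add: add.commute)
    have top: "?top y \<in> ?R'" if "y \<in> W" for y using top_ancestor_root[OF q r that] .
    have restr: "(x + c) * (\<Sum>Z\<in>Pow ?R'. if ?top y \<notin> Z then ?m Z else 0) = x * (x + c) ^ card ?R'"
      if y: "y \<in> W" for y
    proof -
      let ?A = "?R' - {?top y}"
      have cR: "card ?R' = Suc (card ?A)"
        using finR top[OF y] by (rule card.remove)
      have "(\<Sum>Z\<in>Pow ?R'. if ?top y \<notin> Z then ?m Z else 0) = (\<Sum>Z\<in>Pow ?A. ?m Z)"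
        by (rule sum.mono_neutral_cong_right) (use finR in auto)
      also have "\<dots> = (\<Sum>Z\<in>Pow ?A. x * (c ^ card Z * x ^ card (?A - Z)))"
      proof (intro sum.cong refl)
        fix Z assume Z: "Z \<in> Pow ?A"
        have "?R' - Z = insert (?top y) (?A - Z)" using Z top[OF y] by auto
        then have "card (?R' - Z) = Suc (card (?A - Z))"
          using finR Z by (simp add: card_insert_if)
        then show "?m Z = x * (c ^ card Z * x ^ card (?A - Z))" by simp
      qed
      also have "\<dots> = x * (x + c) ^ card ?A"
        using binom[of ?A] finR by (simp add: sum_distrib_left[symmetric])
      finally show ?thesis using cR by simp
    qed
    have "(\<Sum>Z\<in>Pow ?R'. \<Sum>y\<in>?Y q Z. ?wt (q, Z, y)) =
      (\<Sum>Z\<in>Pow ?R'. ?in q * ?m Z * (x + (\<Sum>y\<in>W. if ?top y \<notin> Z then c else 0)))"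
    proof (intro sum.cong refl)
      fix Z
      have "(\<Sum>y\<in>?Y q Z. if y = r then x else c) = x + (\<Sum>y\<in>{y\<in>W. ?top y \<notin> Z}. if y = r then x else c)"
        using fin r by (subst sum.insert) auto
      also have "(\<Sum>y\<in>{y\<in>W. ?top y \<notin> Z}. if y = r then x else c) = (\<Sum>y\<in>W. if ?top y \<notin> Z then c else 0)"
        using r fin by (intro sum.mono_neutral_cong_left) auto
      finally show "(\<Sum>y\<in>?Y q Z. ?wt (q, Z, y)) = ?in q * ?m Z * (x + (\<Sum>y\<in>W. if ?top y \<notin> Z then c else 0))"
        by (simp add: sum_distrib_left[symmetric])
    qed
    also have "\<dots> = ?in q * (x * (\<Sum>Z\<in>Pow ?R'. ?m Z) +
        c * (\<Sum>y\<in>W. \<Sum>Z\<in>Pow ?R'. if ?top y \<notin> Z then ?m Z else 0))"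
    proof -
      have "(\<Sum>Z\<in>Pow ?R'. \<Sum>y\<in>W. ?m Z * (if ?top y \<notin> Z then c else 0)) =
         c * (\<Sum>y\<in>W. \<Sum>Z\<in>Pow ?R'. if ?top y \<notin> Z then ?m Z else 0)"
        unfolding sum_distrib_left by (subst sum.swap) (intro sum.cong, auto)
      then have swap: "(\<Sum>Z\<in>Pow ?R'. ?m Z * (\<Sum>y\<in>W. if ?top y \<notin> Z then c else 0)) =
         c * (\<Sum>y\<in>W. \<Sum>Z\<in>Pow ?R'. if ?top y \<notin> Z then ?m Z else 0)"
        by (simp only: sum_distrib_left)
      have "(\<Sum>Z\<in>A. I * m Z * (x + s Z)) = I * (x * (\<Sum>Z\<in>A. m Z) + (\<Sum>Z\<in>A. m Z * s Z))"
        for A :: "'a set set" and I and m s :: "'a set \<Rightarrow> real"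
        by (simp add: sum_distrib_left sum.distrib algebra_simps)
      then show ?thesis unfolding swap[symmetric] .
    qed
    finally have "(\<Sum>Z\<in>Pow ?R'. \<Sum>y\<in>?Y q Z. ?wt (q, Z, y)) = ?in q * (x * (x + c) ^ card ?R' +
        c * (\<Sum>y\<in>W. \<Sum>Z\<in>Pow ?R'. if ?top y \<notin> Z then ?m Z else 0))"
      unfolding binom[OF finR] .
    moreover have "(x + c) * X = I * (x * (x + c) * B + c * ((x + c) * C))" if "X = I * (x * B + c * C)"
      for X I B C :: real
      unfolding that by (simp add: algebra_simps)
    ultimately have "(x + c) * (\<Sum>Z\<in>Pow ?R'. \<Sum>y\<in>?Y q Z. ?wt (q, Z, y)) =
        ?in q * (x * (x + c) * (x + c) ^ card ?R' +
        c * ((x + c) * (\<Sum>y\<in>W. \<Sum>Z\<in>Pow ?R'. if ?top y \<notin> Z then ?m Z else 0)))"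
      by blast
    also have "(x + c) * (\<Sum>y\<in>W. \<Sum>Z\<in>Pow ?R'. if ?top y \<notin> Z then ?m Z else 0) =
        (\<Sum>y\<in>W. (x + c) * (\<Sum>Z\<in>Pow ?R'. if ?top y \<notin> Z then ?m Z else 0))"
      by (rule sum_distrib_left)
    also have "(\<Sum>y\<in>W. (x + c) * (\<Sum>Z\<in>Pow ?R'. if ?top y \<notin> Z then ?m Z else 0)) =
        real (card W) * (x * (x + c) ^ card ?R')"
      using restr by simp
    also have "?in q * (x * (x + c) * (x + c) ^ card ?R' + c * (real (card W) * (x * (x + c) ^ card ?R')))
       = x * (x + (real (card W) + 1) * c) * (?in q * (x + c) ^ card ?R')"
      by (simp add: algebra_simps)
    also have "?in q * (x + c) ^ card ?R' = (\<Prod>i\<in>W. if q i = r then x + c else w i (q i))"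
    proof -
      have "(\<Prod>i\<in>W. if q i = r then x + c else w i (q i)) =
         (\<Prod>i\<in>W - ?R'. if q i = r then x + c else w i (q i)) * (\<Prod>i\<in>?R'. if q i = r then x + c else w i (q i))"
        by (rule prod.subset_diff) (use fin in auto)
      also have "(\<Prod>i\<in>W - ?R'. if q i = r then x + c else w i (q i)) = ?in q"
        by (intro prod.cong) auto
      also have "(\<Prod>i\<in>?R'. if q i = r then x + c else w i (q i)) = (x + c) ^ card ?R'" by simp
      finally show ?thesis by simp
    qed
    finally show ?thesis .
  qed
  have "forest_sum w (insert v W) r = (\<Sum>t\<in>?D. ?wt t)"
    unfolding forest_sum_def
  proof (rule sum.reindex_bij_witness[of _ ?g ?f])
    fix p assume p: "p \<in> parent_maps (insert v W) r"
    show "?g (?f p) = p" by (rule gf[OF p])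
    show "?f p \<in> ?D" by (rule f_mem[OF p])
    show "?wt (?f p) = (\<Prod>i\<in>insert v W. w i (p i))"
      unfolding wt[OF f_mem[OF p]] gf[OF p] ..
  next
    fix t assume t: "t \<in> ?D"
    show "?f (?g t) = t" by (rule fg[OF t])
    show "?g t \<in> parent_maps (insert v W) r" by (rule g_mem[OF t])
  qed
  also have "\<dots> = (\<Sum>q\<in>parent_maps W r. \<Sum>t\<in>(SIGMA Z:Pow (?R q). ?Y q Z). ?wt (q, t))"
    by (rule sum_over_Sigma)
      (use fin finite_parent_maps[OF fin, of r] in \<open>auto intro!: finite_SigmaI\<close>)
  also have "\<dots> = (\<Sum>q\<in>parent_maps W r. \<Sum>Z\<in>Pow (?R q). \<Sum>y\<in>?Y q Z. ?wt (q, Z, y))"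
    by (intro sum.cong refl sum_over_Sigma) (use fin in auto)
  finally have "(x + c) * forest_sum w (insert v W) r =
      (\<Sum>q\<in>parent_maps W r. (x + c) * (\<Sum>Z\<in>Pow (?R q). \<Sum>y\<in>?Y q Z. ?wt (q, Z, y)))"
    by (simp only: sum_distrib_left)
  also have "\<dots> = (\<Sum>q\<in>parent_maps W r. x * (x + (real (card W) + 1) * c) *
      (\<Prod>i\<in>W. if q i = r then x + c else w i (q i)))"
    by (intro sum.cong refl inner)
  finally show ?thesis
    by (simp only: forest_sum_def sum_distrib_left)
qed

text \<open>
The vertex \<open>m\<close> has weight \<open>a m\<close> to every later vertex, so it can be removed by \<open>forest_sum_insert\<close>, at the
price of the root weight \<open>x + a m\<close>.
\<close>

lemma forest_sum_min:
  fixes a :: "nat \<Rightarrow> real"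
  assumes "m \<le> k" and "0 < x" and r: "r \<notin> {m..k}"
    and mono: "\<And>i j. m \<le> i \<Longrightarrow> i \<le> j \<Longrightarrow> j \<le> k \<Longrightarrow> a i \<le> a j" and pos: "\<And>i. m \<le> i \<Longrightarrow> i \<le> k \<Longrightarrow> 0 < a i"
  shows "forest_sum (\<lambda>i j. if j = r then x else min (a i) (a j)) {m..k} r =
         x * (\<Prod>j\<in>{m..<k}. x + (\<Sum>l\<in>{m..<j}. a l) + real (k - j + 1) * a j)"
  using assms
proof (induction m arbitrary: x rule: inc_induct)
  case base
  have "parent_maps {k} r = {\<lambda>i\<in>{k}. r}"
    using base by (auto simp: parent_maps_def PiE_def extensional_def Pi_def subset_singleton_iff)
  then show ?case by (simp add: forest_sum_def)
next
  case (step m)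
  let ?w = "\<lambda>x i j. if j = r then x else min (a i) (a j)"
  have split: "{m..k} = insert m {Suc m..k}" using step by auto
  have am: "0 < a m" using step by auto
  have IH: "forest_sum (?w (x + a m)) {Suc m..k} r =
     (x + a m) * (\<Prod>j\<in>{Suc m..<k}. (x + a m) + (\<Sum>l\<in>{Suc m..<j}. a l) + real (k - j + 1) * a j)"
    using step.prems am by (intro step.IH add_pos_pos) auto
  have "(x + a m) * forest_sum (?w x) {m..k} r =
      x * (x + (real (card {Suc m..k}) + 1) * a m) *
      forest_sum (\<lambda>i j. if j = r then x + a m else ?w x i j) {Suc m..k} r"
    unfolding split
    by (rule forest_sum_insert) (use step in \<open>auto intro!: min_absorb1 min_absorb2\<close>)
  moreover have "(\<lambda>i j. if j = r then x + a m else ?w x i j) = ?w (x + a m)" by (auto intro!: ext)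
  ultimately have "(x + a m) * forest_sum (?w x) {m..k} r = (x + a m) * (x * (x + (real (card {Suc m..k}) + 1) * a m) *
     (\<Prod>j\<in>{Suc m..<k}. (x + a m) + (\<Sum>l\<in>{Suc m..<j}. a l) + real (k - j + 1) * a j))"
    by (simp only: IH mult_ac)
  moreover have "x + a m \<noteq> 0" using step.prems am by simp
  ultimately have "forest_sum (?w x) {m..k} r = x * (x + (real (card {Suc m..k}) + 1) * a m) *
     (\<Prod>j\<in>{Suc m..<k}. (x + a m) + (\<Sum>l\<in>{Suc m..<j}. a l) + real (k - j + 1) * a j)"
    using mult_left_cancel by blast
  also have "(\<Prod>j\<in>{Suc m..<k}. (x + a m) + (\<Sum>l\<in>{Suc m..<j}. a l) + real (k - j + 1) * a j) =
     (\<Prod>j\<in>{Suc m..<k}. x + (\<Sum>l\<in>{m..<j}. a l) + real (k - j + 1) * a j)"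
    by (intro prod.cong refl) (simp add: sum.atLeast_Suc_lessThan)
  finally show ?case
    using step.hyps by (simp add: prod.atLeast_Suc_lessThan mult.assoc of_nat_diff)
qed

section \<open>Spanning trees as parent maps\<close>

definition parent_edges :: "'a set \<Rightarrow> ('a \<Rightarrow> 'a) \<Rightarrow> 'a set set" where
  "parent_edges W p = (\<lambda>i. {i, p i}) ` W"

lemma parent_maps_no_fixpoint:
  assumes "p \<in> parent_maps W r" "i \<in> W" shows "p i \<noteq> i"
  using parent_maps_exit[OF assms(1), of "{i}"] assms(2) by blast

lemma parent_maps_no_swap:
  assumes "p \<in> parent_maps W r" "i \<in> W" "j \<in> W" "p i = j" shows "p j \<noteq> i"
  using parent_maps_exit[OF assms(1), of "{i, j}"] assms(2-4) by blast

lemma inj_on_parent_edge: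
  assumes p: "p \<in> parent_maps W r"
  shows "inj_on (\<lambda>i. {i, p i}) W"
proof (rule inj_onI, rule ccontr)
  fix i j assume ij: "i \<in> W" "j \<in> W" "{i, p i} = {j, p j}" "i \<noteq> j"
  then have "p i = j" "p j = i" by (auto simp: doubleton_eq_iff)
  with parent_maps_no_swap[OF p ij(1,2)] show False by blast
qed

text \<open>
On a cycle, consider a vertex of maximal depth: both of its neighbours have to be its parent.
\<close>

lemma parent_edges_acyclic:
  assumes p: "p \<in> parent_maps W r" and r: "r \<notin> W"
    and L: "3 \<le> length vs" and dist: "distinct vs"
    and cyc: "\<forall>i<length vs. {vs ! i, vs ! (Suc i mod length vs)} \<in> parent_edges W p"
  shows False
proof -
  let ?L = "length vs" and ?d = "depth r p"
  have ne: "set vs \<noteq> {}" using L by auto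
  define M where "M = Max (?d ` set vs)"
  have "M \<in> ?d ` set vs" unfolding M_def using ne by (intro Max_in) auto
  then obtain m where m: "m < ?L" "?d (vs ! m) = M" by (auto simp: in_set_conv_nth)
  have max: "?d x \<le> M" if "x \<in> set vs" for x unfolding M_def using that by (intro Max_ge) auto
  have nb: "x = p (vs ! m)" if x: "x \<in> set vs" and e: "{vs ! m, x} \<in> parent_edges W p" for x
  proof (rule ccontr)
    assume ne: "x \<noteq> p (vs ! m)"
    from e obtain j where j: "j \<in> W" "{vs ! m, x} = {j, p j}" by (auto simp: parent_edges_def)
    with ne have "j = x" "p j = vs ! m" by (auto simp: doubleton_eq_iff)
    then have "?d x = Suc M" using depth_step[OF p j(1) r] m by simp
    with max[OF x] show False by simp
  qed
  define s where "s = (if m = ?L - 1 then 0 else Suc m)"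
  define q where "q = (if m = 0 then ?L - 1 else m - 1)"
  have "Suc m mod ?L = s \<and> s < ?L \<and> Suc q mod ?L = m \<and> q < ?L \<and> s \<noteq> q"
    using m(1) L by (cases "m = 0"; cases "Suc m = ?L") (auto simp: s_def q_def)
  then have s: "Suc m mod ?L = s" "s < ?L" and q: "Suc q mod ?L = m" "q < ?L" and sq: "s \<noteq> q"
    by auto
  have "{vs ! m, vs ! s} \<in> parent_edges W p" using cyc[rule_format, OF m(1)] unfolding s(1) .
  then have "vs ! s = p (vs ! m)" using s by (intro nb nth_mem)
  moreover have "{vs ! m, vs ! q} \<in> parent_edges W p"
    using cyc[rule_format, OF q(2)] unfolding q(1) by (simp only: insert_commute)
  then have "vs ! q = p (vs ! m)" using q by (intro nb nth_mem)
  ultimately have "s = q" using dist s q nth_eq_iff_index_eq[of vs s q] by simp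
  with sq show False ..
qed

lemma spanning_tree_parent_edges:
  assumes p: "p \<in> parent_maps W r" and r: "r \<notin> W"
  shows "spanning_tree_on (insert r W) (parent_edges W p)"
proof -
  let ?E = "{(v, w). {v, w} \<in> parent_edges W p}"
  have sub: "parent_edges W p \<subseteq> {{x, y} | x y. x \<in> insert r W \<and> y \<in> insert r W \<and> x \<noteq> y}"
    unfolding parent_edges_def using parent_maps_mem[OF p] parent_maps_no_fixpoint[OF p] by fastforce
  have sym: "sym (?E\<^sup>*)" by (intro sym_rtrancl symI) (auto simp: insert_commute)
  have "(i, r) \<in> ?E\<^sup>*" if "i \<in> W" for i
    using p r that
  proof (induction rule: parent_maps_induct)
    case (step i)
    have "(i, p i) \<in> ?E" using step(1) by (auto simp: parent_edges_def)
    moreover have "(p i, r) \<in> ?E\<^sup>*" using step parent_maps_mem[OF p step(1)] by auto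
    ultimately show ?case by (rule converse_rtrancl_into_rtrancl)
  qed
  then have "(i, r) \<in> ?E\<^sup>*" if "i \<in> insert r W" for i using that by auto
  then have "\<forall>x\<in>insert r W. \<forall>y\<in>insert r W. (x, y) \<in> ?E\<^sup>*"
    using sym by (meson rtrancl_trans symD)
  moreover have "\<not> (\<exists>vs. 3 \<le> length vs \<and> distinct vs \<and>
     (\<forall>i<length vs. {vs ! i, vs ! (Suc i mod length vs)} \<in> parent_edges W p))"
    using parent_edges_acyclic[OF p r] by blast
  ultimately show ?thesis unfolding spanning_tree_on_def using sub by blast
qed

text \<open>
If \<open>p\<close> and \<open>q\<close> have the same edges and differ at \<open>i\<close>, then \<open>q\<close> maps \<open>p i\<close> back to \<open>i\<close>, and \<open>p\<close> does not;
so the set of vertices where they differ is closed under \<open>p\<close>.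
\<close>

lemma inj_on_parent_edges:
  assumes r: "r \<notin> W"
  shows "inj_on (parent_edges W) (parent_maps W r)"
proof (rule inj_onI, rule ccontr)
  fix p q assume p: "p \<in> parent_maps W r" and q: "q \<in> parent_maps W r"
    and e: "parent_edges W p = parent_edges W q" and ne: "p \<noteq> q"
  let ?S = "{i \<in> W. p i \<noteq> q i}"
  have "p \<in> extensional W" "q \<in> extensional W" using p q by (auto simp: parent_maps_def PiE_def)
  then have "?S \<noteq> {}" using ne extensionalityI[of p W q] by auto
  then obtain i where i: "i \<in> ?S" "p i \<notin> ?S"
    using parent_maps_exit[OF p, of ?S] by blast
  have "{i, p i} \<in> parent_edges W q" using i e by (auto simp: parent_edges_def)
  then obtain j where j: "j \<in> W" "{i, p i} = {j, q j}" by (auto simp: parent_edges_def)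
  then have "j = p i" "q (p i) = i" using i by (auto simp: doubleton_eq_iff)
  with j(1) i(2) have "p (p i) = i" "p i \<in> W" by auto
  with parent_maps_no_swap[OF p] i show False by blast
qed

lemma simple_path:
  assumes "(x, y) \<in> R\<^sup>*"
  shows "\<exists>vs. vs \<noteq> [] \<and> hd vs = x \<and> last vs = y \<and> distinct vs \<and> successively (\<lambda>a b. (a, b) \<in> R) vs"
  using assms
proof (induction rule: rtrancl_induct)
  case base
  then show ?case by (intro exI[of _ "[x]"]) auto
next
  case (step y z)
  then obtain vs where vs: "vs \<noteq> []" "hd vs = x" "last vs = y" "distinct vs" "successively (\<lambda>a b. (a, b) \<in> R) vs"
    by blast
  show ?case
  proof (cases "z \<in> set vs")
    case False
    then show ?thesis using vs step(2)
      by (intro exI[of _ "vs @ [z]"]) (auto simp: successively_append_iff)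
  next
    case True
    then obtain as bs where "vs = as @ z # bs" by (auto simp: in_set_conv_decomp)
    then show ?thesis using vs
      by (intro exI[of _ "as @ [z]"]) (auto simp: successively_append_iff hd_append)
  qed
qed

text \<open>
The parent of a vertex is a neighbour that is closer to \<open>r\<close> in the graph distance.  These edges already connect
the graph, so a further edge would close a cycle.
\<close>

lemma spanning_tree_has_parent_map:
  assumes T: "spanning_tree_on (insert r W) T" and r: "r \<notin> W"
  shows "\<exists>p\<in>parent_maps W r. parent_edges W p = T"
proof -
  let ?E = "{(v, w). {v, w} \<in> T}"
  define d where "d = (\<lambda>i. LEAST n. (i, r) \<in> ?E ^^ n)"
  have sub: "T \<subseteq> {{x, y} | x y. x \<in> insert r W \<and> y \<in> insert r W \<and> x \<noteq> y}"
    and conn: "\<And>x y. x \<in> insert r W \<Longrightarrow> y \<in> insert r W \<Longrightarrow> (x, y) \<in> ?E\<^sup>*"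
    and acyc: "\<And>vs. 3 \<le> length vs \<Longrightarrow> distinct vs \<Longrightarrow>
      \<forall>i<length vs. {vs ! i, vs ! (Suc i mod length vs)} \<in> T \<Longrightarrow> False"
    using T unfolding spanning_tree_on_def by blast+
  have "\<exists>j. {i, j} \<in> T \<and> d j < d i \<and> j \<in> insert r W" if i: "i \<in> W" for i
  proof -
    have "(i, r) \<in> ?E\<^sup>*" using conn i by blast
    then obtain n where "(i, r) \<in> ?E ^^ n" by (auto simp: rtrancl_power)
    then have di: "(i, r) \<in> ?E ^^ d i" unfolding d_def by (rule LeastI)
    have "d i \<noteq> 0"
    proof
      assume "d i = 0"
      with di have "i = r" by simp
      with i r show False by simp
    qed
    then obtain n where n: "d i = Suc n" by (cases "d i") auto
    with di have "(i, r) \<in> ?E ^^ Suc n" by simp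
    then obtain j where j: "(i, j) \<in> ?E" "(j, r) \<in> ?E ^^ n" by (rule relpow_Suc_E2)
    have "d j \<le> n" unfolding d_def by (rule Least_le) (rule j(2))
    moreover have "j \<in> insert r W" using j(1) sub by (fastforce simp: doubleton_eq_iff)
    ultimately show ?thesis using j(1) n by auto
  qed
  then obtain p0 where p0: "\<And>i. i \<in> W \<Longrightarrow> {i, p0 i} \<in> T \<and> d (p0 i) < d i \<and> p0 i \<in> insert r W"
    by metis
  define p where "p = restrict p0 W"
  have pp: "{i, p i} \<in> T" "d (p i) < d i" "p i \<in> insert r W" if "i \<in> W" for i
    using p0[OF that] that by (auto simp: p_def)
  have "\<exists>i\<in>S. p i \<notin> S" if S: "S \<subseteq> W" "S \<noteq> {}" for S
  proof -
    obtain i where i: "i \<in> S" "\<And>j. j \<in> S \<Longrightarrow> d i \<le> d j"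
      using arg_min_natI[of "\<lambda>j. j \<in> S" _ d] arg_min_nat_le[of "\<lambda>j. j \<in> S" _ d] S(2) by blast
    have "p i \<notin> S" using i(2)[of "p i"] pp(2)[of i] i(1) S(1) by force
    then show ?thesis using i(1) by blast
  qed
  moreover have "p \<in> W \<rightarrow>\<^sub>E insert r W" using pp(3) by (auto simp: p_def)
  ultimately have p: "p \<in> parent_maps W r" unfolding parent_maps_def by blast
  have "parent_edges W p \<subseteq> T" using pp(1) by (auto simp: parent_edges_def)
  moreover have "e \<in> parent_edges W p" if e: "e \<in> T" for e
  proof (rule ccontr)
    assume ne: "e \<notin> parent_edges W p"
    obtain x y where xy: "e = {x, y}" "x \<in> insert r W" "y \<in> insert r W" "x \<noteq> y" using sub e by blast
    let ?F = "{(v, w). {v, w} \<in> parent_edges W p}"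
    have "(x, y) \<in> ?F\<^sup>*"
      using spanning_tree_parent_edges[OF p r] xy unfolding spanning_tree_on_def by blast
    from simple_path[OF this] obtain vs where vs: "vs \<noteq> []" "hd vs = x" "last vs = y" "distinct vs"
        and suc: "successively (\<lambda>a b. (a, b) \<in> ?F) vs" by blast
    have step: "{vs ! i, vs ! Suc i} \<in> parent_edges W p" if "Suc i < length vs" for i
      using suc that by (auto simp: successively_conv_nth)
    have h: "vs ! 0 = x" "vs ! (length vs - 1) = y" using vs by (auto simp: hd_conv_nth last_conv_nth)
    have "length vs \<noteq> 0" "length vs \<noteq> 1" "length vs \<noteq> 2"
      using vs xy h step[of 0] ne by (auto simp: numeral_2_eq_2)
    then have "3 \<le> length vs" by linarith
    moreover have "{vs ! i, vs ! (Suc i mod length vs)} \<in> T" if i: "i < length vs" for i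
    proof (cases "Suc i < length vs")
      case True
      then show ?thesis using step[OF True] \<open>parent_edges W p \<subseteq> T\<close> by auto
    next
      case False
      then have "i = length vs - 1" "Suc i = length vs" using i by auto
      then show ?thesis using h e xy(1) by (simp add: insert_commute)
    qed
    ultimately show False using acyc[of vs] vs(4) by blast
  qed
  ultimately show ?thesis using p by blast
qed

lemma bij_betw_parent_edges:
  assumes r: "r \<notin> W"
  shows "bij_betw (parent_edges W) (parent_maps W r) {T. spanning_tree_on (insert r W) T}"
proof (rule bij_betw_imageI[OF inj_on_parent_edges[OF r]], intro equalityI subsetI)
  fix T assume "T \<in> {T. spanning_tree_on (insert r W) T}"
  then show "T \<in> parent_edges W ` parent_maps W r"
    using spanning_tree_has_parent_map[OF _ r] by auto
qed (use spanning_tree_parent_edges[OF _ r] in auto)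

lemma finite_spanning_trees: "finite V \<Longrightarrow> finite {T. spanning_tree_on V T}"
  by (rule finite_subset[of _ "Pow (Pow V)"]) (auto simp: spanning_tree_on_def)

lemma tree_weight_parent_edges:
  assumes p: "p \<in> parent_maps W r"
  shows "tree_weight a (parent_edges W p) = (\<Prod>i\<in>W. min (a i) (a (p i)))"
  unfolding tree_weight_def parent_edges_def
  by (subst prod.reindex[OF inj_on_parent_edge[OF p]]) simp

text \<open>
Root the spanning trees at the vertex \<open>1\<close>.  Its edges all have weight \<open>a 1\<close>, so the trees are the forests on
\<open>{2..k}\<close> with root weight \<open>a 1\<close>; the factor \<open>k\<close> supplies the factor for \<open>j = 1\<close>.
\<close>

lemma sum_tree_weight:
  fixes a :: "nat \<Rightarrow> real"
  assumes k: "1 \<le> k" and pos: "\<And>i. i \<in> {1..k} \<Longrightarrow> 0 < a i"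
    and mono: "\<And>i j. 1 \<le> i \<Longrightarrow> i \<le> j \<Longrightarrow> j \<le> k \<Longrightarrow> a i \<le> a j"
  shows "real k * (\<Sum>T | spanning_tree_on {1..k} T. tree_weight a T) =
    (\<Prod>j=1..k-1. real (k - j + 1) * a j + (\<Sum>m=1..j-1. a m))"
proof -
  let ?w = "\<lambda>i j. if j = 1 then a 1 else min (a i) (a j)"
  have V: "{1..k} = insert 1 {2..k}" using k by auto
  have r: "1 \<notin> {2..k}" by simp
  have "(\<Sum>T | spanning_tree_on {1..k} T. tree_weight a T) =
      (\<Sum>p\<in>parent_maps {2..k} 1. tree_weight a (parent_edges {2..k} p))"
    unfolding V by (rule sum.reindex_bij_betw[OF bij_betw_parent_edges[OF r], symmetric])
  also have "\<dots> = forest_sum ?w {2..k} 1"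
    unfolding forest_sum_def
  proof (intro sum.cong refl)
    fix p assume p: "p \<in> parent_maps {2..k} 1"
    show "tree_weight a (parent_edges {2..k} p) = (\<Prod>i\<in>{2..k}. ?w i (p i))"
      unfolding tree_weight_parent_edges[OF p]
      using mono by (intro prod.cong refl) (auto intro!: min_absorb2)
  qed
  finally have sum: "(\<Sum>T | spanning_tree_on {1..k} T. tree_weight a T) = forest_sum ?w {2..k} 1" .
  show ?thesis
  proof (cases "k = 1")
    case True
    have "parent_maps {} (1::nat) = {\<lambda>_. undefined}" by (auto simp: parent_maps_def)
    then show ?thesis unfolding sum using True by (simp add: forest_sum_def)
  next
    case False
    then have k2: "2 \<le> k" using k by simp
    have "real k * forest_sum ?w {2..k} 1 = real k * a 1 *
       (\<Prod>j\<in>{2..<k}. a 1 + (\<Sum>l\<in>{2..<j}. a l) + real (k - j + 1) * a j)"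
      by (subst forest_sum_min) (use k2 pos mono in auto)
    also have "\<dots> = (\<Prod>j\<in>{1..<k}. real (k - j + 1) * a j + (\<Sum>m\<in>{1..<j}. a m))"
    proof -
      have "(\<Sum>m\<in>{1..<j}. a m) = a 1 + (\<Sum>m\<in>{2..<j}. a m)" if "2 \<le> j" for j
        using that by (simp add: sum.atLeast_Suc_lessThan numeral_2_eq_2)
      then have "(\<Prod>j\<in>{2..<k}. a 1 + (\<Sum>l\<in>{2..<j}. a l) + real (k - j + 1) * a j) =
        (\<Prod>j\<in>{2..<k}. real (k - j + 1) * a j + (\<Sum>m\<in>{1..<j}. a m))"
        by (intro prod.cong refl) auto
      then show ?thesis
        using k2 by (subst (2) prod.atLeast_Suc_lessThan) (auto simp: numeral_2_eq_2)
    qed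
    also have "\<dots> = (\<Prod>j=1..k-1. real (k - j + 1) * a j + (\<Sum>m=1..j-1. a m))"
      using k2 by (intro prod.cong sum.cong arg_cong2[where f = "(+)"]) auto
    finally show ?thesis unfolding sum .
  qed
qed

section \<open>The age law\<close>

definition age_density :: "real \<Rightarrow> real" where
  "age_density x = 1 / 2 * (1 / cosh (x / 2))\<^sup>2"

lemma age_density_pos: "0 < age_density x"
  by (simp add: age_density_def)

lemma age_density_le_1: "age_density x \<le> 1"
proof -
  have "(1 / cosh (x / 2))\<^sup>2 \<le> 1"
    using cosh_real_ge_1[of "x / 2"] by (intro power_le_one) auto
  then show ?thesis by (simp add: age_density_def)
qed

lemma measurable_age_density [measurable]: "age_density \<in> borel_measurable borel"
  unfolding age_density_def by (intro borel_measurable_continuous_onI continuous_intros) auto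

lemma space_age_law [simp]: "space age_law = {0..}"
  by (simp add: age_law_def space_restrict_space)

lemma sets_age_law: "B \<in> sets age_law \<longleftrightarrow> B \<in> sets borel \<and> B \<subseteq> {0..}"
  by (auto simp: age_law_def sets_restrict_space_iff)

lemma space_age_intensity [simp]: "space (age_intensity s) = {0..}"
  by (simp add: age_intensity_def)

lemma measurable_age_law_borel: "f \<in> borel_measurable borel \<Longrightarrow> f \<in> borel_measurable age_law"
  by (simp add: age_law_def measurable_restrict_space1)

lemma nn_integral_age_law:
  assumes [measurable]: "f \<in> borel_measurable borel" and B: "B \<in> sets age_law"
  shows "(\<integral>\<^sup>+x. f x * indicator B x \<partial>age_law) = (\<integral>\<^sup>+x. ennreal (age_density x) * f x * indicator B x \<partial>lborel)"
proof -
  have [measurable]: "B \<in> sets borel" and sub: "B \<subseteq> {0..}" using B by (auto simp: sets_age_law)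
  have "(\<integral>\<^sup>+x. f x * indicator B x \<partial>age_law) =
      (\<integral>\<^sup>+x. ennreal (age_density x) * (f x * indicator B x) \<partial>restrict_space lborel {0..})"
    unfolding age_law_def age_density_def[symmetric]
    by (rule nn_integral_density; rule measurable_restrict_space1) measurable
  also have "\<dots> = (\<integral>\<^sup>+x. ennreal (age_density x) * f x * indicator B x \<partial>lborel)"
  proof (subst nn_integral_restrict_space)
    show "(\<integral>\<^sup>+x. ennreal (age_density x) * (f x * indicator B x) * indicator {0..} x \<partial>lborel) =
        (\<integral>\<^sup>+x. ennreal (age_density x) * f x * indicator B x \<partial>lborel)"
      using sub by (intro nn_integral_cong) (auto simp: mult.assoc split: split_indicator)
  qed simp
  finally show ?thesis .
qed

lemma emeasure_age_law:
  assumes B: "B \<in> sets age_law"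
  shows "emeasure age_law B = (\<integral>\<^sup>+x. ennreal (age_density x) * indicator B x \<partial>lborel)"
  using nn_integral_age_law[of "\<lambda>_. 1" B] B by simp

lemma emeasure_age_intensity:
  assumes B: "B \<in> sets age_law"
  shows "emeasure (age_intensity s) B =
    (\<integral>\<^sup>+x. ennreal (age_density x) * ennreal (min x s) * indicator B x \<partial>lborel)"
proof -
  have "emeasure (age_intensity s) B = (\<integral>\<^sup>+x. ennreal (min x s) * indicator B x \<partial>age_law)"
    unfolding age_intensity_def by (intro emeasure_density measurable_age_law_borel B) measurable
  also have "\<dots> = (\<integral>\<^sup>+x. ennreal (age_density x) * ennreal (min x s) * indicator B x \<partial>lborel)"
    by (rule nn_integral_age_law) (use B in auto)
  finally show ?thesis .
qed

lemma has_real_derivative_tanh_half: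
  "((\<lambda>x. tanh (x / 2)) has_real_derivative age_density x) (at x)"
proof -
  have "1 - (tanh (x / 2))\<^sup>2 = ((cosh (x / 2))\<^sup>2 - (sinh (x / 2))\<^sup>2) / (cosh (x / 2))\<^sup>2"
    by (simp add: tanh_def power_divide diff_divide_distrib)
  also have "\<dots> = (1 / cosh (x / 2))\<^sup>2"
    by (simp add: cosh_square_eq power_divide)
  finally have "1 - (tanh (x / 2))\<^sup>2 = (1 / cosh (x / 2))\<^sup>2" .
  moreover have "((\<lambda>x. tanh (x / 2)) has_real_derivative (1 - (tanh (x / 2))\<^sup>2) * (1 / 2)) (at x)"
    by (auto intro!: derivative_eq_intros)
  ultimately show ?thesis by (simp add: age_density_def)
qed

lemma has_real_derivative_ln_cosh_half:
  "((\<lambda>x::real. 2 * ln (cosh (x / 2))) has_real_derivative tanh (x / 2)) (at x)"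
  by (auto intro!: derivative_eq_intros simp: tanh_def)

text \<open>
Below \<open>s\<close> the integrand is \<open>x h(x)\<close> and above it is \<open>s h(x)\<close>, where \<open>h\<close> is the derivative of
\<open>tanh (x / 2)\<close>.
\<close>

lemma emeasure_age_intensity_total:
  assumes s: "0 \<le> s"
  shows "emeasure (age_intensity s) {0..} = ennreal (s - 2 * ln (cosh (s / 2)))"
proof -
  let ?F = "\<lambda>x. x * tanh (x / 2) - 2 * ln (cosh (x / 2))" and ?G = "\<lambda>x. s * tanh (x / 2)"
  have F: "(?F has_real_derivative x * age_density x) (at x)" for x
    by (rule derivative_eq_intros has_real_derivative_tanh_half has_real_derivative_ln_cosh_half refl)+ simp
  have G: "(?G has_real_derivative s * age_density x) (at x)" for x
    by (rule derivative_eq_intros has_real_derivative_tanh_half refl)+ simp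
  have tend: "((\<lambda>x::real. tanh (x / 2)) \<longlongrightarrow> 1) at_top"
  proof (rule filterlim_compose[OF tanh_real_at_top])
    have "filterlim (\<lambda>x::real. 1 / 2 * x) at_top at_top"
      by (rule filterlim_tendsto_pos_mult_at_top[OF tendsto_const _ filterlim_ident]) simp
    then show "filterlim (\<lambda>x::real. x / 2) at_top at_top" by simp
  qed
  have "emeasure (age_intensity s) {0..} =
     (\<integral>\<^sup>+x. ennreal (age_density x) * ennreal (min x s) * indicator {0..} x \<partial>lborel)"
    by (rule emeasure_age_intensity) (simp add: sets_age_law)
  also have "\<dots> = (\<integral>\<^sup>+x. ennreal (x * age_density x) * indicator {0..s} x +
      ennreal (s * age_density x) * indicator {s..} x \<partial>lborel)"
  proof (rule nn_integral_cong_AE)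
    have "AE x in lborel. x \<noteq> s" by (rule AE_lborel_singleton)
    then show "AE x in lborel. ennreal (age_density x) * ennreal (min x s) * indicator {0..} x =
       ennreal (x * age_density x) * indicator {0..s} x + ennreal (s * age_density x) * indicator {s..} x"
    proof eventually_elim
      case (elim x)
      have h: "0 \<le> age_density x" using age_density_pos[of x] by simp
      consider "x < 0" | "0 \<le> x" "x < s" | "s < x" using elim by linarith
      then show ?case
      proof cases
        case 1
        then show ?thesis using s by simp
      next
        case 2
        then show ?thesis using h by (simp add: min_absorb1 ennreal_mult mult.commute)
      next
        case 3
        then show ?thesis using h s by (simp add: min_absorb2 ennreal_mult mult.commute)
      qed
    qed
  qed
  also have "\<dots> = (\<integral>\<^sup>+x. ennreal (x * age_density x) * indicator {0..s} x \<partial>lborel) +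
      (\<integral>\<^sup>+x. ennreal (s * age_density x) * indicator {s..} x \<partial>lborel)"
    by (rule nn_integral_add) auto
  also have "(\<integral>\<^sup>+x. ennreal (x * age_density x) * indicator {0..s} x \<partial>lborel) = ennreal (?F s - ?F 0)"
    by (rule nn_integral_FTC_Icc)
      (use s F in \<open>auto intro!: has_field_derivative_at_within mult_nonneg_nonneg less_imp_le[OF age_density_pos]\<close>)
  also have "(\<integral>\<^sup>+x. ennreal (s * age_density x) * indicator {s..} x \<partial>lborel) = ennreal (s * 1 - ?G s)"
  proof (rule nn_integral_FTC_atLeast[where F = ?G])
    show "(?G \<longlongrightarrow> s * 1) at_top" by (rule tendsto_mult[OF tendsto_const tend])
    show "(?G has_real_derivative s * age_density x) (at x)" for x by (rule G)
    show "0 \<le> s * age_density x" for x using s age_density_pos[of x] by simp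
  qed simp
  also have "ennreal (?F s - ?F 0) + ennreal (s * 1 - ?G s) = ennreal ((?F s - ?F 0) + (s * 1 - ?G s))"
  proof (rule ennreal_plus[symmetric])
    have "?F 0 \<le> ?F s"
    proof (rule DERIV_nonneg_imp_nondecreasing[OF s])
      fix x :: real assume "0 \<le> x"
      then have "0 \<le> x * age_density x" using age_density_pos[of x] by simp
      with F[of x] show "\<exists>y. (?F has_real_derivative y) (at x) \<and> 0 \<le> y"
        by (intro exI[of _ "x * age_density x"] conjI)
    qed
    then show "0 \<le> ?F s - ?F 0" by simp
    have "tanh (s / 2) \<le> 1" using tanh_real_lt_1[of "s / 2"] by simp
    then have "s * tanh (s / 2) \<le> s * 1" using s by (intro mult_left_mono) auto
    then show "0 \<le> s * 1 - ?G s" by simp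
  qed
  finally show ?thesis by simp
qed

lemma emeasure_age_intensity_eq_measure:
  assumes s: "0 \<le> s" and B: "B \<in> sets age_law"
  shows "emeasure (age_intensity s) B = ennreal (measure (age_intensity s) B)"
proof -
  have "emeasure (age_intensity s) B \<le> emeasure (age_intensity s) {0..}"
    using B by (intro emeasure_mono) (auto simp: sets_age_law age_intensity_def)
  also have "\<dots> < \<infinity>" unfolding emeasure_age_intensity_total[OF s] by simp
  finally show ?thesis by (intro emeasure_eq_ennreal_measure) auto
qed

text \<open>
The identity that makes the whole computation explicit: \<open>exp (- \<Lambda>(s)) = exp (- s) cosh\<^sup>2 (s / 2)\<close> cancels the
hyperbolic factor of the density.
\<close>

lemma void_probability_times_age_density:
  assumes s: "0 \<le> s"
  shows "exp (- measure (age_intensity s) {0..}) * age_density s = exp (- s) / 2"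
proof -
  have "2 * ln (cosh (s / 2)) \<le> s"
  proof -
    have "cosh (s / 2) \<le> exp (s / 2)" using s by (simp add: cosh_def)
    then have "ln (cosh (s / 2)) \<le> ln (exp (s / 2))" by (subst ln_le_cancel_iff) auto
    then show ?thesis by simp
  qed
  then have "measure (age_intensity s) {0..} = s - 2 * ln (cosh (s / 2))"
    unfolding measure_def emeasure_age_intensity_total[OF s] by simp
  then have "- measure (age_intensity s) {0..} = - s + 2 * ln (cosh (s / 2))" by simp
  then have "exp (- measure (age_intensity s) {0..}) = exp (- s) * exp (2 * ln (cosh (s / 2)))"
    by (simp only: exp_add)
  also have "exp (2 * ln (cosh (s / 2))) = (cosh (s / 2))\<^sup>2"
    by (simp add: exp_double)
  finally show ?thesis
    by (simp add: age_density_def power_divide)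
qed

lemma measurable_age_intensity [measurable]:
  assumes B: "B \<in> sets age_law"
  shows "(\<lambda>s. measure (age_intensity s) B) \<in> borel_measurable borel"
proof -
  have [measurable]: "B \<in> sets borel" using B by (simp add: sets_age_law)
  show ?thesis
    unfolding measure_def emeasure_age_intensity[OF B] by measurable
qed

lemma measure_age_intensity_le:
  assumes B: "B \<in> sets borel" "B \<subseteq> {0..K}" and fin: "emeasure lborel B = ennreal d" "0 \<le> d" "0 \<le> K"
  shows "measure (age_intensity s) B \<le> K * d"
proof -
  have B': "B \<in> sets age_law" using B by (auto simp: sets_age_law)
  have "emeasure (age_intensity s) B \<le> (\<integral>\<^sup>+x. ennreal K * indicator B x \<partial>lborel)"
    unfolding emeasure_age_intensity[OF B']
  proof (intro nn_integral_mono)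
    fix x
    have "ennreal (age_density x) * ennreal (min x s) \<le> 1 * ennreal K" if "x \<in> B"
      using that B age_density_le_1[of x] by (intro mult_mono ennreal_leI) (auto intro!: min.coboundedI1)
    then show "ennreal (age_density x) * ennreal (min x s) * indicator B x \<le> ennreal K * indicator B x"
      by (auto split: split_indicator)
  qed
  also have "\<dots> = ennreal (K * d)" using B fin by (subst nn_integral_cmult_indicator) (auto simp: ennreal_mult)
  finally show ?thesis
    unfolding measure_def using fin by (intro enn2real_leI) auto
qed

section \<open>Conditional offspring counts\<close>

locale age_galton_watson =
  fixes M :: "'w measure" and H :: "'w \<Rightarrow> nat list \<rightharpoonup> real"
  assumes galton_watson: "poisson_galton_watson M age_law age_intensity H"
begin

abbreviation age :: "nat list \<Rightarrow> 'w \<Rightarrow> real" where "age u \<omega> \<equiv> the (H \<omega> u)"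
abbreviation G :: "nat \<Rightarrow> 'w measure" where "G \<equiv> generation_algebra M age_law H"

sublocale prob_space M
  using galton_watson by (simp add: poisson_galton_watson_def)

lemma typed_tree_H: "\<omega> \<in> space M \<Longrightarrow> typed_tree {0..} (H \<omega>)"
  using galton_watson by (simp add: poisson_galton_watson_def)

lemma sets_type_event: "B \<in> sets age_law \<Longrightarrow> {\<omega> \<in> space M. \<exists>x\<in>B. H \<omega> u = Some x} \<in> sets M"
  using galton_watson by (simp add: poisson_galton_watson_def)

lemma root_law: "distr M age_law (age []) = age_law"
  using galton_watson by (simp add: poisson_galton_watson_def)

lemma offspring_law:
  assumes "finite U" "\<And>u. u \<in> U \<Longrightarrow> length u = n" "finite J"
    "\<And>u j. u \<in> U \<Longrightarrow> j \<in> J \<Longrightarrow> B u j \<in> sets age_law"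
    "\<And>u. u \<in> U \<Longrightarrow> disjoint_family_on (B u) (J::nat set)"
  shows "AE \<omega> in M. U \<subseteq> dom (H \<omega>) \<longrightarrow>
           real_cond_exp M (G n)
             (indicator {\<omega> \<in> space M. \<forall>u\<in>U. \<forall>j\<in>J. children_count (H \<omega>) u (B u j) = c u j}) \<omega>
           = (\<Prod>u\<in>U. \<Prod>j\<in>J. poisson_prob (measure (age_intensity (age u \<omega>)) (B u j)) (c u j))"
proof -
  have law: "\<forall>n U J B c. finite U \<and> (\<forall>u\<in>U. length u = n) \<and> finite J \<and>
        (\<forall>u\<in>U. \<forall>j\<in>J. B u j \<in> sets age_law) \<and> (\<forall>u\<in>U. disjoint_family_on (B u) J) \<longrightarrow>
        (AE \<omega> in M. U \<subseteq> dom (H \<omega>) \<longrightarrow>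
           real_cond_exp M (G n)
             (indicator {\<omega> \<in> space M. \<forall>u\<in>U. \<forall>j\<in>J. children_count (H \<omega>) u (B u j) = c u j}) \<omega>
           = (\<Prod>u\<in>U. \<Prod>j\<in>(J::nat set). poisson_prob (measure (age_intensity (age u \<omega>)) (B u j)) (c u j)))"
    using galton_watson unfolding poisson_galton_watson_def by (elim conjE) assumption
  show ?thesis by (rule law[rule_format]) (use assms in simp)
qed

lemma root_mem: "\<omega> \<in> space M \<Longrightarrow> [] \<in> dom (H \<omega>)"
  using typed_tree_H by (auto simp: typed_tree_def)

lemma parent_mem: "\<omega> \<in> space M \<Longrightarrow> u @ [i] \<in> dom (H \<omega>) \<Longrightarrow> u \<in> dom (H \<omega>)"
  using typed_tree_H unfolding typed_tree_def by blast

lemma finite_children: "\<omega> \<in> space M \<Longrightarrow> finite {i. u @ [i] \<in> dom (H \<omega>)}"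
  using typed_tree_H by (auto simp: typed_tree_def)

lemma age_nonneg: "\<omega> \<in> space M \<Longrightarrow> u \<in> dom (H \<omega>) \<Longrightarrow> 0 \<le> age u \<omega>"
proof -
  assume a: "\<omega> \<in> space M" "u \<in> dom (H \<omega>)"
  then have "age u \<omega> \<in> ran (H \<omega>)" by (auto simp: ran_def)
  then show ?thesis using typed_tree_H[OF a(1)] by (auto simp: typed_tree_def)
qed

lemma space_G [simp]: "space (G n) = space M"
  unfolding generation_algebra_def by (rule space_measure_of) auto

lemma sets_G_type_event:
  assumes "length u \<le> n" "B \<in> sets age_law"
  shows "{\<omega> \<in> space M. \<exists>x\<in>B. H \<omega> u = Some x} \<in> sets (G n)"
  unfolding generation_algebra_def by (rule in_measure_of) (use assms in auto)

lemma sets_G_subset: "sets (G n) \<subseteq> sets M"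
proof -
  have "sigma_sets (space M) {{\<omega> \<in> space M. \<exists>x\<in>B. H \<omega> u = Some x} | u B. length u \<le> n \<and> B \<in> sets age_law} \<subseteq> sets M"
    by (rule sets.sigma_sets_subset) (use sets_type_event in blast)
  moreover have "sets (G n) = sigma_sets (space M) {{\<omega> \<in> space M. \<exists>x\<in>B. H \<omega> u = Some x} | u B. length u \<le> n \<and> B \<in> sets age_law}"
    unfolding generation_algebra_def by (rule sets_measure_of) auto
  ultimately show ?thesis by simp
qed

lemma subalgebra_G: "subalgebra M (G n)"
  using sets_G_subset by (auto simp: subalgebra_def)

text \<open>
Where \<open>u\<close> is not a vertex, \<open>age u\<close> is the unspecified value \<open>the None\<close>; events about ages therefore always ask
for \<open>u\<close> to be a vertex.
\<close>

lemma type_event_iff: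
  assumes "\<omega> \<in> space M"
  shows "(\<exists>x\<in>B \<inter> {0..}. H \<omega> u = Some x) \<longleftrightarrow> u \<in> dom (H \<omega>) \<and> age u \<omega> \<in> B"
proof (cases "H \<omega> u")
  case (Some y)
  then have "0 \<le> y" using age_nonneg[OF assms, of u] by auto
  with Some show ?thesis by auto
qed auto

lemma sets_G_vertex_age:
  assumes "length u \<le> n" "B \<in> sets borel"
  shows "{\<omega> \<in> space M. u \<in> dom (H \<omega>) \<and> age u \<omega> \<in> B} \<in> sets (G n)"
proof -
  have "B \<inter> {0..} \<in> sets age_law" using assms(2) by (auto simp: sets_age_law)
  from sets_G_type_event[OF assms(1) this] show ?thesis
    by (simp add: type_event_iff cong: conj_cong)
qed

lemma sets_G_vertex: "length u \<le> n \<Longrightarrow> {\<omega> \<in> space M. u \<in> dom (H \<omega>)} \<in> sets (G n)"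
  using sets_G_vertex_age[of u n UNIV] by simp

lemma measurable_G_age: "length u \<le> n \<Longrightarrow> age u \<in> borel_measurable (G n)"
proof (rule measurableI)
  fix B :: "real set" assume u: "length u \<le> n" and B: "B \<in> sets borel"
  have "age u -` B \<inter> space (G n) = {\<omega> \<in> space M. u \<in> dom (H \<omega>) \<and> age u \<omega> \<in> B} \<union>
     (if the (None :: real option) \<in> B then space (G n) - {\<omega> \<in> space M. u \<in> dom (H \<omega>)} else {})"
    (is "?L = ?R")
  proof (rule set_eqI)
    show "\<omega> \<in> ?L \<longleftrightarrow> \<omega> \<in> ?R" for \<omega> by (cases "H \<omega> u") auto
  qed
  also have "\<dots> \<in> sets (G n)"
    by (intro sets.Un sets_G_vertex_age[OF u B])
       (use sets.compl_sets[OF sets_G_vertex[OF u]] in auto)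
  finally show "age u -` B \<inter> space (G n) \<in> sets (G n)" .
qed simp

lemma measurable_vertex [measurable]: "Measurable.pred M (\<lambda>\<omega>. u \<in> dom (H \<omega>))"
  using sets_G_vertex[of u "length u"] sets_G_subset by (auto simp: pred_def)

lemma measurable_age [measurable]: "age u \<in> borel_measurable M"
  by (rule measurable_from_subalg[OF subalgebra_G[of "length u"] measurable_G_age]) simp

lemma children_count_eq_iff:
  assumes "\<omega> \<in> space M"
  shows "children_count (H \<omega>) u B = c \<longleftrightarrow>
    (\<exists>xs::nat list. distinct xs \<and> length xs = c \<and> (\<forall>i. i \<in> set xs \<longleftrightarrow> u @ [i] \<in> dom (H \<omega>) \<and> age (u @ [i]) \<omega> \<in> B))"
proof -
  let ?C = "{i. \<exists>x\<in>B. H \<omega> (u @ [i]) = Some x}"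
  have fin: "finite ?C" by (rule finite_subset[OF _ finite_children[OF assms, of u]]) auto
  have C: "?C = {i. u @ [i] \<in> dom (H \<omega>) \<and> age (u @ [i]) \<omega> \<in> B}" by auto
  show ?thesis
  proof
    assume "children_count (H \<omega>) u B = c"
    moreover obtain xs where "set xs = ?C" "distinct xs" using finite_distinct_list[OF fin] by blast
    ultimately show "\<exists>xs. distinct xs \<and> length xs = c \<and> (\<forall>i. i \<in> set xs \<longleftrightarrow> u @ [i] \<in> dom (H \<omega>) \<and> age (u @ [i]) \<omega> \<in> B)"
      unfolding children_count_def C using distinct_card[of xs] by auto
  next
    assume "\<exists>xs. distinct xs \<and> length xs = c \<and> (\<forall>i. i \<in> set xs \<longleftrightarrow> u @ [i] \<in> dom (H \<omega>) \<and> age (u @ [i]) \<omega> \<in> B)"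
    then obtain xs where "distinct xs" "length xs = c" "set xs = ?C" unfolding C by blast
    then show "children_count (H \<omega>) u B = c" unfolding children_count_def using distinct_card[of xs] by metis
  qed
qed

lemma measurable_children_count:
  assumes [measurable]: "B \<in> sets borel"
  shows "Measurable.pred M (\<lambda>\<omega>. children_count (H \<omega>) u B = c)"
proof -
  have "Measurable.pred M (\<lambda>\<omega>. \<exists>xs::nat list. distinct xs \<and> length xs = c \<and>
     (\<forall>i. i \<in> set xs \<longleftrightarrow> u @ [i] \<in> dom (H \<omega>) \<and> age (u @ [i]) \<omega> \<in> B))"
    by measurable
  then show ?thesis
    by (rule measurable_cong[THEN iffD2, rotated]) (rule children_count_eq_iff)
qed

text \<open>
The conditional offspring law in integrated form, on events \<open>A\<close> of the first \<open>n\<close> generations on which the vertices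
in \<open>U\<close> exist.
\<close>

lemma offspring_probability:
  fixes c :: "nat list \<Rightarrow> nat \<Rightarrow> nat"
  assumes U: "finite U" "\<And>u. u \<in> U \<Longrightarrow> length u = n" and J: "finite J"
    and B: "\<And>u j. u \<in> U \<Longrightarrow> j \<in> J \<Longrightarrow> B u j \<in> sets age_law"
    and disj: "\<And>u. u \<in> U \<Longrightarrow> disjoint_family_on (B u) (J::nat set)"
    and A: "A \<in> sets (G n)" "\<And>\<omega>. \<omega> \<in> A \<Longrightarrow> U \<subseteq> dom (H \<omega>)"
  defines "q \<equiv> \<lambda>\<omega>. \<Prod>u\<in>U. \<Prod>j\<in>J. poisson_prob (measure (age_intensity (age u \<omega>)) (B u j)) (c u j)"
  shows "emeasure M (A \<inter> {\<omega> \<in> space M. \<forall>u\<in>U. \<forall>j\<in>J. children_count (H \<omega>) u (B u j) = c u j}) =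
    (\<integral>\<^sup>+\<omega>. ennreal (q \<omega>) * indicator A \<omega> \<partial>M)"
proof -
  let ?C = "{\<omega> \<in> space M. \<forall>u\<in>U. \<forall>j\<in>J. children_count (H \<omega>) u (B u j) = c u j}"
  let ?e = "real_cond_exp M (G n) (indicator ?C)"
  interpret finite_measure_subalgebra M "G n"
    by unfold_locales (rule subalgebra_G)
  have B': "B u j \<in> sets borel" if "u \<in> U" "j \<in> J" for u j
    using B[OF that] by (simp add: sets_age_law)
  have AM: "A \<in> sets M" using A(1) sets_G_subset by auto
  have "Measurable.pred M (\<lambda>\<omega>. \<forall>u\<in>U. \<forall>j\<in>J. children_count (H \<omega>) u (B u j) = c u j)"
    by (intro pred_intros_finite U J measurable_children_count B')
  then have C: "?C \<in> sets M" by (simp add: pred_def)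
  have int: "integrable M (indicator ?C :: 'w \<Rightarrow> real)"
    using C by (intro integrable_real_indicator) (auto simp: less_top[symmetric])
  have qm: "q \<in> borel_measurable M"
    unfolding q_def poisson_prob_def
    using measurable_compose[OF measurable_age measurable_age_intensity[OF B]]
    by (intro borel_measurable_prod borel_measurable_times borel_measurable_divide borel_measurable_power borel_measurable_const)
       (auto intro!: borel_measurable_exp borel_measurable_uminus)
  have q0: "0 \<le> q \<omega>" for \<omega>
    unfolding q_def poisson_prob_def by (intro prod_nonneg ballI mult_nonneg_nonneg divide_nonneg_nonneg) auto
  have "AE \<omega> in M. U \<subseteq> dom (H \<omega>) \<longrightarrow> ?e \<omega> = q \<omega>"
    unfolding q_def by (rule offspring_law) (use U J B disj in auto)
  then have AE: "AE \<omega> in M. indicator A \<omega> *\<^sub>R ?e \<omega> = q \<omega> * indicator A \<omega>"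
  proof eventually_elim
    case (elim \<omega>)
    then show ?case using A(2) by (cases "\<omega> \<in> A") (auto simp: q_def)
  qed
  have ie: "integrable M (\<lambda>\<omega>. indicator A \<omega> *\<^sub>R ?e \<omega>)"
    by (rule integrable_mult_indicator[OF AM real_cond_exp_int(1)[OF int]])
  have iq: "integrable M (\<lambda>\<omega>. q \<omega> * indicator A \<omega>)"
    by (rule integrable_cong_AE_imp[OF ie _ AE]) (use qm AM in auto)
  have "measure M (A \<inter> ?C) = (\<integral>\<omega>. indicator (A \<inter> ?C) \<omega> \<partial>M)"
    using AM C sets.sets_into_space[of "A \<inter> ?C" M] by (simp add: Int_absorb1)
  also have "\<dots> = (\<integral>\<omega>\<in>A. indicator ?C \<omega> \<partial>M)"
    unfolding set_lebesgue_integral_def by (intro Bochner_Integration.integral_cong) (auto split: split_indicator)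
  also have "\<dots> = (\<integral>\<omega>\<in>A. ?e \<omega> \<partial>M)"
    by (rule real_cond_exp_intA[OF int A(1)])
  also have "\<dots> = (\<integral>\<omega>. q \<omega> * indicator A \<omega> \<partial>M)"
    unfolding set_lebesgue_integral_def by (rule integral_cong_AE) (use iq ie AE in auto)
  finally have m: "measure M (A \<inter> ?C) = (\<integral>\<omega>. q \<omega> * indicator A \<omega> \<partial>M)" .
  have "(\<integral>\<^sup>+\<omega>. ennreal (q \<omega>) * indicator A \<omega> \<partial>M) = (\<integral>\<^sup>+\<omega>. ennreal (q \<omega> * indicator A \<omega>) \<partial>M)"
    by (intro nn_integral_cong) (auto split: split_indicator)
  also have "\<dots> = ennreal (\<integral>\<omega>. q \<omega> * indicator A \<omega> \<partial>M)"
    by (rule nn_integral_eq_integral[OF iq]) (use q0 in auto)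
  finally show ?thesis unfolding m[symmetric] emeasure_eq_measure by simp
qed

end

section \<open>Matching the tree with a rooted labelled tree\<close>

text \<open>
The label \<open>0\<close> is kept free: among the sets in which the children of a vertex are counted, index \<open>0\<close> is used for
the ages outside all prescribed sets.
\<close>

locale tree_match = age_galton_watson M H for M :: "'w measure" and H +
  fixes W :: "nat set" and r :: nat and p :: "nat \<Rightarrow> nat" and I :: "nat \<Rightarrow> real set"
  assumes finite_W: "finite W" and r: "r \<notin> W" and zero: "0 \<notin> insert r W"
    and p: "p \<in> parent_maps W r"
    and I_disjoint: "disjoint_family_on I (insert r W)"
    and I_sets: "\<And>i. I i \<in> sets age_law"
begin

abbreviation d :: "nat \<Rightarrow> nat" where "d \<equiv> depth r p"
definition V :: "nat \<Rightarrow> nat set" where "V n = {i \<in> insert r W. d i \<le> n}"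
definition L :: "nat \<Rightarrow> nat set" where "L n = {i \<in> insert r W. d i = n}"
definition kids :: "nat \<Rightarrow> nat set" where "kids i = {j \<in> W. p j = i}"

lemma finite_V [simp]: "finite (V n)" and finite_L [simp]: "finite (L n)" and finite_kids [simp]: "finite (kids i)"
  using finite_W by (auto simp: V_def L_def kids_def)

lemma d_step: "j \<in> W \<Longrightarrow> d j = Suc (d (p j))"
  by (rule depth_step[OF p _ r])

lemma p_mem: "j \<in> W \<Longrightarrow> p j \<in> insert r W"
  by (rule parent_maps_mem[OF p])

lemma d_eq_0: "i \<in> insert r W \<Longrightarrow> d i = 0 \<longleftrightarrow> i = r"
  using d_step[of i] by (cases "i = r") auto

lemma V_0: "V 0 = {r}"
  using d_eq_0 by (auto simp: V_def)

lemma V_Suc: "V (Suc n) = V n \<union> L (Suc n)" "V n \<inter> L (Suc n) = {}"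
  by (auto simp: V_def L_def)

lemma r_mem: "r \<in> V n" by (simp add: V_def)

lemma L_Suc: "L (Suc n) = (\<Union>i\<in>L n. kids i)"
proof -
  have "j \<in> L (Suc n) \<longleftrightarrow> j \<in> (\<Union>i\<in>L n. kids i)" for j
    using d_step[of j] p_mem[of j] by (cases "j = r") (auto simp: L_def kids_def r)
  then show ?thesis by blast
qed

lemma L_Suc_W: "j \<in> L (Suc n) \<Longrightarrow> j \<in> W \<and> p j \<in> L n"
  unfolding L_Suc by (auto simp: kids_def)

lemma kids_L: "i \<in> L n \<Longrightarrow> j \<in> kids i \<Longrightarrow> j \<in> L (Suc n) \<and> p j = i \<and> j \<in> W"
  unfolding L_Suc by (auto simp: kids_def)

lemma L_sub_V: "L n \<subseteq> V n" by (auto simp: V_def L_def)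

lemma V_parent: "j \<in> V n - {r} \<Longrightarrow> p j \<in> V n"
  using d_step[of j] p_mem[of j] by (auto simp: V_def)

text \<open>
A placement sends labels to vertices of the random tree.  The numbering of siblings in the random tree carries no
information, so all placements compatible with the parent map have to be considered; there are countably many.
\<close>

definition placements :: "nat \<Rightarrow> (nat \<Rightarrow> nat list) set" where
  "placements n = {\<phi> \<in> V n \<rightarrow>\<^sub>E UNIV. \<phi> r = [] \<and> (\<forall>j\<in>V n - {r}. \<exists>c. \<phi> j = \<phi> (p j) @ [c])}"

text \<open>
For disjoint sets \<open>B i\<close> these events are disjoint in \<open>\<phi>\<close> (\<open>disjoint_placed\<close>), so that the probability of
\<open>matched n B\<close> is the sum of theirs.
\<close>

definition placed :: "nat \<Rightarrow> (nat \<Rightarrow> real set) \<Rightarrow> (nat \<Rightarrow> nat list) \<Rightarrow> 'w set" where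
  "placed n B \<phi> = {\<omega> \<in> space M. (\<forall>u. length u \<le> n \<longrightarrow> (u \<in> dom (H \<omega>) \<longleftrightarrow> u \<in> \<phi> ` V n)) \<and>
     (\<forall>i\<in>V n. age (\<phi> i) \<omega> \<in> B i)}"

definition matched :: "nat \<Rightarrow> (nat \<Rightarrow> real set) \<Rightarrow> 'w set" where
  "matched n B = (\<Union>\<phi>\<in>placements n. placed n B \<phi>)"

lemma countable_placements: "countable (placements n)"
  by (rule countable_subset[of _ "V n \<rightarrow>\<^sub>E UNIV"]) (auto simp: placements_def intro!: countable_PiE)

lemma length_placement:
  assumes \<phi>: "\<phi> \<in> placements n" and i: "i \<in> V n"
  shows "length (\<phi> i) = d i"
proof (cases "i = r")
  case True
  then show ?thesis using \<phi> by (simp add: placements_def)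
next
  case False
  then have iW: "i \<in> W" using i by (auto simp: V_def)
  from p r iW have "i \<in> V n \<longrightarrow> length (\<phi> i) = d i"
  proof (induction rule: parent_maps_induct)
    case (step i)
    show ?case
    proof
      assume iV: "i \<in> V n"
      have ir: "i \<noteq> r" using step(1) r by auto
      then obtain c where c: "\<phi> i = \<phi> (p i) @ [c]" using \<phi> iV by (auto simp: placements_def)
      have pV: "p i \<in> V n" using V_parent iV ir by auto
      have "length (\<phi> (p i)) = d (p i)"
      proof (cases "p i = r")
        case True
        then show ?thesis using \<phi> by (simp add: placements_def)
      next
        case False
        then show ?thesis using step(2) p_mem[OF step(1)] pV by auto
      qed
      then show "length (\<phi> i) = d i" using c d_step[OF step(1)] by simp
    qed
  qed
  then show ?thesis using i by simp
qed

lemma placement_parent: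
  assumes "\<phi> \<in> placements n" "j \<in> V n" "j \<noteq> r"
  shows "\<exists>c. \<phi> j = \<phi> (p j) @ [c]"
  using assms by (auto simp: placements_def)

lemma disjoint_mem:
  assumes "disjoint_family_on B (insert r W)" "i \<in> V n" "j \<in> V m" "x \<in> B i" "x \<in> B j"
  shows "i = j"
proof (rule ccontr)
  assume "i \<noteq> j"
  moreover have "i \<in> insert r W" "j \<in> insert r W" using assms(2,3) by (auto simp: V_def)
  ultimately have "B i \<inter> B j = {}" using assms(1) unfolding disjoint_family_on_def by blast
  with assms(4,5) show False by blast
qed

lemma placed_dom: "\<omega> \<in> placed n B \<phi> \<Longrightarrow> \<phi> \<in> placements n \<Longrightarrow> i \<in> V n \<Longrightarrow> \<phi> i \<in> dom (H \<omega>)"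
  using length_placement[of \<phi> n i] by (auto simp: placed_def V_def)

lemma placed_age: "\<omega> \<in> placed n B \<phi> \<Longrightarrow> i \<in> V n \<Longrightarrow> age (\<phi> i) \<omega> \<in> B i"
  by (auto simp: placed_def)

lemma placed_vertex:
  assumes "\<omega> \<in> placed n B \<phi>" "u \<in> dom (H \<omega>)" "length u \<le> n"
  shows "\<exists>i\<in>V n. u = \<phi> i"
  using assms by (auto simp: placed_def)

lemma placed_inj:
  assumes B: "disjoint_family_on B (insert r W)" and \<omega>: "\<omega> \<in> placed n B \<phi>"
  shows "inj_on \<phi> (V n)"
proof (rule inj_onI)
  fix i j assume ij: "i \<in> V n" "j \<in> V n" "\<phi> i = \<phi> j"
  show "i = j"
    using disjoint_mem[OF B ij(1,2) placed_age[OF \<omega> ij(1)]] placed_age[OF \<omega> ij(2)] ij(3) by simp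
qed

lemma disjoint_placed:
  assumes B: "disjoint_family_on B (insert r W)"
  shows "disjoint_family_on (placed n B) (placements n)"
  unfolding disjoint_family_on_def
proof (intro ballI impI equals0I)
  fix \<phi> \<psi> \<omega> assume \<phi>: "\<phi> \<in> placements n" and \<psi>: "\<psi> \<in> placements n" and ne: "\<phi> \<noteq> \<psi>"
    and \<omega>: "\<omega> \<in> placed n B \<phi> \<inter> placed n B \<psi>"
  have "\<phi> i = \<psi> i" if i: "i \<in> V n" for i
  proof -
    have "\<phi> i \<in> dom (H \<omega>)" "length (\<phi> i) \<le> n"
      using placed_dom[of \<omega> n B \<phi> i] length_placement[OF \<phi> i] \<omega> \<phi> i by (auto simp: V_def)
    then obtain j where j: "j \<in> V n" "\<phi> i = \<psi> j" using placed_vertex[of \<omega> n B \<psi>] \<omega> by blast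
    then have "age (\<phi> i) \<omega> \<in> B i" "age (\<phi> i) \<omega> \<in> B j"
      using placed_age[of \<omega> n B \<phi> i] placed_age[of \<omega> n B \<psi> j] \<omega> i by auto
    then show ?thesis using disjoint_mem[OF B i j(1)] j(2) by auto
  qed
  moreover have "\<phi> \<in> extensional (V n)" "\<psi> \<in> extensional (V n)"
    using \<phi> \<psi> by (auto simp: placements_def PiE_def)
  ultimately have "\<phi> = \<psi>" by (intro extensionalityI[of \<phi> "V n"])
  with ne show False ..
qed

lemma sets_placed:
  assumes B: "\<And>i. B i \<in> sets age_law" and \<phi>: "\<phi> \<in> placements n"
  shows "placed n B \<phi> \<in> sets (G n)"
proof -
  let ?P = "\<lambda>\<omega>. (\<forall>u\<in>{u. length u \<le> n}. u \<in> dom (H \<omega>) \<longleftrightarrow> u \<in> \<phi> ` V n) \<and>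
      (\<forall>i\<in>V n. \<phi> i \<in> dom (H \<omega>) \<and> age (\<phi> i) \<omega> \<in> B i)"
  have len: "length (\<phi> i) \<le> n" if "i \<in> V n" for i
    using length_placement[OF \<phi> that] that by (simp add: V_def)
  have vertex: "Measurable.pred (G n) (\<lambda>\<omega>. u \<in> dom (H \<omega>))" if "length u \<le> n" for u
    unfolding pred_def using sets_G_vertex[OF that] by simp
  have 1: "Measurable.pred (G n) (\<lambda>\<omega>. u \<in> dom (H \<omega>) \<longleftrightarrow> u \<in> \<phi> ` V n)" if "length u \<le> n" for u
    using vertex[OF that] pred_intros_logic(2)[OF vertex[OF that]]
    by (cases "u \<in> \<phi> ` V n") simp_all
  have 2: "Measurable.pred (G n) (\<lambda>\<omega>. \<phi> i \<in> dom (H \<omega>) \<and> age (\<phi> i) \<omega> \<in> B i)" if "i \<in> V n" for i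
    unfolding pred_def using sets_G_vertex_age[OF len[OF that], of "B i"] B[of i]
    by (simp add: sets_age_law)
  have "Measurable.pred (G n) ?P"
    by (rule pred_intros_logic(3); rule pred_intros_countable_bounded(3)) (simp_all only: mem_Collect_eq 1 2)
  then have "{\<omega> \<in> space M. ?P \<omega>} \<in> sets (G n)" by (simp only: pred_def space_G)
  moreover have "placed n B \<phi> = {\<omega> \<in> space M. ?P \<omega>}"
  proof (intro equalityI subsetI)
    fix \<omega> assume \<omega>: "\<omega> \<in> placed n B \<phi>"
    have "\<omega> \<in> space M" "\<forall>u\<in>{u. length u \<le> n}. u \<in> dom (H \<omega>) \<longleftrightarrow> u \<in> \<phi> ` V n"
      using \<omega> unfolding placed_def by simp_all
    moreover have "\<forall>i\<in>V n. \<phi> i \<in> dom (H \<omega>) \<and> age (\<phi> i) \<omega> \<in> B i"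
      by (intro ballI conjI placed_dom[OF \<omega> \<phi>] placed_age[OF \<omega>])
    ultimately show "\<omega> \<in> {\<omega> \<in> space M. ?P \<omega>}" by (intro CollectI conjI)
  next
    fix \<omega> assume "\<omega> \<in> {\<omega> \<in> space M. ?P \<omega>}"
    then show "\<omega> \<in> placed n B \<phi>" unfolding placed_def by simp
  qed
  ultimately show ?thesis by (simp only:)
qed

lemma sets_placed_M:
  assumes "\<And>i. B i \<in> sets age_law" "\<phi> \<in> placements n"
  shows "placed n B \<phi> \<in> sets M"
  using sets_placed[OF assms] sets_G_subset[of n] by (rule rev_subsetD)

lemma sets_matched:
  assumes B: "\<And>i. B i \<in> sets age_law"
  shows "matched n B \<in> sets M"
  unfolding matched_def
proof (rule sets.countable_UN''[OF countable_placements])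
  show "placed n B \<phi> \<in> sets M" if "\<phi> \<in> placements n" for \<phi>
    by (rule sets_placed_M[OF B that])
qed

definition kid_region :: "(nat \<Rightarrow> real set) \<Rightarrow> nat \<Rightarrow> nat \<Rightarrow> real set" where
  "kid_region B i j = (if j = 0 then {0..} - (\<Union>l\<in>kids i. B l) else if j \<in> kids i then B j else {})"

definition breeding :: "nat \<Rightarrow> (nat \<Rightarrow> real set) \<Rightarrow> (nat \<Rightarrow> nat list) \<Rightarrow> 'w set" where
  "breeding n B \<phi> = {\<omega> \<in> space M. \<forall>i\<in>L n. \<forall>j\<in>insert 0 (insert r W).
      children_count (H \<omega>) (\<phi> i) (kid_region B i j) = (if j \<in> kids i then 1 else 0)}"

lemma children_count_0: "\<omega> \<in> space M \<Longrightarrow> children_count (H \<omega>) u A = 0 \<longleftrightarrow> (\<forall>c. u @ [c] \<in> dom (H \<omega>) \<longrightarrow> age (u @ [c]) \<omega> \<notin> A)"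
  by (subst children_count_eq_iff) auto

lemma children_count_1: "\<omega> \<in> space M \<Longrightarrow> children_count (H \<omega>) u A = 1 \<longleftrightarrow> (\<exists>c. \<forall>c'. u @ [c'] \<in> dom (H \<omega>) \<and> age (u @ [c']) \<omega> \<in> A \<longleftrightarrow> c' = c)"
proof -
  assume "\<omega> \<in> space M"
  then have "children_count (H \<omega>) u A = 1 \<longleftrightarrow> (\<exists>xs::nat list. distinct xs \<and> length xs = 1 \<and> (\<forall>i. i \<in> set xs \<longleftrightarrow> u @ [i] \<in> dom (H \<omega>) \<and> age (u @ [i]) \<omega> \<in> A))"
    by (rule children_count_eq_iff)
  also have "\<dots> \<longleftrightarrow> (\<exists>c. \<forall>c'. u @ [c'] \<in> dom (H \<omega>) \<and> age (u @ [c']) \<omega> \<in> A \<longleftrightarrow> c' = c)"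
  proof
    assume "\<exists>xs::nat list. distinct xs \<and> length xs = 1 \<and> (\<forall>i. i \<in> set xs \<longleftrightarrow> u @ [i] \<in> dom (H \<omega>) \<and> age (u @ [i]) \<omega> \<in> A)"
    then obtain xs :: "nat list" where xs: "length xs = 1" "\<And>i. i \<in> set xs \<longleftrightarrow> u @ [i] \<in> dom (H \<omega>) \<and> age (u @ [i]) \<omega> \<in> A"
      by blast
    from xs(1) obtain c where "xs = [c]" by (auto simp: length_Suc_conv)
    then show "\<exists>c. \<forall>c'. u @ [c'] \<in> dom (H \<omega>) \<and> age (u @ [c']) \<omega> \<in> A \<longleftrightarrow> c' = c"
      using xs(2) by (intro exI[of _ c]) simp
  next
    assume "\<exists>c. \<forall>c'. u @ [c'] \<in> dom (H \<omega>) \<and> age (u @ [c']) \<omega> \<in> A \<longleftrightarrow> c' = c"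
    then obtain c where "\<forall>c'. u @ [c'] \<in> dom (H \<omega>) \<and> age (u @ [c']) \<omega> \<in> A \<longleftrightarrow> c' = c" ..
    then show "\<exists>xs::nat list. distinct xs \<and> length xs = 1 \<and> (\<forall>i. i \<in> set xs \<longleftrightarrow> u @ [i] \<in> dom (H \<omega>) \<and> age (u @ [i]) \<omega> \<in> A)"
      by (intro exI[of _ "[c]"]) simp
  qed
  finally show ?thesis .
qed

text \<open>
Each prescribed set contains the age of one child, which is the place of the corresponding label, and the void
region \<open>kid_region B i 0\<close> rules out further children.
\<close>

lemma breeding_extends:
  assumes B: "disjoint_family_on B (insert r W)" and \<phi>: "\<phi> \<in> placements n"
    and \<omega>: "\<omega> \<in> placed n B \<phi>" "\<omega> \<in> breeding n B \<phi>"
  shows "\<exists>\<psi>\<in>placements (Suc n). \<omega> \<in> placed (Suc n) B \<psi>"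
proof -
  have \<omega>M: "\<omega> \<in> space M" using \<omega> by (auto simp: placed_def)
  have "\<exists>c. \<forall>c'. \<phi> (p j) @ [c'] \<in> dom (H \<omega>) \<and> age (\<phi> (p j) @ [c']) \<omega> \<in> B j \<longleftrightarrow> c' = c" if j: "j \<in> L (Suc n)" for j
  proof -
    have jW: "j \<in> W" "p j \<in> L n" using L_Suc_W[OF j] by auto
    then have jk: "j \<in> kids (p j)" by (simp add: kids_def)
    moreover have "j \<noteq> 0" using jW(1) zero by (metis insertCI)
    moreover have "children_count (H \<omega>) (\<phi> (p j)) (kid_region B (p j) j) = (if j \<in> kids (p j) then 1 else 0)"
      using \<omega>(2) jW unfolding breeding_def by blast
    ultimately have "children_count (H \<omega>) (\<phi> (p j)) (B j) = 1"
      by (simp add: kid_region_def)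
    then show ?thesis using children_count_1[OF \<omega>M] by blast
  qed
  then obtain c where c: "\<And>j c'. j \<in> L (Suc n) \<Longrightarrow> \<phi> (p j) @ [c'] \<in> dom (H \<omega>) \<and> age (\<phi> (p j) @ [c']) \<omega> \<in> B j \<longleftrightarrow> c' = c j"
    by metis
  define \<psi> where "\<psi> = (\<lambda>j\<in>V (Suc n). if j \<in> V n then \<phi> j else \<phi> (p j) @ [c j])"
  have \<psi>V: "\<psi> j = \<phi> j" if "j \<in> V n" for j using that V_Suc by (simp add: \<psi>_def)
  have \<psi>L: "\<psi> j = \<phi> (p j) @ [c j]" if "j \<in> L (Suc n)" for j using that V_Suc by (auto simp: \<psi>_def)
  have LV: "p j \<in> V n" if "j \<in> L (Suc n)" for j using L_Suc_W[OF that] L_sub_V by auto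
  have "\<psi> \<in> placements (Suc n)"
    unfolding placements_def
  proof (intro CollectI conjI ballI)
    show "\<psi> \<in> V (Suc n) \<rightarrow>\<^sub>E UNIV" by (simp add: \<psi>_def)
    show "\<psi> r = []" using \<psi>V[OF r_mem] \<phi> by (simp add: placements_def)
    fix j assume j: "j \<in> V (Suc n) - {r}"
    show "\<exists>c. \<psi> j = \<psi> (p j) @ [c]"
    proof (cases "j \<in> V n")
      case True
      then obtain c' where "\<phi> j = \<phi> (p j) @ [c']" using j placement_parent[OF \<phi>, of j] by auto
      then show ?thesis using \<psi>V[OF True] \<psi>V[OF V_parent[of j n]] True j by auto
    next
      case False
      then have "j \<in> L (Suc n)" using j V_Suc by auto
      then show ?thesis using \<psi>L \<psi>V[OF LV] by auto
    qed
  qed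
  moreover have "\<omega> \<in> placed (Suc n) B \<psi>"
    unfolding placed_def
  proof (intro CollectI conjI allI impI ballI \<omega>M)
    fix i assume "i \<in> V (Suc n)"
    then consider "i \<in> V n" | "i \<in> L (Suc n)" using V_Suc by auto
    then show "age (\<psi> i) \<omega> \<in> B i"
    proof cases
      case 1
      then show ?thesis using \<psi>V placed_age[OF \<omega>(1)] by simp
    next
      case 2
      then show ?thesis using \<psi>L c[OF 2, of "c i"] by simp
    qed
  next
    fix u :: "nat list" assume u: "length u \<le> Suc n"
    have len\<psi>: "length (\<psi> j) = Suc n" if "j \<in> L (Suc n)" for j
      using \<psi>L[OF that] length_placement[OF \<phi> LV[OF that]] L_Suc_W[OF that] by (simp add: L_def)
    show "u \<in> dom (H \<omega>) \<longleftrightarrow> u \<in> \<psi> ` V (Suc n)"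
    proof (cases "length u \<le> n")
      case True
      then have "u \<in> dom (H \<omega>) \<longleftrightarrow> u \<in> \<phi> ` V n" using \<omega>(1) by (simp add: placed_def)
      moreover have "u \<notin> \<psi> ` L (Suc n)" using len\<psi> True by fastforce
      moreover have "\<psi> ` V n = \<phi> ` V n" using \<psi>V by auto
      ultimately show ?thesis unfolding V_Suc(1) image_Un by blast
    next
      case False
      then have lu: "length u = Suc n" using u by simp
      show ?thesis
      proof
        assume ud: "u \<in> dom (H \<omega>)"
        from lu obtain v c' where v: "u = v @ [c']" by (cases u rule: rev_exhaust) auto
        have "v \<in> dom (H \<omega>)" "length v = n" using parent_mem[OF \<omega>M] ud lu v by auto
        then obtain i where i: "i \<in> V n" "v = \<phi> i" using placed_vertex[OF \<omega>(1), of v] by auto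
        then have iL: "i \<in> L n" using length_placement[OF \<phi>] \<open>length v = n\<close> by (auto simp: V_def L_def)
        then have "children_count (H \<omega>) (\<phi> i) (kid_region B i 0) = (if 0 \<in> kids i then 1 else 0)"
          using \<omega>(2) by (simp add: breeding_def)
        moreover have "0 \<notin> kids i" using zero by (auto simp: kids_def)
        ultimately have "children_count (H \<omega>) (\<phi> i) (kid_region B i 0) = 0" by simp
        then have "age u \<omega> \<notin> kid_region B i 0" using ud v i by (simp add: children_count_0[OF \<omega>M])
        moreover have "0 \<le> age u \<omega>" by (rule age_nonneg[OF \<omega>M ud])
        ultimately obtain l where l: "l \<in> kids i" "age u \<omega> \<in> B l" by (auto simp: kid_region_def)
        have l': "l \<in> L (Suc n)" "p l = i" using kids_L[OF iL l(1)] by auto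
        then have "c' = c l" using c[OF l'(1), of c'] ud v i l by auto
        then have "u = \<psi> l" using \<psi>L[OF l'(1)] l'(2) v i by simp
        then show "u \<in> \<psi> ` V (Suc n)" using l' V_Suc by auto
      next
        assume "u \<in> \<psi> ` V (Suc n)"
        then obtain j where j: "j \<in> V (Suc n)" "u = \<psi> j" by auto
        have "j \<notin> V n" using length_placement[OF \<phi>, of j] \<psi>V[of j] j lu by (auto simp: V_def)
        then have "j \<in> L (Suc n)" using j V_Suc by auto
        then show "u \<in> dom (H \<omega>)" using \<psi>L c[of j "c j"] j by auto
      qed
    qed
  qed
  ultimately show ?thesis by blast
qed

lemma placed_restricts:
  assumes B: "disjoint_family_on B (insert r W)" and \<psi>: "\<psi> \<in> placements (Suc n)"
    and \<omega>: "\<omega> \<in> placed (Suc n) B \<psi>"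
  defines "\<phi> \<equiv> restrict \<psi> (V n)"
  shows "\<phi> \<in> placements n" "\<omega> \<in> placed n B \<phi>" "\<omega> \<in> breeding n B \<phi>"
proof -
  have \<omega>M: "\<omega> \<in> space M" using \<omega> by (auto simp: placed_def)
  have sub: "V n \<subseteq> V (Suc n)" using V_Suc by auto
  have \<phi>\<psi>: "\<phi> i = \<psi> i" if "i \<in> V n" for i using that by (simp add: \<phi>_def)
  note inj = placed_inj[OF B \<omega>]
  show \<phi>: "\<phi> \<in> placements n"
    unfolding placements_def
  proof (intro CollectI conjI ballI)
    show "\<phi> \<in> V n \<rightarrow>\<^sub>E UNIV" by (simp add: \<phi>_def)
    show "\<phi> r = []" using \<phi>\<psi>[OF r_mem] \<psi> by (simp add: placements_def)
    fix j assume j: "j \<in> V n - {r}"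
    then obtain c where "\<psi> j = \<psi> (p j) @ [c]" using sub placement_parent[OF \<psi>, of j] by auto
    then show "\<exists>c. \<phi> j = \<phi> (p j) @ [c]" using \<phi>\<psi>[of j] \<phi>\<psi>[OF V_parent[OF j]] j by auto
  qed
  show "\<omega> \<in> placed n B \<phi>"
    unfolding placed_def
  proof (intro CollectI conjI allI impI ballI \<omega>M)
    fix i assume i: "i \<in> V n"
    then show "age (\<phi> i) \<omega> \<in> B i" using placed_age[OF \<omega>, of i] \<phi>\<psi> sub by auto
  next
    fix u :: "nat list" assume u: "length u \<le> n"
    have "u \<in> dom (H \<omega>) \<longleftrightarrow> u \<in> \<psi> ` V (Suc n)" using \<omega> u by (simp add: placed_def)
    moreover have "j \<in> V n" if "j \<in> V (Suc n)" "u = \<psi> j" for j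
      using length_placement[OF \<psi> that(1)] that u by (simp add: V_def)
    ultimately show "u \<in> dom (H \<omega>) \<longleftrightarrow> u \<in> \<phi> ` V n"
      using \<phi>\<psi> sub by (auto simp: image_iff)
  qed
  have child: "\<exists>l\<in>kids i. \<phi> i @ [c] = \<psi> l" if i: "i \<in> L n" and c: "\<phi> i @ [c] \<in> dom (H \<omega>)" for i c
  proof -
    have iV: "i \<in> V n" using i L_sub_V by auto
    have "length (\<phi> i) = n" using length_placement[OF \<phi> iV] i by (simp add: L_def)
    then obtain l where l: "l \<in> V (Suc n)" "\<phi> i @ [c] = \<psi> l"
      using placed_vertex[OF \<omega> c] by auto
    have lr: "l \<noteq> r" using l \<psi> by (auto simp: placements_def)
    obtain c' where "\<psi> l = \<psi> (p l) @ [c']" using placement_parent[OF \<psi> l(1) lr] by blast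
    then have "\<psi> (p l) = \<psi> i" using l(2) \<phi>\<psi>[OF iV] by simp
    moreover have "p l \<in> V (Suc n)" using V_parent l(1) lr by auto
    ultimately have "p l = i" using inj sub iV by (auto dest: inj_onD)
    then have "l \<in> kids i" using l(1) lr by (auto simp: kids_def V_def)
    then show ?thesis using l(2) by blast
  qed
  show "\<omega> \<in> breeding n B \<phi>"
    unfolding breeding_def
  proof (intro CollectI conjI ballI \<omega>M)
    fix i j assume i: "i \<in> L n" and j: "j \<in> insert 0 (insert r W)"
    have iV: "i \<in> V n" using i L_sub_V by auto
    have kV: "l \<in> V (Suc n)" if "l \<in> kids i" for l using kids_L[OF i that] V_Suc by auto
    have k0: "0 \<notin> kids i" using zero by (auto simp: kids_def)
    show "children_count (H \<omega>) (\<phi> i) (kid_region B i j) = (if j \<in> kids i then 1 else 0)"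
    proof (cases "j \<in> kids i")
      case False
      have "age (\<phi> i @ [c]) \<omega> \<notin> kid_region B i j" if c: "\<phi> i @ [c] \<in> dom (H \<omega>)" for c
      proof -
        obtain l where "l \<in> kids i" "\<phi> i @ [c] = \<psi> l" using child[OF i c] by blast
        then show ?thesis using placed_age[OF \<omega> kV] False by (auto simp: kid_region_def)
      qed
      then show ?thesis using False by (simp add: children_count_0[OF \<omega>M])
    next
      case True
      then have j0: "kid_region B i j = B j" using k0 by (auto simp: kid_region_def)
      have jW: "j \<in> W" "p j = i" "j \<noteq> r" using kids_L[OF i True] r by auto
      obtain c where c: "\<psi> j = \<psi> (p j) @ [c]" using placement_parent[OF \<psi> kV[OF True] jW(3)] by blast
      then have c': "\<psi> j = \<phi> i @ [c]" using jW \<phi>\<psi>[OF iV] by simp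
      have "\<phi> i @ [c'] \<in> dom (H \<omega>) \<and> age (\<phi> i @ [c']) \<omega> \<in> B j \<longleftrightarrow> c' = c" for c'
      proof
        assume a: "\<phi> i @ [c'] \<in> dom (H \<omega>) \<and> age (\<phi> i @ [c']) \<omega> \<in> B j"
        then obtain l where l: "l \<in> kids i" "\<phi> i @ [c'] = \<psi> l" using child[OF i] by blast
        then have "l = j" using disjoint_mem[OF B kV[OF l(1)] kV[OF True] placed_age[OF \<omega> kV[OF l(1)]]] a by simp
        then show "c' = c" using l c' by simp
      next
        assume "c' = c"
        then show "\<phi> i @ [c'] \<in> dom (H \<omega>) \<and> age (\<phi> i @ [c']) \<omega> \<in> B j"
          using placed_dom[OF \<omega> \<psi> kV[OF True]] placed_age[OF \<omega> kV[OF True]] c' by simp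
      qed
      then show ?thesis unfolding j0 using True children_count_1[OF \<omega>M] by auto
    qed
  qed
qed

lemma matched_Suc:
  assumes B: "disjoint_family_on B (insert r W)"
  shows "matched (Suc n) B = (\<Union>\<phi>\<in>placements n. placed n B \<phi> \<inter> breeding n B \<phi>)"
proof
  show "matched (Suc n) B \<subseteq> (\<Union>\<phi>\<in>placements n. placed n B \<phi> \<inter> breeding n B \<phi>)"
  proof
    fix \<omega> assume "\<omega> \<in> matched (Suc n) B"
    then obtain \<psi> where \<psi>: "\<psi> \<in> placements (Suc n)" "\<omega> \<in> placed (Suc n) B \<psi>" by (auto simp only: matched_def)
    from placed_restricts[OF B \<psi>] show "\<omega> \<in> (\<Union>\<phi>\<in>placements n. placed n B \<phi> \<inter> breeding n B \<phi>)"
      by (intro UN_I[of "restrict \<psi> (V n)"] IntI)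
  qed
  show "(\<Union>\<phi>\<in>placements n. placed n B \<phi> \<inter> breeding n B \<phi>) \<subseteq> matched (Suc n) B"
  proof
    fix \<omega> assume "\<omega> \<in> (\<Union>\<phi>\<in>placements n. placed n B \<phi> \<inter> breeding n B \<phi>)"
    then obtain \<phi> where "\<phi> \<in> placements n" "\<omega> \<in> placed n B \<phi>" "\<omega> \<in> breeding n B \<phi>" by blast
    then have "\<exists>\<psi>\<in>placements (Suc n). \<omega> \<in> placed (Suc n) B \<psi>" by (rule breeding_extends[OF B])
    then show "\<omega> \<in> matched (Suc n) B" by (auto simp only: matched_def)
  qed
qed

end

lemma finite_measure_age_intensity: "0 \<le> s \<Longrightarrow> finite_measure (age_intensity s)"
  by (rule finite_measureI) (simp add: emeasure_age_intensity_total)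

lemma sets_age_intensity [simp]: "sets (age_intensity s) = sets age_law"
  by (simp add: age_intensity_def)

lemma mult_indicator_cong:
  fixes f g :: ennreal
  assumes "x \<in> A \<Longrightarrow> f = g"
  shows "f * indicator A x = g * indicator A x"
  using assms by (simp split: split_indicator)

lemma disjoint_family_on_mono':
  assumes "disjoint_family_on B A" "\<And>i. i \<in> A \<Longrightarrow> C i \<subseteq> B i"
  shows "disjoint_family_on C A"
  using assms unfolding disjoint_family_on_def by blast

context tree_match
begin

text \<open>
The probability that a vertex of age \<open>s\<close> and label \<open>i\<close> has one child in \<open>B j\<close> for each \<open>j\<close> in \<open>kids i\<close> and no
other children.
\<close>

definition brood :: "(nat \<Rightarrow> real set) \<Rightarrow> nat \<Rightarrow> real \<Rightarrow> ennreal" where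
  "brood B i s = ennreal (exp (- measure (age_intensity s) {0..})) * (\<Prod>j\<in>kids i. emeasure (age_intensity s) (B j))"

lemma kids_sub: "kids i \<subseteq> insert r W" "0 \<notin> kids i"
  using zero by (auto simp: kids_def)

lemma kid_region_sets:
  assumes "\<And>i. B i \<in> sets age_law"
  shows "kid_region B i j \<in> sets age_law"
proof -
  have "{0..} \<in> sets age_law" using sets.top[of age_law] by simp
  then show ?thesis unfolding kid_region_def using assms by (auto intro!: sets.Diff sets.finite_UN)
qed

text \<open>
The exponential factors of the Poisson probabilities combine to the void probability of the whole half-line, because
the regions partition it.
\<close>

lemma brood_eq:
  assumes s: "0 \<le> s" and B: "\<And>i. B i \<in> sets age_law" "disjoint_family_on B (insert r W)"
  shows "ennreal (\<Prod>j\<in>insert 0 (insert r W). poisson_prob (measure (age_intensity s) (kid_region B i j))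
      (if j \<in> kids i then 1 else 0)) = brood B i s"
proof -
  interpret \<nu>: finite_measure "age_intensity s" by (rule finite_measure_age_intensity[OF s])
  let ?m = "measure (age_intensity s)"
  let ?f = "\<lambda>j. poisson_prob (?m (kid_region B i j)) (if j \<in> kids i then 1 else 0)"
  have dis: "disjoint_family_on B (kids i)"
    using B(2) kids_sub unfolding disjoint_family_on_def by blast
  have "prod ?f (insert 0 (insert r W)) = prod ?f (insert 0 (kids i))"
  proof (rule prod.mono_neutral_right)
    show "\<forall>j\<in>insert 0 (insert r W) - insert 0 (kids i). ?f j = 1"
      by (auto simp: kid_region_def poisson_prob_def)
  qed (use finite_W kids_sub in auto)
  also have "\<dots> = ?f 0 * prod ?f (kids i)" using kids_sub by (subst prod.insert) auto
  also have "?f 0 = exp (- ?m ({0..} - (\<Union>l\<in>kids i. B l)))"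
    using kids_sub by (simp add: kid_region_def poisson_prob_def)
  also have "prod ?f (kids i) = (\<Prod>j\<in>kids i. ?m (B j) * exp (- ?m (B j)))"
  proof (rule prod.cong[OF refl])
    fix j assume "j \<in> kids i"
    moreover from this have "j \<noteq> 0" using kids_sub by metis
    ultimately show "?f j = ?m (B j) * exp (- ?m (B j))"
      by (simp add: kid_region_def poisson_prob_def)
  qed
  also have "\<dots> = (\<Prod>j\<in>kids i. ?m (B j)) * exp (- (\<Sum>j\<in>kids i. ?m (B j)))"
    by (simp add: prod.distrib exp_sum sum_negf[symmetric])
  also have "(\<Sum>j\<in>kids i. ?m (B j)) = ?m (\<Union>l\<in>kids i. B l)"
    using B(1) dis by (intro \<nu>.finite_measure_finite_Union[symmetric]) auto
  also have "?m ({0..} - (\<Union>l\<in>kids i. B l)) = ?m {0..} - ?m (\<Union>l\<in>kids i. B l)"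
  proof (rule \<nu>.finite_measure_Diff)
    show "{0..} \<in> sets (age_intensity s)" using sets.top[of "age_intensity s"] by simp
    show "(\<Union>l\<in>kids i. B l) \<in> sets (age_intensity s)" using B(1) by auto
    show "(\<Union>l\<in>kids i. B l) \<subseteq> {0..}" using B(1) by (auto simp: sets_age_law)
  qed
  finally have "prod ?f (insert 0 (insert r W)) = exp (- ?m {0..}) * (\<Prod>j\<in>kids i. ?m (B j))"
    by (simp add: exp_diff exp_minus field_simps)
  then show ?thesis
    unfolding brood_def
    by (simp add: ennreal_mult prod_nonneg prod_ennreal[symmetric] emeasure_age_intensity_eq_measure[OF s B(1)])
qed

lemma sets_breeding:
  assumes B: "\<And>i. B i \<in> sets age_law"
  shows "breeding n B \<phi> \<in> sets M"
proof -
  have "Measurable.pred M (\<lambda>\<omega>. \<forall>i\<in>L n. \<forall>j\<in>insert 0 (insert r W).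
      children_count (H \<omega>) (\<phi> i) (kid_region B i j) = (if j \<in> kids i then 1 else 0))"
  proof (intro pred_intros_finite(3) ballI)
    show "finite (L n)" "finite (insert 0 (insert r W))" using finite_W by auto
    fix i j show "Measurable.pred M (\<lambda>\<omega>. children_count (H \<omega>) (\<phi> i) (kid_region B i j) = (if j \<in> kids i then 1 else 0))"
      using kid_region_sets[of B i j] B by (intro measurable_children_count) (simp add: sets_age_law)
  qed
  then show ?thesis unfolding breeding_def pred_def .
qed

lemma prob_breeding:
  assumes B: "\<And>i. B i \<in> sets age_law" "disjoint_family_on B (insert r W)" and \<phi>: "\<phi> \<in> placements n"
  shows "emeasure M (placed n B \<phi> \<inter> breeding n B \<phi>) =
    (\<integral>\<^sup>+\<omega>. (\<Prod>i\<in>L n. brood B i (age (\<phi> i) \<omega>)) * indicator (placed n B \<phi>) \<omega> \<partial>M)"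
proof (cases "placed n B \<phi> = {}")
  case True
  then show ?thesis by simp
next
  case False
  then obtain \<omega>0 where "\<omega>0 \<in> placed n B \<phi>" by auto
  then have "inj_on \<phi> (V n)" by (rule placed_inj[OF B(2)])
  then have inj: "inj_on \<phi> (L n)" by (rule inj_on_subset) (rule L_sub_V)
  let ?\<iota> = "inv_into (L n) \<phi>" and ?J = "insert 0 (insert r W)"
  have \<iota>: "?\<iota> (\<phi> i) = i" if "i \<in> L n" for i using inv_into_f_f[OF inj that] .
  let ?B = "\<lambda>u. kid_region B (?\<iota> u)" and ?c = "\<lambda>u j. if j \<in> kids (?\<iota> u) then 1 else (0::nat)"
  have len: "length (\<phi> i) = n" if "i \<in> L n" for i
    using length_placement[OF \<phi>, of i] that L_sub_V by (auto simp: L_def)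
  have disj: "disjoint_family_on (kid_region B i) ?J" for i
    unfolding disjoint_family_on_def
  proof (intro ballI impI)
    fix j l assume "j \<in> ?J" "l \<in> ?J" "j \<noteq> l"
    moreover have "B a \<inter> B b = {}" if "a \<in> kids i" "b \<in> kids i" "a \<noteq> b" for a b
      using B(2) that kids_sub unfolding disjoint_family_on_def by blast
    ultimately show "kid_region B i j \<inter> kid_region B i l = {}"
      unfolding kid_region_def by auto
  qed
  have dom: "\<phi> ` L n \<subseteq> dom (H \<omega>)" if "\<omega> \<in> placed n B \<phi>" for \<omega>
    using placed_dom[OF that \<phi>] L_sub_V by blast
  have eq: "breeding n B \<phi> = {\<omega> \<in> space M. \<forall>u\<in>\<phi> ` L n. \<forall>j\<in>?J. children_count (H \<omega>) u (?B u j) = ?c u j}"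
    unfolding breeding_def by (intro Collect_cong conj_cong refl) (simp add: \<iota>)
  have "emeasure M (placed n B \<phi> \<inter> breeding n B \<phi>) =
     (\<integral>\<^sup>+\<omega>. ennreal (\<Prod>u\<in>\<phi> ` L n. \<Prod>j\<in>?J. poisson_prob (measure (age_intensity (age u \<omega>)) (?B u j)) (?c u j))
        * indicator (placed n B \<phi>) \<omega> \<partial>M)"
    unfolding eq
  proof (rule offspring_probability)
    show "finite (\<phi> ` L n)" "finite ?J" using finite_W by auto
    show "\<And>u. u \<in> \<phi> ` L n \<Longrightarrow> length u = n" using len by auto
    show "\<And>u j. kid_region B (?\<iota> u) j \<in> sets age_law" by (rule kid_region_sets[OF B(1)])
    show "\<And>u. disjoint_family_on (?B u) ?J" by (rule disj)
    show "placed n B \<phi> \<in> sets (G n)" by (rule sets_placed[OF B(1) \<phi>])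
    show "\<And>\<omega>. \<omega> \<in> placed n B \<phi> \<Longrightarrow> \<phi> ` L n \<subseteq> dom (H \<omega>)" by (rule dom)
  qed
  also have "\<dots> = (\<integral>\<^sup>+\<omega>. (\<Prod>i\<in>L n. brood B i (age (\<phi> i) \<omega>)) * indicator (placed n B \<phi>) \<omega> \<partial>M)"
  proof (rule nn_integral_cong)
    fix \<omega> assume \<omega>M: "\<omega> \<in> space M"
    have "ennreal (\<Prod>u\<in>\<phi> ` L n. \<Prod>j\<in>?J. poisson_prob (measure (age_intensity (age u \<omega>)) (?B u j)) (?c u j)) =
       (\<Prod>i\<in>L n. brood B i (age (\<phi> i) \<omega>))" if \<omega>: "\<omega> \<in> placed n B \<phi>"
    proof -
      have pos: "0 \<le> poisson_prob (measure (age_intensity s) A) c" for s A c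
        by (simp add: poisson_prob_def)
      have "ennreal (\<Prod>u\<in>\<phi> ` L n. \<Prod>j\<in>?J. poisson_prob (measure (age_intensity (age u \<omega>)) (?B u j)) (?c u j)) =
        ennreal (\<Prod>i\<in>L n. \<Prod>j\<in>?J. poisson_prob (measure (age_intensity (age (\<phi> i) \<omega>)) (kid_region B i j))
            (if j \<in> kids i then 1 else 0))"
        by (subst prod.reindex[OF inj]) (simp add: \<iota> cong: prod.cong)
      also have "\<dots> = (\<Prod>i\<in>L n. ennreal (\<Prod>j\<in>?J. poisson_prob (measure (age_intensity (age (\<phi> i) \<omega>)) (kid_region B i j))
            (if j \<in> kids i then 1 else 0)))"
        by (rule prod_ennreal[symmetric]) (intro prod_nonneg ballI pos)
      also have "\<dots> = (\<Prod>i\<in>L n. brood B i (age (\<phi> i) \<omega>))"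
      proof (rule prod.cong[OF refl])
        fix i assume "i \<in> L n"
        then have "0 \<le> age (\<phi> i) \<omega>" using age_nonneg[OF \<omega>M] dom[OF \<omega>] by blast
        then show "ennreal (\<Prod>j\<in>?J. poisson_prob (measure (age_intensity (age (\<phi> i) \<omega>)) (kid_region B i j))
            (if j \<in> kids i then 1 else 0)) = brood B i (age (\<phi> i) \<omega>)"
          by (rule brood_eq[OF _ B])
      qed
      finally show ?thesis .
    qed
    then show "ennreal (\<Prod>u\<in>\<phi> ` L n. \<Prod>j\<in>?J. poisson_prob (measure (age_intensity (age u \<omega>)) (?B u j)) (?c u j))
        * indicator (placed n B \<phi>) \<omega> = (\<Prod>i\<in>L n. brood B i (age (\<phi> i) \<omega>)) * indicator (placed n B \<phi>) \<omega>"
      by (rule mult_indicator_cong)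
  qed
  finally show ?thesis .
qed

text \<open>
The age of the vertex in the place of label \<open>i\<close>.  On a matching tree it is the only age of a vertex of generation
\<open>d i\<close> in \<open>I i\<close>; the supremum picks it without reference to a placement and is measurable everywhere.
\<close>

definition matched_age :: "nat \<Rightarrow> 'w \<Rightarrow> real" where
  "matched_age i \<omega> = enn2real (SUP u\<in>{u. length u = d i}. if u \<in> dom (H \<omega>) \<and> age u \<omega> \<in> I i then ennreal (age u \<omega>) else 0)"

lemma measurable_matched_age [measurable]: "matched_age i \<in> borel_measurable M"
proof -
  have [measurable]: "I i \<in> sets borel" using I_sets[of i] by (simp add: sets_age_law)
  show ?thesis
    unfolding matched_age_def
    by (intro measurable_compose[OF _ borel_measurable_enn2real] borel_measurable_SUP) measurable
qed

lemma matched_age_placed: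
  assumes \<phi>: "\<phi> \<in> placements n" and sub: "\<And>i. B i \<subseteq> I i" and \<omega>: "\<omega> \<in> placed n B \<phi>" and i: "i \<in> V n"
  shows "matched_age i \<omega> = age (\<phi> i) \<omega>"
proof -
  have \<omega>M: "\<omega> \<in> space M" using \<omega> by (auto simp: placed_def)
  have di: "d i \<le> n" using i by (simp add: V_def)
  have "(SUP u\<in>{u. length u = d i}. if u \<in> dom (H \<omega>) \<and> age u \<omega> \<in> I i then ennreal (age u \<omega>) else 0) = ennreal (age (\<phi> i) \<omega>)"
  proof (rule antisym)
    show "(SUP u\<in>{u. length u = d i}. if u \<in> dom (H \<omega>) \<and> age u \<omega> \<in> I i then ennreal (age u \<omega>) else 0) \<le> ennreal (age (\<phi> i) \<omega>)"
    proof (rule SUP_least)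
      fix u :: "nat list" assume u: "u \<in> {u. length u = d i}"
      have "u = \<phi> i" if ud: "u \<in> dom (H \<omega>)" and uI: "age u \<omega> \<in> I i"
      proof -
        have "length u \<le> n" using u di by simp
        then obtain j where j: "j \<in> V n" "u = \<phi> j" using placed_vertex[OF \<omega> ud] by blast
        have "age u \<omega> \<in> I j" using placed_age[OF \<omega> j(1)] sub[of j] j(2) by auto
        then have "i = j" using disjoint_mem[OF I_disjoint i j(1) uI] by simp
        then show ?thesis using j by simp
      qed
      then have u\<phi>: "u = \<phi> i" if "u \<in> dom (H \<omega>) \<and> age u \<omega> \<in> I i" using that by blast
      show "(if u \<in> dom (H \<omega>) \<and> age u \<omega> \<in> I i then ennreal (age u \<omega>) else 0) \<le> ennreal (age (\<phi> i) \<omega>)"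
      proof (cases "u \<in> dom (H \<omega>) \<and> age u \<omega> \<in> I i")
        case True
        have "age u \<omega> = age (\<phi> i) \<omega>" by (simp only: u\<phi>[OF True])
        then show ?thesis unfolding if_P[OF True] by (rule eq_refl[OF arg_cong])
      next
        case False
        show ?thesis unfolding if_not_P[OF False] by (rule zero_le)
      qed
    qed
    have "\<phi> i \<in> {u. length u = d i}" using length_placement[OF \<phi> i] by simp
    moreover have "\<phi> i \<in> dom (H \<omega>) \<and> age (\<phi> i) \<omega> \<in> I i"
      using placed_dom[OF \<omega> \<phi> i] placed_age[OF \<omega> i] sub[of i] by blast
    ultimately show "ennreal (age (\<phi> i) \<omega>) \<le> (SUP u\<in>{u. length u = d i}. if u \<in> dom (H \<omega>) \<and> age u \<omega> \<in> I i then ennreal (age u \<omega>) else 0)"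
      by (intro SUP_upper2[of "\<phi> i"]) simp_all
  qed
  then show ?thesis
    unfolding matched_age_def using age_nonneg[OF \<omega>M placed_dom[OF \<omega> \<phi> i]] by simp
qed

lemma matched_Int:
  "matched n (\<lambda>i. A i \<inter> I i) = {\<omega> \<in> matched n I. \<forall>i\<in>V n. matched_age i \<omega> \<in> A i}"
proof (intro equalityI subsetI)
  fix \<omega> assume "\<omega> \<in> matched n (\<lambda>i. A i \<inter> I i)"
  then obtain \<phi> where \<phi>: "\<phi> \<in> placements n" and \<omega>: "\<omega> \<in> placed n (\<lambda>i. A i \<inter> I i) \<phi>"
    by (auto simp only: matched_def)
  have "matched_age i \<omega> = age (\<phi> i) \<omega>" if "i \<in> V n" for i by (rule matched_age_placed[OF \<phi> _ \<omega> that]) simp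
  then have "\<forall>i\<in>V n. matched_age i \<omega> \<in> A i" using placed_age[OF \<omega>] by simp
  moreover have "\<omega> \<in> placed n I \<phi>" using \<omega> unfolding placed_def by blast
  ultimately show "\<omega> \<in> {\<omega> \<in> matched n I. \<forall>i\<in>V n. matched_age i \<omega> \<in> A i}"
    unfolding matched_def using \<phi> by blast
next
  fix \<omega> assume "\<omega> \<in> {\<omega> \<in> matched n I. \<forall>i\<in>V n. matched_age i \<omega> \<in> A i}"
  then obtain \<phi> where \<phi>: "\<phi> \<in> placements n" and \<omega>: "\<omega> \<in> placed n I \<phi>" and A: "\<forall>i\<in>V n. matched_age i \<omega> \<in> A i"
    by (auto simp only: matched_def)
  have "matched_age i \<omega> = age (\<phi> i) \<omega>" if "i \<in> V n" for i by (rule matched_age_placed[OF \<phi> _ \<omega> that]) simp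
  then have "\<forall>i\<in>V n. age (\<phi> i) \<omega> \<in> A i \<inter> I i" using A placed_age[OF \<omega>] by simp
  then have "\<omega> \<in> placed n (\<lambda>i. A i \<inter> I i) \<phi>" using \<omega> unfolding placed_def by blast
  then show "\<omega> \<in> matched n (\<lambda>i. A i \<inter> I i)" unfolding matched_def using \<phi> by blast
qed

lemma measurable_brood [measurable]:
  assumes B: "\<And>i. B i \<in> sets age_law"
  shows "brood B i \<in> borel_measurable borel"
proof -
  have e: "(\<lambda>s. emeasure (age_intensity s) (B j)) \<in> borel_measurable borel" for j
  proof -
    have [measurable]: "B j \<in> sets borel" using B[of j] by (simp add: sets_age_law)
    show ?thesis unfolding emeasure_age_intensity[OF B] by measurable
  qed
  have "{0..} \<in> sets age_law" using sets.top[of age_law] by simp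
  note [measurable] = measurable_age_intensity[OF this] e
  show ?thesis unfolding brood_def by measurable
qed

text \<open>
One more generation.  The placements give a countable disjoint decomposition of both sides, which is summed through
the measure with density \<open>\<Prod>i\<in>L n. brood B i (matched_age i \<omega>)\<close>.
\<close>

lemma emeasure_matched_Suc:
  assumes B: "\<And>i. B i \<in> sets age_law" and sub: "\<And>i. B i \<subseteq> I i"
  shows "emeasure M (matched (Suc n) B) = (\<integral>\<^sup>+\<omega>. (\<Prod>i\<in>L n. brood B i (matched_age i \<omega>)) * indicator (matched n B) \<omega> \<partial>M)"
proof -
  have dis: "disjoint_family_on B (insert r W)" by (rule disjoint_family_on_mono'[OF I_disjoint sub])
  note [measurable] = measurable_brood[OF B]
  let ?f = "\<lambda>\<omega>. \<Prod>i\<in>L n. brood B i (matched_age i \<omega>)"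
  have f: "?f \<in> borel_measurable M" by measurable
  have "emeasure M (matched (Suc n) B) =
      (\<integral>\<^sup>+\<phi>. emeasure M (placed n B \<phi> \<inter> breeding n B \<phi>) \<partial>count_space (placements n))"
    unfolding matched_Suc[OF dis]
  proof (rule emeasure_UN_countable)
    show "placed n B \<phi> \<inter> breeding n B \<phi> \<in> sets M" if "\<phi> \<in> placements n" for \<phi>
      using sets_placed_M[OF B that] sets_breeding[OF B] by (rule sets.Int)
    show "disjoint_family_on (\<lambda>\<phi>. placed n B \<phi> \<inter> breeding n B \<phi>) (placements n)"
      by (rule disjoint_family_on_mono'[OF disjoint_placed[OF dis]]) blast
  qed (rule countable_placements)
  also have "\<dots> = (\<integral>\<^sup>+\<phi>. emeasure (density M ?f) (placed n B \<phi>) \<partial>count_space (placements n))"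
  proof (rule nn_integral_cong)
    fix \<phi> assume "\<phi> \<in> space (count_space (placements n))"
    then have \<phi>: "\<phi> \<in> placements n" by simp
    have "emeasure M (placed n B \<phi> \<inter> breeding n B \<phi>) =
      (\<integral>\<^sup>+\<omega>. (\<Prod>i\<in>L n. brood B i (age (\<phi> i) \<omega>)) * indicator (placed n B \<phi>) \<omega> \<partial>M)"
      by (rule prob_breeding[OF B dis \<phi>])
    also have "\<dots> = (\<integral>\<^sup>+\<omega>. ?f \<omega> * indicator (placed n B \<phi>) \<omega> \<partial>M)"
    proof (rule nn_integral_cong)
      fix \<omega>
      have "(\<Prod>i\<in>L n. brood B i (age (\<phi> i) \<omega>)) = ?f \<omega>" if \<omega>: "\<omega> \<in> placed n B \<phi>"
      proof (rule prod.cong[OF refl])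
        fix i assume "i \<in> L n"
        then have "i \<in> V n" using L_sub_V by blast
        then show "brood B i (age (\<phi> i) \<omega>) = brood B i (matched_age i \<omega>)"
          by (simp only: matched_age_placed[OF \<phi> sub \<omega>])
      qed
      then show "(\<Prod>i\<in>L n. brood B i (age (\<phi> i) \<omega>)) * indicator (placed n B \<phi>) \<omega> = ?f \<omega> * indicator (placed n B \<phi>) \<omega>"
        by (rule mult_indicator_cong)
    qed
    also have "\<dots> = emeasure (density M ?f) (placed n B \<phi>)"
      by (rule emeasure_density[symmetric, OF f sets_placed_M[OF B \<phi>]])
    finally show "emeasure M (placed n B \<phi> \<inter> breeding n B \<phi>) = emeasure (density M ?f) (placed n B \<phi>)" .
  qed
  also have "\<dots> = emeasure (density M ?f) (matched n B)"
    unfolding matched_def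
  proof (rule emeasure_UN_countable[symmetric])
    show "placed n B \<phi> \<in> sets (density M ?f)" if "\<phi> \<in> placements n" for \<phi>
      using sets_placed_M[OF B that] by simp
  qed (rule countable_placements, rule disjoint_placed[OF dis])
  also have "\<dots> = (\<integral>\<^sup>+\<omega>. ?f \<omega> * indicator (matched n B) \<omega> \<partial>M)"
    by (rule emeasure_density[OF f sets_matched[OF B]])
  finally show ?thesis .
qed

end

context tree_match
begin

interpretation lb: product_sigma_finite "\<lambda>_::nat. lborel :: real measure" ..

abbreviation PV :: "nat \<Rightarrow> (nat \<Rightarrow> real) measure" where "PV n \<equiv> PiM (V n) (\<lambda>_. lborel)"

text \<open>
Vertices of depth \<open>n\<close> have not reproduced yet, so they lack the void factor.
\<close>

definition match_density :: "nat \<Rightarrow> (nat \<Rightarrow> real) \<Rightarrow> ennreal" where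
  "match_density n a = (\<Prod>i\<in>V n. indicator (I i) (a i) * ennreal (age_density (a i))) *
     ((\<Prod>j\<in>V n - {r}. ennreal (min (a j) (a (p j)))) *
      (\<Prod>i\<in>V n - L n. ennreal (exp (- measure (age_intensity (a i)) {0..}))))"

definition match_law :: "nat \<Rightarrow> (nat \<Rightarrow> real) measure" where
  "match_law n = distr (density M (indicator (matched n I))) (PV n) (\<lambda>\<omega>. \<lambda>i\<in>V n. matched_age i \<omega>)"

lemma I_borel [measurable]: "I i \<in> sets borel"
  using I_sets[of i] by (simp add: sets_age_law)

lemma half_line_sets: "{0..} \<in> sets age_law"
  using sets.top[of age_law] by simp

lemma measurable_void [measurable]: "(\<lambda>s. measure (age_intensity s) {0..}) \<in> borel_measurable borel"
  by (rule measurable_age_intensity[OF half_line_sets])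

lemma measurable_coordinate: "i \<in> V n \<Longrightarrow> (\<lambda>a. a i) \<in> borel_measurable (PV n)"
  using measurable_component_singleton[of i "V n" "\<lambda>_. lborel :: real measure"] by simp

lemma measurable_match_density [measurable]: "match_density n \<in> borel_measurable (PV n)"
  unfolding match_density_def
proof (intro borel_measurable_times_ennreal borel_measurable_prod_ennreal)
  fix i assume i: "i \<in> V n"
  note [measurable] = measurable_coordinate[OF i]
  show "(\<lambda>a. indicator (I i) (a i) :: ennreal) \<in> borel_measurable (PV n)" by measurable
  show "(\<lambda>a. ennreal (age_density (a i))) \<in> borel_measurable (PV n)" by measurable
next
  fix j assume j: "j \<in> V n - {r}"
  then have "j \<in> V n" by simp
  note [measurable] = measurable_coordinate[OF this] measurable_coordinate[OF V_parent[OF j]]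
  show "(\<lambda>a. ennreal (min (a j) (a (p j)))) \<in> borel_measurable (PV n)" by measurable
next
  fix i assume "i \<in> V n - L n"
  then have "i \<in> V n" by simp
  note [measurable] = measurable_coordinate[OF this]
  show "(\<lambda>a. ennreal (exp (- measure (age_intensity (a i)) {0..}))) \<in> borel_measurable (PV n)" by measurable
qed

lemma measurable_vec [measurable]: "(\<lambda>\<omega>. \<lambda>i\<in>V n. matched_age i \<omega>) \<in> measurable M (PV n)"
  by (rule measurable_restrict) simp

lemma nn_integral_match_law:
  assumes F: "F \<in> borel_measurable (PV n)"
  shows "(\<integral>\<^sup>+a. F a \<partial>match_law n) = (\<integral>\<^sup>+\<omega>. F (\<lambda>i\<in>V n. matched_age i \<omega>) * indicator (matched n I) \<omega> \<partial>M)"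
proof -
  note [measurable] = sets_matched[OF I_sets, of n] F
  have "(\<integral>\<^sup>+a. F a \<partial>match_law n) = (\<integral>\<^sup>+\<omega>. F (\<lambda>i\<in>V n. matched_age i \<omega>) \<partial>density M (indicator (matched n I)))"
    unfolding match_law_def by (rule nn_integral_distr) measurable
  also have "\<dots> = (\<integral>\<^sup>+\<omega>. indicator (matched n I) \<omega> * F (\<lambda>i\<in>V n. matched_age i \<omega>) \<partial>M)"
    by (rule nn_integral_density) measurable
  finally show ?thesis by (simp only: mult.commute)
qed

lemma box_indicator:
  assumes "finite J"
  shows "(\<Prod>i\<in>J. indicator (A i) (a i)) = (if \<forall>i\<in>J. a i \<in> A i then 1 else (0::ennreal))"
proof (cases "\<forall>i\<in>J. a i \<in> A i")
  case True
  then have "(\<Prod>i\<in>J. indicator (A i) (a i) :: ennreal) = 1" by (intro prod.neutral) simp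
  with True show ?thesis by simp
next
  case False
  then obtain i where i: "i \<in> J" "a i \<notin> A i" by blast
  then have "(\<Prod>i\<in>J. indicator (A i) (a i) :: ennreal) = 0"
    using assms i by (intro prod_zero bexI[of _ i]) (simp_all only: indicator_simps)
  with False show ?thesis by (simp only: if_False)
qed

lemma emeasure_match_law_box:
  assumes A: "\<And>i. A i \<in> sets borel"
  shows "emeasure (match_law n) (PiE (V n) A) = emeasure M (matched n (\<lambda>i. A i \<inter> I i))"
proof -
  have box: "PiE (V n) A \<in> sets (PV n)" using A by (intro sets_PiM_I_finite) auto
  have "emeasure (match_law n) (PiE (V n) A) = (\<integral>\<^sup>+a. indicator (PiE (V n) A) a \<partial>match_law n)"
    using box by (simp add: match_law_def)
  also have "\<dots> = (\<integral>\<^sup>+\<omega>. indicator (PiE (V n) A) (\<lambda>i\<in>V n. matched_age i \<omega>) * indicator (matched n I) \<omega> \<partial>M)"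
    by (rule nn_integral_match_law) (use box in simp)
  also have "\<dots> = (\<integral>\<^sup>+\<omega>. indicator (matched n (\<lambda>i. A i \<inter> I i)) \<omega> \<partial>M)"
    unfolding matched_Int by (intro nn_integral_cong) (auto simp: PiE_def Pi_def extensional_def indicator_def)
  also have "\<dots> = emeasure M (matched n (\<lambda>i. A i \<inter> I i))"
  proof (rule nn_integral_indicator[OF sets_matched])
    show "A i \<inter> I i \<in> sets age_law" for i using A[of i] I_sets[of i] by (auto simp: sets_age_law)
  qed
  finally show ?thesis .
qed

text \<open>
It suffices to compare boxes, and on boxes the law is the probability of matching with smaller sets.
\<close>

lemma match_law_eqI:
  assumes "\<And>A. (\<And>i. A i \<in> sets borel) \<Longrightarrow> emeasure M (matched n (\<lambda>i. A i \<inter> I i)) =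
     (\<integral>\<^sup>+a. (\<Prod>i\<in>V n. indicator (A i) (a i)) * match_density n a \<partial>PV n)"
  shows "match_law n = density (PV n) (match_density n)"
proof (rule measure_eqI_PiM_finite)
  show "sets (match_law n) = PiM (V n) (\<lambda>_. lborel)" by (simp add: match_law_def)
  show "sets (density (PV n) (match_density n)) = PiM (V n) (\<lambda>_. lborel)" by simp
  fix A :: "nat \<Rightarrow> real set" assume A: "\<And>i. i \<in> V n \<Longrightarrow> A i \<in> sets lborel"
  define A' where "A' i = (if i \<in> V n then A i else {})" for i
  have A': "A' i \<in> sets borel" for i using A[of i] by (simp add: A'_def)
  have eq: "PiE (V n) A = PiE (V n) A'" by (rule PiE_cong) (simp add: A'_def)
  have box: "PiE (V n) A' \<in> sets (PV n)" using A' by (intro sets_PiM_I_finite) auto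
  have "emeasure (match_law n) (PiE (V n) A') = (\<integral>\<^sup>+a. (\<Prod>i\<in>V n. indicator (A' i) (a i)) * match_density n a \<partial>PV n)"
    unfolding emeasure_match_law_box[OF A'] by (rule assms[OF A'])
  also have "\<dots> = (\<integral>\<^sup>+a. match_density n a * indicator (PiE (V n) A') a \<partial>PV n)"
  proof (rule nn_integral_cong)
    fix a assume "a \<in> space (PV n)"
    then have "a \<in> PiE (V n) A' \<longleftrightarrow> (\<forall>i\<in>V n. a i \<in> A' i)" by (auto simp: space_PiM PiE_def)
    then show "(\<Prod>i\<in>V n. indicator (A' i) (a i)) * match_density n a = match_density n a * indicator (PiE (V n) A') a"
      unfolding box_indicator[OF finite_V] by simp
  qed
  also have "\<dots> = emeasure (density (PV n) (match_density n)) (PiE (V n) A')"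
    by (rule emeasure_density[symmetric]) (use box in simp_all)
  finally show "emeasure (match_law n) (PiE (V n) A) = emeasure (density (PV n) (match_density n)) (PiE (V n) A)"
    unfolding eq .
next
  show "range (\<lambda>_::nat. space (PV n)) \<subseteq> prod_algebra (V n) (\<lambda>_. lborel)"
    by (auto simp: space_PiM intro!: prod_algebraI_finite)
  show "(\<Union>i::nat. space (PV n)) = space (PiM (V n) (\<lambda>_. lborel))" by simp
  have "emeasure (match_law n) (space (match_law n)) = (\<integral>\<^sup>+a. 1 \<partial>match_law n)" by simp
  also have "\<dots> = (\<integral>\<^sup>+\<omega>. 1 * indicator (matched n I) \<omega> \<partial>M)"
    by (rule nn_integral_match_law) simp
  also have "\<dots> = emeasure M (matched n I)"
    using nn_integral_indicator[OF sets_matched[OF I_sets], of n] by (simp only: mult_1)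
  also have "\<dots> \<noteq> \<infinity>" by simp
  finally have "emeasure (match_law n) (space (PV n)) \<noteq> \<infinity>" by (simp add: match_law_def)
  then show "emeasure (match_law n) (space (PV n)) \<noteq> \<infinity>" for i :: nat
    .
qed simp

lemma match_law_0: "match_law 0 = density (PV 0) (match_density 0)"
proof (rule match_law_eqI)
  fix A :: "nat \<Rightarrow> real set" assume A [measurable]: "\<And>i. A i \<in> sets borel"
  let ?B = "A r \<inter> I r"
  have B: "?B \<in> sets age_law" using A[of r] I_sets[of r] by (auto simp: sets_age_law)
  have age_meas: "age [] \<in> measurable M age_law"
  proof (rule measurableI)
    show "age [] \<omega> \<in> space age_law" if "\<omega> \<in> space M" for \<omega>
      using age_nonneg[OF that root_mem[OF that]] by simp
    show "age [] -` C \<inter> space M \<in> sets M" if "C \<in> sets age_law" for C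
      using that by (intro measurable_sets[OF measurable_age]) (simp add: sets_age_law)
  qed
  have single: "placements 0 = {\<lambda>i\<in>{r}. []}"
    by (auto simp: placements_def V_0 PiE_def extensional_def fun_eq_iff)
  have "matched 0 (\<lambda>i. A i \<inter> I i) = age [] -` ?B \<inter> space M"
    unfolding matched_def single placed_def V_0 using root_mem by auto
  then have "emeasure M (matched 0 (\<lambda>i. A i \<inter> I i)) = emeasure (distr M age_law (age [])) ?B"
    using emeasure_distr[OF age_meas B] by simp
  also have "\<dots> = (\<integral>\<^sup>+x. ennreal (age_density x) * indicator ?B x \<partial>lborel)"
    unfolding root_law by (rule emeasure_age_law[OF B])
  also have "\<dots> = (\<integral>\<^sup>+x. indicator (A r) x * (indicator (I r) x * ennreal (age_density x)) \<partial>lborel)"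
    by (intro nn_integral_cong) (simp add: indicator_inter_arith mult_ac)
  also have "\<dots> = (\<integral>\<^sup>+a. indicator (A r) (a r) * (indicator (I r) (a r) * ennreal (age_density (a r))) \<partial>PiM {r} (\<lambda>_. lborel))"
    by (rule lb.product_nn_integral_singleton[symmetric]) measurable
  also have "\<dots> = (\<integral>\<^sup>+a. (\<Prod>i\<in>V 0. indicator (A i) (a i)) * match_density 0 a \<partial>PV 0)"
  proof -
    have "V 0 - L 0 = {}" by (auto simp: V_def L_def)
    then show ?thesis unfolding match_density_def V_0 by simp
  qed
  finally show "emeasure M (matched 0 (\<lambda>i. A i \<inter> I i)) = (\<integral>\<^sup>+a. (\<Prod>i\<in>V 0. indicator (A i) (a i)) * match_density 0 a \<partial>PV 0)" .
qed

lemma merge_V: "i \<in> V n \<Longrightarrow> merge (V n) (L (Suc n)) (x, y) i = x i"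
  and merge_L: "i \<in> L (Suc n) \<Longrightarrow> merge (V n) (L (Suc n)) (x, y) i = y i"
  using V_Suc(2)[of n] by (auto simp: merge_def)

lemma match_density_merge:
  "(\<Prod>i\<in>V (Suc n). indicator (A i) (merge (V n) (L (Suc n)) (x, y) i)) * match_density (Suc n) (merge (V n) (L (Suc n)) (x, y)) =
   (((\<Prod>i\<in>V n. indicator (A i) (x i)) * match_density n x) * (\<Prod>i\<in>L n. ennreal (exp (- measure (age_intensity (x i)) {0..})))) *
   (\<Prod>j\<in>L (Suc n). ennreal (age_density (y j)) * ennreal (min (y j) (x (p j))) * indicator (A j \<inter> I j) (y j))"
proof -
  let ?m = "merge (V n) (L (Suc n)) (x, y)"
  have split: "prod f (V (Suc n)) = prod f (V n) * prod f (L (Suc n))" for f :: "nat \<Rightarrow> ennreal"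
    unfolding V_Suc(1) by (rule prod.union_disjoint) (auto simp: V_Suc(2))
  have pL: "p j \<in> V n" if "j \<in> L (Suc n)" for j using L_Suc_W[OF that] L_sub_V by blast
  have 1: "(\<Prod>i\<in>V (Suc n). indicator (A i) (?m i)) = (\<Prod>i\<in>V n. indicator (A i) (x i)) * (\<Prod>j\<in>L (Suc n). indicator (A j) (y j) :: ennreal)"
    unfolding split by (simp add: merge_V merge_L cong: prod.cong)
  have 2: "(\<Prod>i\<in>V (Suc n). indicator (I i) (?m i) * ennreal (age_density (?m i))) =
      (\<Prod>i\<in>V n. indicator (I i) (x i) * ennreal (age_density (x i))) *
      (\<Prod>j\<in>L (Suc n). indicator (I j) (y j) * ennreal (age_density (y j)))"
    unfolding split by (simp add: merge_V merge_L cong: prod.cong)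
  have Vr: "V (Suc n) - {r} = (V n - {r}) \<union> L (Suc n)"
    using V_Suc r L_Suc_W by blast
  have 3: "(\<Prod>j\<in>V (Suc n) - {r}. ennreal (min (?m j) (?m (p j)))) =
      (\<Prod>j\<in>V n - {r}. ennreal (min (x j) (x (p j)))) * (\<Prod>j\<in>L (Suc n). ennreal (min (y j) (x (p j))))"
  proof -
    have "(\<Prod>j\<in>V (Suc n) - {r}. ennreal (min (?m j) (?m (p j)))) =
      (\<Prod>j\<in>V n - {r}. ennreal (min (?m j) (?m (p j)))) * (\<Prod>j\<in>L (Suc n). ennreal (min (?m j) (?m (p j))))"
      unfolding Vr by (rule prod.union_disjoint) (use V_Suc(2) in auto)
    also have "(\<Prod>j\<in>V n - {r}. ennreal (min (?m j) (?m (p j)))) = (\<Prod>j\<in>V n - {r}. ennreal (min (x j) (x (p j))))"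
      using V_parent by (intro prod.cong refl) (simp add: merge_V)
    also have "(\<Prod>j\<in>L (Suc n). ennreal (min (?m j) (?m (p j)))) = (\<Prod>j\<in>L (Suc n). ennreal (min (y j) (x (p j))))"
      using pL by (intro prod.cong refl) (simp add: merge_V merge_L)
    finally show ?thesis .
  qed
  have VL: "V (Suc n) - L (Suc n) = V n" using V_Suc by blast
  have 4: "(\<Prod>i\<in>V (Suc n) - L (Suc n). ennreal (exp (- measure (age_intensity (?m i)) {0..}))) =
     (\<Prod>i\<in>V n - L n. ennreal (exp (- measure (age_intensity (x i)) {0..}))) *
     (\<Prod>i\<in>L n. ennreal (exp (- measure (age_intensity (x i)) {0..})))"
  proof -
    have "(\<Prod>i\<in>V n. ennreal (exp (- measure (age_intensity (?m i)) {0..}))) = (\<Prod>i\<in>V n. ennreal (exp (- measure (age_intensity (x i)) {0..})))"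
      by (intro prod.cong refl) (simp add: merge_V)
    also have "\<dots> = (\<Prod>i\<in>V n - L n. ennreal (exp (- measure (age_intensity (x i)) {0..}))) *
     (\<Prod>i\<in>L n. ennreal (exp (- measure (age_intensity (x i)) {0..})))"
      by (rule prod.subset_diff[OF L_sub_V finite_V])
    finally show ?thesis unfolding VL .
  qed
  have 5: "(\<Prod>j\<in>L (Suc n). ennreal (age_density (y j)) * ennreal (min (y j) (x (p j))) * indicator (A j \<inter> I j) (y j)) =
     (\<Prod>j\<in>L (Suc n). indicator (A j) (y j)) * ((\<Prod>j\<in>L (Suc n). indicator (I j) (y j) * ennreal (age_density (y j))) *
     (\<Prod>j\<in>L (Suc n). ennreal (min (y j) (x (p j)))))"
    unfolding prod.distrib[symmetric] by (intro prod.cong refl) (simp add: indicator_inter_arith mult_ac)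
  have reorder: "(a * b) * ((c * e) * ((f * g) * (h * k))) = ((a * (c * (f * h))) * k) * (b * (e * g))"
    for a b c e f g h k :: ennreal by (simp only: mult_ac)
  show ?thesis unfolding match_density_def 1 2 3 4 5 by (rule reorder)
qed

text \<open>
The children of depth \<open>n + 1\<close> are integrated out first: for fixed ages of their parents they contribute the product of
the \<open>emeasure (age_intensity (x (p j))) (A j \<inter> I j)\<close>, which together with the void factors of the parents is the
product of the \<open>brood\<close> terms.
\<close>

lemma match_law_Suc:
  assumes IH: "match_law n = density (PV n) (match_density n)"
  shows "match_law (Suc n) = density (PV (Suc n)) (match_density (Suc n))"
proof (rule match_law_eqI)
  fix A :: "nat \<Rightarrow> real set" assume A [measurable]: "\<And>i. A i \<in> sets borel"
  let ?B = "\<lambda>i. A i \<inter> I i"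
  have B: "?B i \<in> sets age_law" for i using A[of i] I_sets[of i] by (auto simp: sets_age_law)
  let ?void = "\<lambda>s. ennreal (exp (- measure (age_intensity s) {0..}))"
  let ?F = "\<lambda>a. (\<Prod>i\<in>V n. indicator (A i) (a i)) * (\<Prod>i\<in>L n. brood ?B i (a i))"
  let ?k = "\<lambda>x j t. ennreal (age_density t) * ennreal (min t (x (p j))) * indicator (?B j) t"
  let ?C = "\<lambda>x. ((\<Prod>i\<in>V n. indicator (A i) (x i)) * match_density n x) * (\<Prod>i\<in>L n. ?void (x i))"
  have F: "?F \<in> borel_measurable (PV n)"
  proof (intro borel_measurable_times_ennreal borel_measurable_prod_ennreal)
    show "(\<lambda>a. indicator (A i) (a i) :: ennreal) \<in> borel_measurable (PV n)" if "i \<in> V n" for i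
      by (rule measurable_compose[OF measurable_coordinate[OF that]]) measurable
    show "(\<lambda>a. brood ?B i (a i)) \<in> borel_measurable (PV n)" if "i \<in> L n" for i
      using that L_sub_V by (intro measurable_compose[OF measurable_coordinate measurable_brood[OF B]]) auto
  qed
  have "emeasure M (matched (Suc n) ?B) = (\<integral>\<^sup>+\<omega>. (\<Prod>i\<in>L n. brood ?B i (matched_age i \<omega>)) * indicator (matched n ?B) \<omega> \<partial>M)"
    by (rule emeasure_matched_Suc[OF B]) simp
  also have "\<dots> = (\<integral>\<^sup>+\<omega>. ?F (\<lambda>i\<in>V n. matched_age i \<omega>) * indicator (matched n I) \<omega> \<partial>M)"
  proof (rule nn_integral_cong)
    fix \<omega>
    have "(\<Prod>i\<in>L n. brood ?B i ((\<lambda>i\<in>V n. matched_age i \<omega>) i)) = (\<Prod>i\<in>L n. brood ?B i (matched_age i \<omega>))"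
      using L_sub_V by (intro prod.cong refl) auto
    moreover have "(indicator (matched n ?B) \<omega> :: ennreal) = (\<Prod>i\<in>V n. indicator (A i) ((\<lambda>i\<in>V n. matched_age i \<omega>) i)) * indicator (matched n I) \<omega>"
      unfolding matched_Int box_indicator[OF finite_V] by (simp add: indicator_def)
    ultimately show "(\<Prod>i\<in>L n. brood ?B i (matched_age i \<omega>)) * indicator (matched n ?B) \<omega> = ?F (\<lambda>i\<in>V n. matched_age i \<omega>) * indicator (matched n I) \<omega>"
      by (simp only: mult_ac)
  qed
  also have "\<dots> = (\<integral>\<^sup>+a. ?F a \<partial>match_law n)" by (rule nn_integral_match_law[OF F, symmetric])
  also have "\<dots> = (\<integral>\<^sup>+x. match_density n x * ?F x \<partial>PV n)" unfolding IH by (rule nn_integral_density[OF measurable_match_density F])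
  also have "\<dots> = (\<integral>\<^sup>+x. (\<integral>\<^sup>+y. ?C x * (\<Prod>j\<in>L (Suc n). ?k x j (y j)) \<partial>PiM (L (Suc n)) (\<lambda>_. lborel)) \<partial>PV n)"
  proof (rule nn_integral_cong)
    fix x
    have km: "?k x j \<in> borel_measurable lborel" for j by measurable
    have "(\<integral>\<^sup>+y. ?C x * (\<Prod>j\<in>L (Suc n). ?k x j (y j)) \<partial>PiM (L (Suc n)) (\<lambda>_. lborel)) =
       ?C x * (\<integral>\<^sup>+y. (\<Prod>j\<in>L (Suc n). ?k x j (y j)) \<partial>PiM (L (Suc n)) (\<lambda>_. lborel))"
    proof (rule nn_integral_cmult, rule borel_measurable_prod_ennreal)
      show "(\<lambda>y. ?k x j (y j)) \<in> borel_measurable (PiM (L (Suc n)) (\<lambda>_. lborel))" if "j \<in> L (Suc n)" for j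
        by (rule measurable_compose[OF measurable_component_singleton[OF that] km])
    qed
    also have "(\<integral>\<^sup>+y. (\<Prod>j\<in>L (Suc n). ?k x j (y j)) \<partial>PiM (L (Suc n)) (\<lambda>_. lborel)) =
        (\<Prod>j\<in>L (Suc n). integral\<^sup>N lborel (?k x j))"
      by (rule lb.product_nn_integral_prod[OF finite_L km])
    also have "\<dots> = (\<Prod>j\<in>L (Suc n). emeasure (age_intensity (x (p j))) (?B j))"
      by (intro prod.cong refl emeasure_age_intensity[OF B, symmetric])
    also have "\<dots> = (\<Prod>i\<in>L n. \<Prod>j\<in>kids i. emeasure (age_intensity (x (p j))) (?B j))"
      unfolding L_Suc by (rule prod.UNION_disjoint) (simp_all, auto simp: kids_def)
    also have "\<dots> = (\<Prod>i\<in>L n. \<Prod>j\<in>kids i. emeasure (age_intensity (x i)) (?B j))"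
      by (intro prod.cong refl) (simp add: kids_def)
    finally show "match_density n x * ?F x = (\<integral>\<^sup>+y. ?C x * (\<Prod>j\<in>L (Suc n). ?k x j (y j)) \<partial>PiM (L (Suc n)) (\<lambda>_. lborel))"
      by (simp only: brood_def prod.distrib mult_ac)
  qed
  also have "\<dots> = (\<integral>\<^sup>+x. (\<integral>\<^sup>+y. (\<lambda>a. (\<Prod>i\<in>V (Suc n). indicator (A i) (a i)) * match_density (Suc n) a)
       (merge (V n) (L (Suc n)) (x, y)) \<partial>PiM (L (Suc n)) (\<lambda>_. lborel)) \<partial>PV n)"
    by (simp only: match_density_merge)
  also have "\<dots> = (\<integral>\<^sup>+a. (\<Prod>i\<in>V (Suc n). indicator (A i) (a i)) * match_density (Suc n) a \<partial>PV (Suc n))"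
  proof -
    have "(\<lambda>a. (\<Prod>i\<in>V (Suc n). indicator (A i) (a i)) * match_density (Suc n) a) \<in> borel_measurable (PV (Suc n))"
    proof (intro borel_measurable_times_ennreal borel_measurable_prod_ennreal measurable_match_density)
      show "(\<lambda>a. indicator (A i) (a i) :: ennreal) \<in> borel_measurable (PV (Suc n))" if "i \<in> V (Suc n)" for i
        by (rule measurable_compose[OF measurable_coordinate[OF that]]) measurable
    qed
    then show ?thesis
      using lb.product_nn_integral_fold[of "V n" "L (Suc n)" "\<lambda>a. (\<Prod>i\<in>V (Suc n). indicator (A i) (a i)) * match_density (Suc n) a"] V_Suc
      by simp
  qed
  finally show "emeasure M (matched (Suc n) ?B) = (\<integral>\<^sup>+a. (\<Prod>i\<in>V (Suc n). indicator (A i) (a i)) * match_density (Suc n) a \<partial>PV (Suc n))" .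
qed

lemma match_law_eq: "match_law n = density (PV n) (match_density n)"
  by (induction n) (rule match_law_0, rule match_law_Suc)

end

context tree_match
begin

text \<open>
Past the largest depth the last generation is empty, so matching determines the whole tree.
\<close>

lemma V_L_large:
  obtains N where "V N = insert r W" "L N = {}"
proof -
  let ?N = "Suc (Max (d ` insert r W))"
  have "d i < ?N" if "i \<in> insert r W" for i
    using finite_W that by (intro le_imp_less_Suc Max_ge) auto
  then have "V ?N = insert r W" "L ?N = {}" by (force simp: V_def L_def intro: less_imp_le)+
  then show thesis by (rule that)
qed

lemma vertex_prefix: "\<omega> \<in> space M \<Longrightarrow> u @ v \<in> dom (H \<omega>) \<Longrightarrow> u \<in> dom (H \<omega>)"
proof (induction v rule: rev_induct)
  case (snoc x xs)
  then show ?case using parent_mem[of \<omega> "u @ xs" x] by simp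
qed simp

definition full_match :: "'w set" where
  "full_match = {\<omega> \<in> space M. \<exists>\<phi>. \<phi> r = [] \<and> (\<forall>j\<in>W. \<exists>c. \<phi> j = \<phi> (p j) @ [c]) \<and>
     dom (H \<omega>) = \<phi> ` insert r W \<and> (\<forall>i\<in>insert r W. age (\<phi> i) \<omega> \<in> I i)}"

lemma matched_eq_full_match:
  assumes N: "V N = insert r W" "L N = {}"
  shows "matched N I = full_match"
proof (intro equalityI subsetI)
  fix \<omega> assume "\<omega> \<in> matched N I"
  then obtain \<phi> where \<phi>: "\<phi> \<in> placements N" and \<omega>: "\<omega> \<in> placed N I \<phi>" by (auto simp only: matched_def)
  have \<omega>M: "\<omega> \<in> space M" using \<omega> by (auto simp: placed_def)
  have short: "length u \<le> N" if u: "u \<in> dom (H \<omega>)" for u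
  proof (rule ccontr)
    assume "\<not> ?thesis"
    then have len: "length (take N u) = N" by simp
    have "take N u \<in> dom (H \<omega>)" using vertex_prefix[OF \<omega>M, of "take N u" "drop N u"] u by simp
    then obtain i where "i \<in> V N" "take N u = \<phi> i" using placed_vertex[OF \<omega>, of "take N u"] len by auto
    then have "i \<in> L N" using length_placement[OF \<phi>, of i] len by (simp add: V_def L_def)
    then show False using N by simp
  qed
  have "dom (H \<omega>) = \<phi> ` insert r W"
  proof (rule set_eqI)
    fix u
    have "\<exists>i\<in>insert r W. u = \<phi> i" if "u \<in> dom (H \<omega>)"
      using placed_vertex[OF \<omega> that short[OF that]] unfolding N(1) .
    moreover have "\<phi> i \<in> dom (H \<omega>)" if "i \<in> insert r W" for i
      using placed_dom[OF \<omega> \<phi>, of i] that unfolding N(1) by simp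
    ultimately show "u \<in> dom (H \<omega>) \<longleftrightarrow> u \<in> \<phi> ` insert r W" by blast
  qed
  moreover have "\<phi> r = []" "\<forall>j\<in>W. \<exists>c. \<phi> j = \<phi> (p j) @ [c]"
    using \<phi> N r by (auto simp: placements_def)
  moreover have "\<forall>i\<in>insert r W. age (\<phi> i) \<omega> \<in> I i" using placed_age[OF \<omega>] N by simp
  ultimately show "\<omega> \<in> full_match"
    unfolding full_match_def by (intro CollectI conjI exI[of _ \<phi>] \<omega>M)
next
  fix \<omega> assume "\<omega> \<in> full_match"
  note full = this[unfolded full_match_def, THEN CollectD]
  then have \<omega>M: "\<omega> \<in> space M" by (rule conjunct1)
  from full[THEN conjunct2] obtain \<phi>0 where f: "\<phi>0 r = [] \<and> (\<forall>j\<in>W. \<exists>c. \<phi>0 j = \<phi>0 (p j) @ [c]) \<and>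
     dom (H \<omega>) = \<phi>0 ` insert r W \<and> (\<forall>i\<in>insert r W. age (\<phi>0 i) \<omega> \<in> I i)" by (rule exE)
  then have \<phi>0: "\<phi>0 r = []" "\<And>j. j \<in> W \<Longrightarrow> \<exists>c. \<phi>0 j = \<phi>0 (p j) @ [c]"
     "dom (H \<omega>) = \<phi>0 ` insert r W" "\<And>i. i \<in> insert r W \<Longrightarrow> age (\<phi>0 i) \<omega> \<in> I i"
    by blast+
  define \<phi> where "\<phi> = restrict \<phi>0 (insert r W)"
  have eq: "\<phi> i = \<phi>0 i" if "i \<in> insert r W" for i using that by (simp only: \<phi>_def restrict_apply if_True)
  have "\<phi> \<in> placements N"
    unfolding placements_def N(1)
  proof (intro CollectI conjI ballI)
    show "\<phi> \<in> insert r W \<rightarrow>\<^sub>E UNIV" unfolding \<phi>_def by simp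
    show "\<phi> r = []" using eq[of r] \<phi>0(1) by simp
    fix j assume j: "j \<in> insert r W - {r}"
    then have "j \<in> W" by blast
    with \<phi>0(2)[OF this] show "\<exists>c. \<phi> j = \<phi> (p j) @ [c]" using eq[of j] eq[OF p_mem[of j]] by auto
  qed
  moreover have im: "\<phi> ` insert r W = \<phi>0 ` insert r W" by (rule image_cong[OF refl eq])
  have "\<omega> \<in> placed N I \<phi>"
    unfolding placed_def N(1) im
  proof (intro CollectI conjI allI impI ballI \<omega>M refl)
    fix i assume i: "i \<in> insert r W"
    show "age (\<phi> i) \<omega> \<in> I i" unfolding eq[OF i] by (rule \<phi>0(4)[OF i])
  next
    fix u :: "nat list"
    show "u \<in> dom (H \<omega>) \<longleftrightarrow> u \<in> \<phi>0 ` insert r W" by (simp only: \<phi>0(3))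
  qed
  ultimately show "\<omega> \<in> matched N I" unfolding matched_def by blast
qed

lemma sets_full_match: "full_match \<in> sets M"
proof -
  obtain N where "V N = insert r W" "L N = {}" by (rule V_L_large)
  then have "full_match = matched N I" by (rule matched_eq_full_match[symmetric])
  then show ?thesis by (simp only: sets_matched[OF I_sets])
qed

lemma emeasure_full_match:
  "emeasure M full_match = (\<integral>\<^sup>+a. (\<Prod>i\<in>insert r W. indicator (I i) (a i) * ennreal (exp (- a i) / 2)) *
     (\<Prod>j\<in>W. ennreal (min (a j) (a (p j)))) \<partial>PiM (insert r W) (\<lambda>_. lborel))"
proof -
  obtain N where N: "V N = insert r W" "L N = {}" by (rule V_L_large)
  have "emeasure M full_match = emeasure M (matched N I)" by (simp only: matched_eq_full_match[OF N])
  also have "\<dots> = (\<integral>\<^sup>+\<omega>. 1 * indicator (matched N I) \<omega> \<partial>M)"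
    using nn_integral_indicator[OF sets_matched[OF I_sets], of N] by (simp only: mult_1)
  also have "\<dots> = (\<integral>\<^sup>+a. 1 \<partial>match_law N)"
    by (rule nn_integral_match_law[symmetric]) simp
  also have "\<dots> = (\<integral>\<^sup>+a. match_density N a * 1 \<partial>PiM (V N) (\<lambda>_. lborel))"
    unfolding match_law_eq by (rule nn_integral_density) simp_all
  also have "\<dots> = (\<integral>\<^sup>+a. (\<Prod>i\<in>insert r W. indicator (I i) (a i) * ennreal (exp (- a i) / 2)) *
     (\<Prod>j\<in>W. ennreal (min (a j) (a (p j)))) \<partial>PiM (insert r W) (\<lambda>_. lborel))"
    unfolding N(1)
  proof (rule nn_integral_cong)
    fix a
    have Wr: "insert r W - {r} = W" using r by simp
    have "(\<Prod>i\<in>insert r W. indicator (I i) (a i) * ennreal (age_density (a i))) *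
        (\<Prod>i\<in>insert r W. ennreal (exp (- measure (age_intensity (a i)) {0..}))) =
        (\<Prod>i\<in>insert r W. indicator (I i) (a i) * ennreal (exp (- a i) / 2))"
      unfolding prod.distrib[symmetric]
    proof (rule prod.cong[OF refl])
      fix i
      show "indicator (I i) (a i) * ennreal (age_density (a i)) * ennreal (exp (- measure (age_intensity (a i)) {0..}))
         = indicator (I i) (a i) * ennreal (exp (- a i) / 2)"
      proof (cases "a i \<in> I i")
        case True
        then have "0 \<le> a i" using I_sets[of i] by (auto simp: sets_age_law)
        note void_probability_times_age_density[OF this]
        then have "ennreal (age_density (a i)) * ennreal (exp (- measure (age_intensity (a i)) {0..})) = ennreal (exp (- a i) / 2)"
          using age_density_pos[of "a i"] by (simp add: ennreal_mult[symmetric] mult.commute)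
        then show ?thesis by (simp add: mult.assoc)
      qed simp
    qed
    then show "match_density N a * 1 = (\<Prod>i\<in>insert r W. indicator (I i) (a i) * ennreal (exp (- a i) / 2)) *
     (\<Prod>j\<in>W. ennreal (min (a j) (a (p j))))"
      unfolding match_density_def N Wr Diff_empty by (simp only: mult_ac mult_1)
  qed
  finally show ?thesis .
qed

end

section \<open>Trees with distinct ages and their ranks\<close>

lemma sorted_ages_placement:
  assumes bij: "bij_betw \<phi> {1..k} (dom t)" and mono: "strict_mono_on {1..k} (\<lambda>i. the (t (\<phi> i)))"
    and i: "i \<in> {1..k}"
  shows "sorted_ages k t i = the (t (\<phi> i))"
proof -
  let ?f = "\<lambda>i. the (t (\<phi> i))" and ?xs = "map (\<lambda>i. the (t (\<phi> i))) [1..<Suc k]"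
  have set: "{1..k} = set [1..<Suc k]" by auto
  have "image_mset (\<lambda>u. the (t u)) (mset_set (dom t)) = image_mset (\<lambda>u. the (t u)) (image_mset \<phi> (mset_set {1..k}))"
    using bij by (simp add: image_mset_mset_set bij_betw_def)
  also have "\<dots> = mset ?xs"
    unfolding set by (subst mset_set_set) (auto simp: multiset.map_comp o_def simp del: upt_Suc)
  finally have m: "image_mset (\<lambda>u. the (t u)) (mset_set (dom t)) = mset ?xs" .
  have "sorted ?xs"
    unfolding sorted_iff_nth_mono
  proof (intro allI impI)
    fix a b assume ab: "a \<le> b" "b < length ?xs"
    then have "b < k" by (simp del: upt_Suc)
    then have "?f (Suc a) \<le> ?f (Suc b)"
      using strict_mono_onD[OF mono, of "Suc a" "Suc b"] ab(1) by (cases "a = b") auto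
    then show "?xs ! a \<le> ?xs ! b" using ab by (simp del: upt_Suc add: nth_map_upt)
  qed
  then have "sorted_list_of_multiset (mset ?xs) = ?xs"
    by (simp only: sorted_list_of_multiset_mset sorted_sort_id)
  moreover have "nth_default 0 ?xs (i - 1) = ?f i"
  proof -
    have "i - 1 < length [1..<Suc k]" "[1..<Suc k] ! (i - 1) = i" using i by (auto simp del: upt_Suc)
    then show ?thesis by (simp add: nth_default_nth del: upt_Suc)
  qed
  ultimately show ?thesis
    using i unfolding sorted_ages_def m by (simp only: restrict_apply if_True)
qed

lemma exists_sorting_placement:
  fixes t :: "nat list \<rightharpoonup> real"
  assumes fin: "finite (dom t)" and card: "card (dom t) = k" and inj: "inj_on (\<lambda>u. the (t u)) (dom t)"
  obtains \<phi> where "bij_betw \<phi> {1..k} (dom t)" "strict_mono_on {1..k} (\<lambda>i. the (t (\<phi> i)))"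
proof -
  let ?f = "\<lambda>u. the (t u)" and ?g = "inv_into (dom t) (\<lambda>u. the (t u))"
  let ?xs = "sorted_list_of_set (?f ` dom t)"
  have xs: "set ?xs = ?f ` dom t" "distinct ?xs" "sorted_wrt (<) ?xs" "length ?xs = k"
    using fin card inj by (simp_all add: card_image)
  have bijg: "bij_betw ?g (?f ` dom t) (dom t)" using inj by (intro bij_betw_inv_into) (simp add: bij_betw_def)
  have b1: "bij_betw (\<lambda>i. i - 1) {1..k} {..<k}"
    by (rule bij_betw_byWitness[where f' = Suc]) auto
  have b2: "bij_betw ((!) ?xs) {..<k} (?f ` dom t)"
    by (rule bij_betw_nth) (use xs in auto)
  let ?\<phi> = "?g \<circ> ((!) ?xs \<circ> (\<lambda>i. i - 1))"
  have "bij_betw ?\<phi> {1..k} (dom t)" by (intro bij_betw_trans[OF bij_betw_trans[OF b1 b2] bijg])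
  moreover have "strict_mono_on {1..k} (\<lambda>i. the (t (?\<phi> i)))"
  proof (rule strict_mono_onI)
    fix i j assume ij: "i \<in> {1..k}" "j \<in> {1..k}" "i < j"
    have "the (t (?\<phi> l)) = ?xs ! (l - 1)" if "l \<in> {1..k}" for l
    proof -
      have "?xs ! (l - 1) \<in> ?f ` dom t" using that xs nth_mem[of "l - 1" ?xs] by auto
      then show ?thesis using f_inv_into_f[of "?xs ! (l - 1)" ?f "dom t"] by simp
    qed
    moreover have "?xs ! (i - 1) < ?xs ! (j - 1)"
      using xs ij by (intro sorted_wrt_nth_less[OF xs(3)]) auto
    ultimately show "the (t (?\<phi> i)) < the (t (?\<phi> j))" using ij by simp
  qed
  ultimately show thesis by (rule that)
qed

lemma tree_edges_placement:
  assumes dom: "dom t = \<phi> ` insert r W" and root: "\<phi> r = []" and step: "\<And>j. j \<in> W \<Longrightarrow> \<exists>c. \<phi> j = \<phi> (p j) @ [c]"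
  shows "tree_edges t = (\<lambda>e. (\<lambda>i. the (t (\<phi> i))) ` e) ` parent_edges W p"
proof (intro equalityI subsetI)
  fix e assume "e \<in> tree_edges t"
  then obtain u c where e: "e = {the (t u), the (t (u @ [c]))}" "u @ [c] \<in> dom t" by (auto simp: tree_edges_def)
  then obtain i where i: "i \<in> insert r W" "u @ [c] = \<phi> i" unfolding dom by blast
  then have "i \<in> W" using root by auto
  with step[OF this] i have "u = \<phi> (p i)" by auto
  then have "e = (\<lambda>i. the (t (\<phi> i))) ` {i, p i}" using e(1) i(2) by (auto simp: insert_commute)
  then show "e \<in> (\<lambda>e. (\<lambda>i. the (t (\<phi> i))) ` e) ` parent_edges W p"
    using \<open>i \<in> W\<close> unfolding parent_edges_def by blast
next
  fix e assume "e \<in> (\<lambda>e. (\<lambda>i. the (t (\<phi> i))) ` e) ` parent_edges W p"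
  then obtain i where i: "i \<in> W" "e = {the (t (\<phi> i)), the (t (\<phi> (p i)))}" by (auto simp: parent_edges_def)
  from step[OF i(1)] obtain c where c: "\<phi> i = \<phi> (p i) @ [c]" ..
  have "\<phi> (p i) @ [c] \<in> dom t" unfolding dom using i(1) c by (metis image_eqI insertI2)
  then show "e \<in> tree_edges t" unfolding tree_edges_def using i(2) c by (auto simp: insert_commute)
qed

text \<open>
A prefix-closed set of words that is enumerated by \<open>\<phi>\<close> defines a parent map on the indices; it is acyclic because
parents are shorter words.
\<close>

lemma placement_parent_map:
  assumes bij: "bij_betw \<phi> V D" and V: "finite V" and root: "[] \<in> D"
    and par: "\<And>u c. u @ [c] \<in> D \<Longrightarrow> u \<in> D"
  shows "\<exists>r\<in>V. \<phi> r = [] \<and> (\<exists>p\<in>parent_maps (V - {r}) r. \<forall>j\<in>V - {r}. \<exists>c. \<phi> j = \<phi> (p j) @ [c])"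
proof -
  let ?\<psi> = "inv_into V \<phi>"
  have inj: "inj_on \<phi> V" and im: "\<phi> ` V = D" using bij by (auto simp: bij_betw_def)
  have \<phi>\<psi>: "\<phi> (?\<psi> u) = u" "?\<psi> u \<in> V" if "u \<in> D" for u
    using that im f_inv_into_f[of u \<phi> V] inv_into_into[of u \<phi> V] by auto
  define r where "r = ?\<psi> []"
  have r: "r \<in> V" "\<phi> r = []" using \<phi>\<psi>[OF root] by (auto simp: r_def)
  define p where "p = (\<lambda>j\<in>V - {r}. ?\<psi> (butlast (\<phi> j)))"
  have step: "\<phi> j = \<phi> (p j) @ [last (\<phi> j)] \<and> p j \<in> V" if j: "j \<in> V - {r}" for j
  proof -
    have "\<phi> j \<noteq> []" using inj r j by (metis DiffE inj_onD singletonI)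
    then have e: "\<phi> j = butlast (\<phi> j) @ [last (\<phi> j)]" by simp
    moreover have "\<phi> j \<in> D" using im j by auto
    ultimately have "butlast (\<phi> j) \<in> D" using par[of "butlast (\<phi> j)" "last (\<phi> j)"] by simp
    with \<phi>\<psi>[OF this] e j show ?thesis by (simp add: p_def)
  qed
  have "p \<in> V - {r} \<rightarrow>\<^sub>E insert r (V - {r})" using step r(1) by (auto simp: p_def)
  moreover have "\<exists>i\<in>S. p i \<notin> S" if S: "S \<subseteq> V - {r}" "S \<noteq> {}" for S
  proof -
    obtain i where i: "i \<in> S" "\<And>j. j \<in> S \<Longrightarrow> length (\<phi> i) \<le> length (\<phi> j)"
      using arg_min_natI[of "\<lambda>j. j \<in> S" _ "\<lambda>j. length (\<phi> j)"]
        arg_min_nat_le[of "\<lambda>j. j \<in> S" _ "\<lambda>j. length (\<phi> j)"] S(2) by blast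
    have "length (\<phi> i) = Suc (length (\<phi> (p i)))" using step[of i] i(1) S(1)
      by (metis length_append_singleton subsetD)
    then have "p i \<notin> S" using i(2)[of "p i"] by linarith
    then show ?thesis using i(1) by blast
  qed
  ultimately have "p \<in> parent_maps (V - {r}) r" unfolding parent_maps_def by blast
  then show ?thesis using r step by blast
qed

definition tree_density :: "nat \<Rightarrow> nat set set \<Rightarrow> (nat \<Rightarrow> real) \<Rightarrow> real" where
  "tree_density k T a = real k * ((1 / 2) ^ k * (\<Prod>i=1..k. exp (- a i)) * tree_weight a T)"

context age_galton_watson
begin

definition distinct_ages :: "nat \<Rightarrow> 'w set" where
  "distinct_ages k = {\<omega> \<in> space M. card (dom (H \<omega>)) = k \<and> inj_on (\<lambda>u. age u \<omega>) (dom (H \<omega>))}"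

definition tree_event :: "nat \<Rightarrow> nat set set \<Rightarrow> 'w set" where
  "tree_event k T = {\<omega> \<in> distinct_ages k. tree_edges (H \<omega>) = (\<lambda>e. sorted_ages k (H \<omega>) ` e) ` T}"

lemma placement_box:
  assumes ordered: "\<forall>i\<in>{1..k}. \<forall>j\<in>{1..k}. i < j \<longrightarrow> (\<forall>x\<in>I i. \<forall>y\<in>I j. x < y)"
    and dom: "dom (H \<omega>) = \<phi> ` {1..k}" and box: "\<forall>i\<in>{1..k}. age (\<phi> i) \<omega> \<in> I i"
  shows "bij_betw \<phi> {1..k} (dom (H \<omega>))" "strict_mono_on {1..k} (\<lambda>i. age (\<phi> i) \<omega>)"
    "inj_on (\<lambda>u. age u \<omega>) (dom (H \<omega>))" "card (dom (H \<omega>)) = k"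
    "\<And>i. i \<in> {1..k} \<Longrightarrow> sorted_ages k (H \<omega>) i = age (\<phi> i) \<omega>"
proof -
  show mono: "strict_mono_on {1..k} (\<lambda>i. age (\<phi> i) \<omega>)"
    by (rule strict_mono_onI) (use ordered box in blast)
  then have inj: "inj_on (\<lambda>i. age (\<phi> i) \<omega>) {1..k}" by (rule strict_mono_on_imp_inj_on)
  have inj\<phi>: "inj_on \<phi> {1..k}"
  proof (rule inj_onI)
    fix x y assume "x \<in> {1..k}" "y \<in> {1..k}" "\<phi> x = \<phi> y"
    then show "x = y" by (intro inj_onD[OF inj]) simp_all
  qed
  then show bij: "bij_betw \<phi> {1..k} (dom (H \<omega>))" by (simp add: bij_betw_def dom)
  show "inj_on (\<lambda>u. age u \<omega>) (dom (H \<omega>))"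
    unfolding dom by (rule inj_on_imageI) (use inj in \<open>simp add: o_def\<close>)
  show "card (dom (H \<omega>)) = k" using bij_betw_same_card[OF bij] by simp
  show "sorted_ages k (H \<omega>) i = age (\<phi> i) \<omega>" if "i \<in> {1..k}" for i
    by (rule sorted_ages_placement[OF bij mono that])
qed

text \<open>
Each of the \<open>k\<close> labels can be the root, and a spanning tree with a chosen root is one parent map; hence \<open>k\<close> disjoint
matching events.
\<close>

lemma tree_event_box:
  assumes ordered: "\<forall>i\<in>{1..k}. \<forall>j\<in>{1..k}. i < j \<longrightarrow> (\<forall>x\<in>I i. \<forall>y\<in>I j. x < y)"
    and k: "1 \<le> k" and T: "spanning_tree_on {1..k} T"
    and pm: "\<And>r. r \<in> {1..k} \<Longrightarrow> pm r \<in> parent_maps ({1..k} - {r}) r"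
      "\<And>r. r \<in> {1..k} \<Longrightarrow> parent_edges ({1..k} - {r}) (pm r) = T"
  shows "{\<omega> \<in> tree_event k T. \<forall>i\<in>{1..k}. sorted_ages k (H \<omega>) i \<in> I i} =
    (\<Union>r\<in>{1..k}. {\<omega> \<in> space M. \<exists>\<phi>. \<phi> r = [] \<and> (\<forall>j\<in>{1..k} - {r}. \<exists>c. \<phi> j = \<phi> (pm r j) @ [c]) \<and>
       dom (H \<omega>) = \<phi> ` {1..k} \<and> (\<forall>i\<in>{1..k}. age (\<phi> i) \<omega> \<in> I i)})" (is "?L = (\<Union>r\<in>_. ?F r)")
proof (intro equalityI subsetI)
  fix \<omega> assume "\<omega> \<in> ?L"
  then have \<omega>M: "\<omega> \<in> space M" and card: "card (dom (H \<omega>)) = k" and inj: "inj_on (\<lambda>u. age u \<omega>) (dom (H \<omega>))"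
    and edges: "tree_edges (H \<omega>) = (\<lambda>e. sorted_ages k (H \<omega>) ` e) ` T"
    and box: "\<And>i. i \<in> {1..k} \<Longrightarrow> sorted_ages k (H \<omega>) i \<in> I i"
    by (auto simp only: tree_event_def distinct_ages_def mem_Collect_eq)
  have fin: "finite (dom (H \<omega>))" using card k by (intro card_ge_0_finite) simp
  obtain \<phi> where bij: "bij_betw \<phi> {1..k} (dom (H \<omega>))" and mono: "strict_mono_on {1..k} (\<lambda>i. age (\<phi> i) \<omega>)"
    by (rule exists_sorting_placement[OF fin card inj])
  let ?a = "\<lambda>i. age (\<phi> i) \<omega>"
  have sa: "sorted_ages k (H \<omega>) i = ?a i" if "i \<in> {1..k}" for i by (rule sorted_ages_placement[OF bij mono that])
  have "\<exists>r\<in>{1..k}. \<phi> r = [] \<and> (\<exists>p\<in>parent_maps ({1..k} - {r}) r. \<forall>j\<in>{1..k} - {r}. \<exists>c. \<phi> j = \<phi> (p j) @ [c])"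
    by (rule placement_parent_map[OF bij finite_atLeastAtMost root_mem[OF \<omega>M] parent_mem[OF \<omega>M]])
  then obtain r p where r: "r \<in> {1..k}" "\<phi> r = []" and p: "p \<in> parent_maps ({1..k} - {r}) r"
    and step: "\<And>j. j \<in> {1..k} - {r} \<Longrightarrow> \<exists>c. \<phi> j = \<phi> (p j) @ [c]"
    by blast
  have ins: "insert r ({1..k} - {r}) = {1..k}" using r by auto
  have dom: "dom (H \<omega>) = \<phi> ` {1..k}" using bij by (simp add: bij_betw_def)
  have "(\<lambda>e. ?a ` e) ` parent_edges ({1..k} - {r}) p = tree_edges (H \<omega>)"
    by (rule tree_edges_placement[symmetric, OF _ r(2) step]) (simp_all only: ins dom)
  also have "\<dots> = (\<lambda>e. ?a ` e) ` T"
  proof -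
    have "e \<subseteq> {1..k}" if "e \<in> T" for e using T that unfolding spanning_tree_on_def by fastforce
    then show ?thesis unfolding edges by (intro image_cong[OF refl] sa) blast
  qed
  finally have "(\<lambda>e. ?a ` e) ` parent_edges ({1..k} - {r}) p = (\<lambda>e. ?a ` e) ` T" .
  moreover have "parent_edges ({1..k} - {r}) p \<subseteq> Pow {1..k}"
    using parent_maps_mem[OF p, unfolded ins] unfolding parent_edges_def by blast
  moreover have "T \<subseteq> Pow {1..k}" using T unfolding spanning_tree_on_def by fastforce
  moreover have "inj_on (\<lambda>e. ?a ` e) (Pow {1..k})"
    by (rule inj_on_image_Pow[OF strict_mono_on_imp_inj_on[OF mono]])
  \<comment> \<open>Distinct ages allow the tree on ranks to be recovered from the tree on ages.\<close>
  ultimately have pT: "parent_edges ({1..k} - {r}) p = T" by (simp only: inj_on_image_eq_iff)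
  have "p = pm r"
    by (rule inj_onD[OF inj_on_parent_edges[of r "{1..k} - {r}"]]) (use pT pm r p in auto)
  have "\<forall>j\<in>{1..k} - {r}. \<exists>c. \<phi> j = \<phi> (pm r j) @ [c]" using step unfolding \<open>p = pm r\<close> by blast
  moreover have "\<forall>i\<in>{1..k}. age (\<phi> i) \<omega> \<in> I i" using box sa by simp
  ultimately have "\<omega> \<in> ?F r" using \<omega>M r(2) dom by (intro CollectI conjI exI[of _ \<phi>])
  then show "\<omega> \<in> (\<Union>r\<in>{1..k}. ?F r)" using r(1) by blast
next
  fix \<omega> assume "\<omega> \<in> (\<Union>r\<in>{1..k}. ?F r)"
  then obtain r where r: "r \<in> {1..k}" and "\<omega> \<in> ?F r" by blast
  then obtain \<phi> where \<omega>M: "\<omega> \<in> space M" and root: "\<phi> r = []" and step: "\<forall>j\<in>{1..k} - {r}. \<exists>c. \<phi> j = \<phi> (pm r j) @ [c]"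
    and dom: "dom (H \<omega>) = \<phi> ` {1..k}" and box: "\<forall>i\<in>{1..k}. age (\<phi> i) \<omega> \<in> I i"
    by (auto simp only: mem_Collect_eq)
  have ins: "insert r ({1..k} - {r}) = {1..k}" using r by auto
  note pb = placement_box[OF ordered dom box]
  have step': "\<And>j. j \<in> {1..k} - {r} \<Longrightarrow> \<exists>c. \<phi> j = \<phi> (pm r j) @ [c]" using step by blast
  have dom': "dom (H \<omega>) = \<phi> ` insert r ({1..k} - {r})" by (simp only: ins dom)
  have "tree_edges (H \<omega>) = (\<lambda>e. (\<lambda>i. age (\<phi> i) \<omega>) ` e) ` T"
    using tree_edges_placement[OF dom' root step'] pm(2)[OF r] by simp
  also have "\<dots> = (\<lambda>e. sorted_ages k (H \<omega>) ` e) ` T"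
  proof -
    have "e \<subseteq> {1..k}" if "e \<in> T" for e using T that unfolding spanning_tree_on_def by fastforce
    then show ?thesis by (intro image_cong[OF refl] pb(5)[symmetric]) blast
  qed
  finally have "\<omega> \<in> tree_event k T" using \<omega>M pb(3,4) by (simp only: tree_event_def distinct_ages_def mem_Collect_eq)
  moreover have "\<forall>i\<in>{1..k}. sorted_ages k (H \<omega>) i \<in> I i" using pb(5) box by simp
  ultimately show "\<omega> \<in> ?L" by simp
qed

lemma match_integrand:
  assumes I: "\<And>i. I i \<subseteq> {0..}" and W: "insert r W = {1..k}" "r \<notin> W"
    and p: "p \<in> parent_maps W r" "parent_edges W p = T"
  shows "(\<Prod>i\<in>{1..k}. indicator (I i) (a i) * ennreal (exp (- a i) / 2)) * (\<Prod>j\<in>W. ennreal (min (a j) (a (p j)))) =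
    (\<Prod>i\<in>{1..k}. indicator (I i) (a i)) * ennreal ((1 / 2) ^ k * (\<Prod>i=1..k. exp (- a i)) * tree_weight a T)"
proof (cases "\<forall>i\<in>{1..k}. a i \<in> I i")
  case True
  then have pos: "0 \<le> a i" if "i \<in> {1..k}" for i using I[of i] that atLeast_iff by blast
  have pW: "p j \<in> {1..k}" "j \<in> {1..k}" if "j \<in> W" for j using parent_maps_mem[OF p(1) that] W that by auto
  have weight: "(\<Prod>j\<in>W. ennreal (min (a j) (a (p j)))) = ennreal (tree_weight a T)"
    unfolding p(2)[symmetric] tree_weight_parent_edges[OF p(1)]
    by (rule prod_ennreal) (use pos pW in simp)
  have exps: "(\<Prod>i\<in>{1..k}. ennreal (exp (- a i) / 2)) = ennreal ((1 / 2) ^ k * (\<Prod>i=1..k. exp (- a i)))"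
    by (subst prod_ennreal) (simp_all add: prod_dividef power_divide)
  have nonneg: "0 \<le> (1 / 2) ^ k * (\<Prod>i=1..k. exp (- a i))" by (intro mult_nonneg_nonneg prod_nonneg) auto
  show ?thesis
    unfolding prod.distrib weight exps ennreal_mult'[OF nonneg] by (simp only: mult.assoc)
next
  case False
  then obtain i where i: "i \<in> {1..k}" "a i \<notin> I i" by blast
  then have "(\<Prod>i\<in>{1..k}. indicator (I i) (a i) :: ennreal) = 0"
    by (intro prod_zero bexI[of _ i]) simp_all
  then show ?thesis unfolding prod.distrib by (simp only: mult_zero_left)
qed

lemma ordered_box_law:
  assumes ordered: "\<forall>i\<in>{1..k}. \<forall>j\<in>{1..k}. i < j \<longrightarrow> (\<forall>x\<in>I i. \<forall>y\<in>I j. x < y)"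
    and I: "\<And>i. I i \<in> sets age_law"
    and k: "1 \<le> k" and T: "spanning_tree_on {1..k} T"
  shows "emeasure M {\<omega> \<in> tree_event k T. \<forall>i\<in>{1..k}. sorted_ages k (H \<omega>) i \<in> I i} =
    (\<integral>\<^sup>+a. (\<Prod>i\<in>{1..k}. indicator (I i) (a i)) * ennreal (tree_density k T a) \<partial>PiM {1..k} (\<lambda>_. lborel))"
proof -
  have ins: "insert r ({1..k} - {r}) = {1..k}" if "r \<in> {1..k}" for r using that by auto
  have "\<exists>p\<in>parent_maps ({1..k} - {r}) r. parent_edges ({1..k} - {r}) p = T" if r: "r \<in> {1..k}" for r
    by (rule spanning_tree_has_parent_map) (simp_all only: ins[OF r] T, simp)
  then obtain pm where pm: "\<And>r. r \<in> {1..k} \<Longrightarrow> pm r \<in> parent_maps ({1..k} - {r}) r"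
      "\<And>r. r \<in> {1..k} \<Longrightarrow> parent_edges ({1..k} - {r}) (pm r) = T"
    by metis
  have disj: "I i \<inter> I j = {}" if ij: "i \<in> {1..k}" "j \<in> {1..k}" "i \<noteq> j" for i j
  proof -
    have "x \<noteq> y" if "x \<in> I i" "y \<in> I j" for x y
      using ordered that ij by (metis less_irrefl nat_neq_iff)
    then show ?thesis by blast
  qed
  let ?F = "\<lambda>r. {\<omega> \<in> space M. \<exists>\<phi>. \<phi> r = [] \<and> (\<forall>j\<in>{1..k} - {r}. \<exists>c. \<phi> j = \<phi> (pm r j) @ [c]) \<and>
       dom (H \<omega>) = \<phi> ` {1..k} \<and> (\<forall>i\<in>{1..k}. age (\<phi> i) \<omega> \<in> I i)}"
  let ?g = "\<lambda>a. (\<Prod>i\<in>{1..k}. indicator (I i) (a i)) * ennreal ((1 / 2) ^ k * (\<Prod>i=1..k. exp (- a i)) * tree_weight a T)"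
  let ?R = "PiM {1..k} (\<lambda>_. lborel :: real measure)"
  have sub: "I i \<subseteq> {0..}" for i using I[of i] by (simp add: sets_age_law)
  have F: "?F r \<in> sets M" "emeasure M (?F r) = (\<integral>\<^sup>+a. ?g a \<partial>?R)" if r: "r \<in> {1..k}" for r
  proof -
    have "tree_match M H ({1..k} - {r}) r (pm r) I"
    proof (intro tree_match.intro tree_match_axioms.intro age_galton_watson_axioms pm(1)[OF r] I)
      show "disjoint_family_on I (insert r ({1..k} - {r}))"
        unfolding ins[OF r] disjoint_family_on_def using disj by blast
    qed (use r in auto)
    then interpret tm: tree_match M H "{1..k} - {r}" r "pm r" I .
    have eq: "?F r = tm.full_match" unfolding tm.full_match_def ins[OF r] ..
    show "?F r \<in> sets M" unfolding eq by (rule tm.sets_full_match)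
    show "emeasure M (?F r) = (\<integral>\<^sup>+a. ?g a \<partial>?R)"
      unfolding eq tm.emeasure_full_match ins[OF r]
      by (intro nn_integral_cong match_integrand[OF sub ins[OF r] _ pm(1)[OF r] pm(2)[OF r]]) simp
  qed
  have disjF: "disjoint_family_on ?F {1..k}"
    unfolding disjoint_family_on_def
  proof (intro ballI impI equals0I)
    fix r s \<omega> assume rs: "r \<in> {1..k}" "s \<in> {1..k}" "r \<noteq> s" and "\<omega> \<in> ?F r \<inter> ?F s"
    then have "age [] \<omega> \<in> I r" "age [] \<omega> \<in> I s" using rs(1,2) by (auto simp only: Int_iff mem_Collect_eq)
    with disj[OF rs] show False by blast
  qed
  have "{\<omega> \<in> tree_event k T. \<forall>i\<in>{1..k}. sorted_ages k (H \<omega>) i \<in> I i} = (\<Union>r\<in>{1..k}. ?F r)"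
    by (rule tree_event_box[OF ordered k T pm])
  then have "emeasure M {\<omega> \<in> tree_event k T. \<forall>i\<in>{1..k}. sorted_ages k (H \<omega>) i \<in> I i} = (\<Sum>r\<in>{1..k}. emeasure M (?F r))"
    using F(1) disjF by (simp only:) (rule sum_emeasure[symmetric]; auto)
  also have "\<dots> = of_nat k * (\<integral>\<^sup>+a. ?g a \<partial>?R)" using F(2) by simp
  also have "\<dots> = (\<integral>\<^sup>+a. of_nat k * ?g a \<partial>?R)"
  proof (rule nn_integral_cmult[symmetric])
    have mc: "(\<lambda>a. a i) \<in> borel_measurable ?R" if "i \<in> {1..k}" for i
      using measurable_component_singleton[OF that, of "\<lambda>_. lborel :: real measure"] by simp
    have mI: "I i \<in> sets borel" for i using I[of i] by (simp add: sets_age_law)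
    have r1: "1 \<in> {1..k}" using k by simp
    have "(\<lambda>a. \<Prod>j\<in>{1..k} - {1}. min (a j) (a (pm 1 j))) \<in> borel_measurable ?R"
    proof (intro borel_measurable_prod borel_measurable_min mc)
      fix j assume j: "j \<in> {1..k} - {1}"
      then show "j \<in> {1..k}" by simp
      show "pm 1 j \<in> {1..k}" using parent_maps_mem[OF pm(1)[OF r1] j] unfolding ins[OF r1] .
    qed
    then have mw: "(\<lambda>a. tree_weight a T) \<in> borel_measurable ?R"
      using tree_weight_parent_edges[OF pm(1)[OF r1]] pm(2)[OF r1] by simp
    have me: "(\<lambda>a. \<Prod>i=1..k. exp (- a i)) \<in> borel_measurable ?R"
      by (intro borel_measurable_prod measurable_compose[OF mc]) auto
    have mi: "(\<lambda>a. \<Prod>i\<in>{1..k}. indicator (I i) (a i) :: ennreal) \<in> borel_measurable ?R"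
      by (intro borel_measurable_prod_ennreal measurable_compose[OF mc] borel_measurable_indicator mI)
    show "?g \<in> borel_measurable ?R" using mw me mi by measurable
  qed
  also have "\<dots> = (\<integral>\<^sup>+a. (\<Prod>i\<in>{1..k}. indicator (I i) (a i)) * ennreal (tree_density k T a) \<partial>?R)"
  proof (rule nn_integral_cong)
    fix a
    show "of_nat k * ?g a = (\<Prod>i\<in>{1..k}. indicator (I i) (a i)) * ennreal (tree_density k T a)"
      unfolding tree_density_def by (simp add: ennreal_mult' ennreal_of_nat_eq_real_of_nat mult_ac)
  qed
  finally show ?thesis .
qed

end

section \<open>Ages are almost surely distinct\<close>

context age_galton_watson
begin

text \<open>
Bounds the probability of an event \<open>D\<close> that excludes each of finitely many offspring counts \<open>c x\<close> when these counts
together have conditional probability at least \<open>l\<close>.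
\<close>

lemma offspring_exclusion:
  fixes c :: "'i \<Rightarrow> nat list \<Rightarrow> nat"
  assumes U: "finite U" "\<And>u. u \<in> U \<Longrightarrow> length u = n" and C: "C \<in> sets age_law"
    and A: "A \<in> sets (G n)" "\<And>\<omega>. \<omega> \<in> A \<Longrightarrow> U \<subseteq> dom (H \<omega>)"
    and X: "finite X" "\<And>x y. x \<in> X \<Longrightarrow> y \<in> X \<Longrightarrow> x \<noteq> y \<Longrightarrow> \<exists>u\<in>U. c x u \<noteq> c y u"
    and D: "D \<in> sets M" "D \<subseteq> A"
      "\<And>\<omega> x. \<omega> \<in> D \<Longrightarrow> x \<in> X \<Longrightarrow> \<exists>u\<in>U. children_count (H \<omega>) u C \<noteq> c x u"
    and l: "0 \<le> l" "\<And>\<omega>. \<omega> \<in> A \<Longrightarrow> l \<le> (\<Sum>x\<in>X. \<Prod>u\<in>U. poisson_prob (measure (age_intensity (age u \<omega>)) C) (c x u))"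
  shows "prob D \<le> (1 - l) * prob A"
proof -
  let ?E = "\<lambda>x. {\<omega> \<in> space M. \<forall>u\<in>U. \<forall>j\<in>{0::nat}. children_count (H \<omega>) u C = c x u}"
  let ?q = "\<lambda>x \<omega>. \<Prod>u\<in>U. \<Prod>j\<in>{0::nat}. poisson_prob (measure (age_intensity (age u \<omega>)) C) (c x u)"
  have AM: "A \<in> sets M" using A(1) sets_G_subset by (rule rev_subsetD)
  have EM: "?E x \<in> sets M" for x
  proof -
    have "Measurable.pred M (\<lambda>\<omega>. \<forall>u\<in>U. \<forall>j\<in>{0::nat}. children_count (H \<omega>) u C = c x u)"
      using C by (intro pred_intros_finite(3) U measurable_children_count) (simp_all add: sets_age_law)
    then show ?thesis by (simp only: pred_def)
  qed
  have qm: "(\<lambda>\<omega>. ennreal (?q x \<omega>) * indicator A \<omega>) \<in> borel_measurable M" for x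
  proof -
    have "(\<lambda>\<omega>. poisson_prob (measure (age_intensity (age u \<omega>)) C) j) \<in> borel_measurable M" for u j
      unfolding poisson_prob_def using measurable_compose[OF measurable_age measurable_age_intensity[OF C], of u]
      by measurable
    then have "?q x \<in> borel_measurable M" by (intro borel_measurable_prod)
    then show ?thesis using AM by measurable
  qed
  have EA: "emeasure M (A \<inter> ?E x) = (\<integral>\<^sup>+\<omega>. ennreal (?q x \<omega>) * indicator A \<omega> \<partial>M)" for x
    by (rule offspring_probability) (use U C A in \<open>auto simp: disjoint_family_on_def\<close>)
  have "ennreal (l * prob A) = (\<integral>\<^sup>+\<omega>. ennreal l * indicator A \<omega> \<partial>M)"
    using AM l(1) by (simp add: nn_integral_cmult_indicator emeasure_eq_measure ennreal_mult)
  also have "\<dots> \<le> (\<integral>\<^sup>+\<omega>. (\<Sum>x\<in>X. ennreal (?q x \<omega>) * indicator A \<omega>) \<partial>M)"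
  proof (rule nn_integral_mono)
    fix \<omega>
    have q0: "0 \<le> ?q x \<omega>" for x by (intro prod_nonneg ballI) (simp add: poisson_prob_def)
    show "ennreal l * indicator A \<omega> \<le> (\<Sum>x\<in>X. ennreal (?q x \<omega>) * indicator A \<omega>)"
    proof (cases "\<omega> \<in> A")
      case True
      then have "ennreal l \<le> ennreal (\<Sum>x\<in>X. ?q x \<omega>)" using l(2)[OF True] by (intro ennreal_leI) simp
      also have "\<dots> = (\<Sum>x\<in>X. ennreal (?q x \<omega>))" by (rule sum_ennreal[symmetric, OF q0])
      finally show ?thesis using True by (simp only: indicator_simps mult_1_right)
    qed simp
  qed
  also have "\<dots> = (\<Sum>x\<in>X. \<integral>\<^sup>+\<omega>. ennreal (?q x \<omega>) * indicator A \<omega> \<partial>M)"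
    by (rule nn_integral_sum[OF qm])
  also have "\<dots> = (\<Sum>x\<in>X. emeasure M (A \<inter> ?E x))" by (simp only: EA)
  also have "\<dots> = emeasure M (\<Union>x\<in>X. A \<inter> ?E x)"
  proof (rule sum_emeasure)
    show "(\<lambda>x. A \<inter> ?E x) ` X \<subseteq> sets M" using AM EM by blast
    show "disjoint_family_on (\<lambda>x. A \<inter> ?E x) X"
      unfolding disjoint_family_on_def
    proof (intro ballI impI equals0I)
      fix x y \<omega> assume xy: "x \<in> X" "y \<in> X" "x \<noteq> y" and "\<omega> \<in> (A \<inter> ?E x) \<inter> (A \<inter> ?E y)"
      then have "c x u = c y u" if "u \<in> U" for u using that by fastforce
      with X(2)[OF xy] show False by blast
    qed
  qed (rule X(1))
  finally have "l * prob A \<le> prob (\<Union>x\<in>X. A \<inter> ?E x)"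
    unfolding emeasure_eq_measure by (simp add: ennreal_le_iff measure_nonneg)
  moreover have un: "(\<Union>x\<in>X. A \<inter> ?E x) \<in> sets M" using AM EM X(1) by (intro sets.finite_UN sets.Int)
  have "D \<inter> (\<Union>x\<in>X. A \<inter> ?E x) = {}" using D(3) by fastforce
  then have "prob D + prob (\<Union>x\<in>X. A \<inter> ?E x) = prob (D \<union> (\<Union>x\<in>X. A \<inter> ?E x))"
    by (intro finite_measure_Union[symmetric] D(1) un)
  moreover have "prob (D \<union> (\<Union>x\<in>X. A \<inter> ?E x)) \<le> prob A"
    using D(2) AM by (intro finite_measure_mono) blast+
  ultimately show ?thesis by (simp add: algebra_simps)
qed

text \<open>
A given earlier vertex in the cell \<open>C\<close> costs nothing, and a child of \<open>v\<close> in \<open>C\<close> has conditional probability at most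
\<open>1 - exp (- \<delta>) \<le> \<delta>\<close>.
\<close>

lemma same_cell_ancestor:
  assumes C: "C \<in> sets age_law" "\<And>s. measure (age_intensity s) C \<le> \<delta>" and \<delta>: "\<delta> \<le> 1"
    and len: "length u \<le> length v"
  shows "prob {\<omega> \<in> space M. (u \<in> dom (H \<omega>) \<and> age u \<omega> \<in> C) \<and> v @ [i] \<in> dom (H \<omega>) \<and> age (v @ [i]) \<omega> \<in> C} \<le>
    \<delta> * prob {\<omega> \<in> space M. u \<in> dom (H \<omega>) \<and> age u \<omega> \<in> C}" (is "prob ?D \<le> _ * prob ?A'")
proof -
  have Cb [measurable]: "C \<in> sets borel" using C(1) by (simp add: sets_age_law)
  let ?A = "?A' \<inter> {\<omega> \<in> space M. v \<in> dom (H \<omega>)}"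
  have \<delta>0: "0 \<le> \<delta>" using C(2)[of 0] measure_nonneg[of "age_intensity 0" C] by linarith
  have "prob ?D \<le> (1 - (1 - \<delta>)) * prob ?A"
  proof (rule offspring_exclusion[where U = "{v}" and n = "length v" and X = "{()}" and c = "\<lambda>_ _. 0" and C = C])
    show "?A \<in> sets (G (length v))"
      by (intro sets.Int sets_G_vertex_age sets_G_vertex len Cb order_refl)
    show "?D \<in> sets M" by measurable
    show "?D \<subseteq> ?A" using parent_mem by blast
    show "\<exists>u\<in>{v}. children_count (H \<omega>) u C \<noteq> 0" if "\<omega> \<in> ?D" for \<omega>
    proof -
      have "children_count (H \<omega>) v C \<noteq> 0"
      proof
        assume z: "children_count (H \<omega>) v C = 0"
        have "finite {j. \<exists>x\<in>C. H \<omega> (v @ [j]) = Some x}"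
          by (rule finite_subset[OF _ finite_children[of \<omega> v]]) (use that in auto)
        with z have "{j. \<exists>x\<in>C. H \<omega> (v @ [j]) = Some x} = {}" by (simp add: children_count_def)
        with that show False by auto
      qed
      then show ?thesis by simp
    qed
    fix \<omega> show "1 - \<delta> \<le> (\<Sum>x\<in>{()}. \<Prod>u\<in>{v}. poisson_prob (measure (age_intensity (age u \<omega>)) C) 0)"
      using C(2)[of "age v \<omega>"] exp_ge_add_one_self[of "- measure (age_intensity (age v \<omega>)) C"]
      by (simp add: poisson_prob_def)
  qed (use C(1) \<delta> in auto)
  also have "\<dots> \<le> \<delta> * prob ?A'"
    using \<delta>0 by (auto intro!: mult_left_mono finite_measure_mono)
  finally show ?thesis .
qed

text \<open>
Two children in \<open>C\<close> of the at most two vertices \<open>u\<close> and \<open>v\<close>: the total count is Poisson with mean \<open>s \<le> 2 \<delta>\<close> and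
exceeds \<open>1\<close> with probability \<open>1 - exp (- s) (1 + s) \<le> s\<^sup>2\<close>.  Counts of total at most \<open>1\<close> are indexed by
\<open>None\<close> and by \<open>Some w\<close> for the vertex \<open>w\<close> with one child.
\<close>

lemma same_cell_generation:
  assumes C: "C \<in> sets age_law" "\<And>s. measure (age_intensity s) C \<le> \<delta>" and \<delta>: "2 * \<delta> \<le> 1"
    and len: "length u = length v" and ne: "u @ [i] \<noteq> v @ [j]"
  shows "prob {\<omega> \<in> space M. (u @ [i] \<in> dom (H \<omega>) \<and> age (u @ [i]) \<omega> \<in> C) \<and> v @ [j] \<in> dom (H \<omega>) \<and> age (v @ [j]) \<omega> \<in> C} \<le> (2 * \<delta>)\<^sup>2"
    (is "prob ?D \<le> _")
proof -
  have Cb [measurable]: "C \<in> sets borel" using C(1) by (simp add: sets_age_law)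
  let ?U = "{u, v}"
  let ?A = "{\<omega> \<in> space M. u \<in> dom (H \<omega>)} \<inter> {\<omega> \<in> space M. v \<in> dom (H \<omega>)}"
  let ?c = "\<lambda>x w. if x = Some w then 1 else (0::nat)"
  let ?X = "insert None (Some ` ?U)"
  have \<delta>0: "0 \<le> \<delta>" using C(2)[of 0] measure_nonneg[of "age_intensity 0" C] by linarith
  have "prob ?D \<le> (1 - (1 - (2 * \<delta>)\<^sup>2)) * prob ?A"
  proof (rule offspring_exclusion[where U = ?U and n = "length v" and X = ?X and c = ?c and C = C])
    show "?A \<in> sets (G (length v))"
      by (intro sets.Int sets_G_vertex) (simp_all add: len)
    show "?D \<in> sets M" by measurable
    show "?D \<subseteq> ?A" using parent_mem by blast
    show "\<exists>w\<in>?U. ?c x w \<noteq> ?c y w" if "x \<in> ?X" "y \<in> ?X" "x \<noteq> y" for x y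
      using that by auto
    show "\<exists>w\<in>?U. children_count (H \<omega>) w C \<noteq> ?c x w" if \<omega>: "\<omega> \<in> ?D" and x: "x \<in> ?X" for \<omega> x
    proof (rule ccontr)
      assume "\<not> ?thesis"
      then have cnt: "children_count (H \<omega>) w C = ?c x w" if "w \<in> ?U" for w using that by blast
      let ?N = "\<lambda>w. {l. \<exists>y\<in>C. H \<omega> (w @ [l]) = Some y}"
      have fin: "finite (?N w)" for w
        by (rule finite_subset[OF _ finite_children[of \<omega> w]]) (use \<omega> in auto)
      have mem: "i \<in> ?N u" "j \<in> ?N v" using \<omega> by auto
      then have pos: "children_count (H \<omega>) u C \<noteq> 0" "children_count (H \<omega>) v C \<noteq> 0"
        using fin by (auto simp: children_count_def)
      have "x = Some u" using cnt[of u] pos(1) by (auto split: if_splits)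
      moreover have "x = Some v" using cnt[of v] pos(2) by (auto split: if_splits)
      ultimately have uv: "u = v" and "children_count (H \<omega>) u C = 1" using cnt[of u] by auto
      then obtain l where "?N u = {l}" by (auto simp: children_count_def card_1_singleton_iff)
      then have "i = j" using mem uv by auto
      with uv ne show False by simp
    qed
    have "(2 * \<delta>)\<^sup>2 \<le> 1" using \<delta> \<delta>0 by (intro power_le_one) auto
    then show "0 \<le> 1 - (2 * \<delta>)\<^sup>2" by simp
    fix \<omega>
    define m where "m w = measure (age_intensity (age w \<omega>)) C" for w
    define s where "s = (\<Sum>w\<in>?U. m w)"
    have m: "0 \<le> m w" "m w \<le> \<delta>" for w using C(2) by (auto simp: m_def)
    have "s \<le> (\<Sum>w\<in>?U. \<delta>)" unfolding s_def by (intro sum_mono m)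
    also have "\<dots> = real (card ?U) * \<delta>" by simp
    also have "\<dots> \<le> 2 * \<delta>" by (intro mult_right_mono \<delta>0) (auto simp: card_insert_if)
    finally have s: "s \<le> 2 * \<delta>" .
    have s0: "0 \<le> s" unfolding s_def by (intro sum_nonneg m)
    have void: "(\<Prod>w\<in>?U. exp (- m w)) = exp (- s)" by (simp add: s_def exp_sum sum_negf[symmetric])
    have None: "(\<Prod>w\<in>?U. poisson_prob (m w) (?c None w)) = exp (- s)"
      by (simp add: poisson_prob_def void)
    have Some: "(\<Prod>w\<in>?U. poisson_prob (m w) (?c (Some y) w)) = m y * exp (- s)" if y: "y \<in> ?U" for y
    proof -
      have "(\<Prod>w\<in>?U. poisson_prob (m w) (?c (Some y) w)) = (\<Prod>w\<in>?U. (if w = y then m y else 1) * exp (- m w))"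
        by (intro prod.cong refl) (auto simp: poisson_prob_def)
      also have "\<dots> = m y * exp (- s)" using y unfolding prod.distrib void by (subst prod.delta) auto
      finally show ?thesis .
    qed
    have "(\<Sum>x\<in>?X. \<Prod>w\<in>?U. poisson_prob (m w) (?c x w)) =
       (\<Prod>w\<in>?U. poisson_prob (m w) (?c None w)) + (\<Sum>x\<in>Some ` ?U. \<Prod>w\<in>?U. poisson_prob (m w) (?c x w))"
      by (rule sum.insert) auto
    also have "(\<Sum>x\<in>Some ` ?U. \<Prod>w\<in>?U. poisson_prob (m w) (?c x w)) = (\<Sum>y\<in>?U. m y * exp (- s))"
    proof (subst sum.reindex)
      show "sum ((\<lambda>x. \<Prod>w\<in>?U. poisson_prob (m w) (?c x w)) \<circ> Some) ?U = (\<Sum>y\<in>?U. m y * exp (- s))"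
        unfolding o_def by (intro sum.cong refl Some)
    qed (rule inj_on_subset[OF inj_Some subset_UNIV])
    also have "(\<Sum>y\<in>?U. m y * exp (- s)) = s * exp (- s)" by (simp only: s_def sum_distrib_right)
    also have "(\<Prod>w\<in>?U. poisson_prob (m w) (?c None w)) + s * exp (- s) = exp (- s) * (1 + s)"
      unfolding None by (simp add: algebra_simps)
    finally have sum: "(\<Sum>x\<in>?X. \<Prod>w\<in>?U. poisson_prob (m w) (?c x w)) = exp (- s) * (1 + s)" .
    have "s\<^sup>2 \<le> (2 * \<delta>)\<^sup>2" by (rule power_mono[OF s s0])
    then have "1 - (2 * \<delta>)\<^sup>2 \<le> 1 - s\<^sup>2" by linarith
    also have "\<dots> = (1 - s) * (1 + s)" by (simp add: power2_eq_square algebra_simps)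
    also have "\<dots> \<le> exp (- s) * (1 + s)"
      using s0 exp_ge_add_one_self[of "- s"] by (intro mult_right_mono) auto
    finally show "1 - (2 * \<delta>)\<^sup>2 \<le> (\<Sum>x\<in>?X. \<Prod>w\<in>?U. poisson_prob (measure (age_intensity (age w \<omega>)) C) (?c x w))"
      unfolding m_def[symmetric] sum .
  qed (use C(1) len in auto)
  also have "\<dots> \<le> (2 * \<delta>)\<^sup>2 * 1" by (simp add: mult_left_le)
  finally show ?thesis by simp
qed

definition cell :: "nat \<Rightarrow> nat \<Rightarrow> real set" where
  "cell m j = {real j / real m ..< real (Suc j) / real m}"

lemma cell_sets: "cell m j \<in> sets age_law"
  by (auto simp: cell_def sets_age_law intro: order_trans[rotated])

lemma cell_cover:
  assumes "0 \<le> x" "x < real K" "0 < m"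
  obtains j where "j < K * m" "x \<in> cell m j"
proof -
  define j where "j = nat \<lfloor>x * real m\<rfloor>"
  have xm: "0 \<le> x * real m" using assms by simp
  have j: "real j \<le> x * real m" "x * real m < real j + 1"
    using xm by (simp_all add: j_def)
  have "x * real m < real (K * m)" using assms by simp
  with j have "j < K * m" by linarith
  moreover have "x \<in> cell m j" using j assms(3) by (auto simp: cell_def field_simps)
  ultimately show thesis by (rule that)
qed

lemma disjoint_cells: "0 < m \<Longrightarrow> disjoint_family_on (cell m) J"
proof -
  assume m: "0 < m"
  have "i = j" if "x \<in> cell m i" "x \<in> cell m j" for i j x
  proof -
    have "real i \<le> x * m" "x * m < real i + 1" "real j \<le> x * m" "x * m < real j + 1"
      using that m by (auto simp: cell_def field_simps)
    then show ?thesis by linarith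
  qed
  then show ?thesis unfolding disjoint_family_on_def by blast
qed

lemma cell_intensity:
  assumes "j < K * m" "0 < m"
  shows "measure (age_intensity s) (cell m j) \<le> real K / real m"
proof -
  have "real (Suc j) \<le> real (K * m)" using assms(1) by (intro of_nat_mono) simp
  then have "real (Suc j) / real m \<le> real K" using assms(2) by (simp add: divide_le_eq)
  then have "cell m j \<subseteq> {0..real K}" using cell_sets[of m j] by (auto simp: cell_def sets_age_law)
  moreover have "emeasure lborel (cell m j) = ennreal (1 / real m)"
    unfolding cell_def using assms(2)
    by (subst emeasure_lborel_Ico) (simp_all add: divide_right_mono diff_divide_distrib[symmetric])
  ultimately have "measure (age_intensity s) (cell m j) \<le> real K * (1 / real m)"
    using cell_sets[of m j] by (intro measure_age_intensity_le) (simp_all add: sets_age_law)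
  then show ?thesis by simp
qed

text \<open>
Cells of length \<open>1 / m\<close> in \<open>[0, K)\<close> have intensity at most \<open>K / m\<close>.  For vertices of different generations the
bounds for the \<open>K m\<close> cells add up to at most \<open>K / m\<close>, since the first vertex lies in only one cell; for vertices of the
same generation they add up to \<open>K m (2 K / m)\<^sup>2\<close>.
\<close>

lemma prob_collision_eq_0:
  assumes uv: "u \<noteq> v" "length u \<le> length v"
  shows "prob {\<omega> \<in> space M. u \<in> dom (H \<omega>) \<and> v \<in> dom (H \<omega>) \<and> age u \<omega> = age v \<omega> \<and> age u \<omega> < real K} = 0"
    (is "prob ?D = 0")
proof -
  have "v \<noteq> []" using uv by auto
  then obtain v' i where v: "v = v' @ [i]" by (cases v rule: rev_exhaust) auto
  let ?E = "\<lambda>m j. {\<omega> \<in> space M. (u \<in> dom (H \<omega>) \<and> age u \<omega> \<in> cell m j) \<and> v \<in> dom (H \<omega>) \<and> age v \<omega> \<in> cell m j}"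
  have cb [measurable]: "cell m j \<in> sets borel" for m j using cell_sets[of m j] by (simp add: sets_age_law)
  have le: "prob ?D \<le> (\<Sum>j<K * m. prob (?E m j))" if m: "0 < m" for m
  proof -
    have "?D \<subseteq> (\<Union>j<K * m. ?E m j)"
    proof
      fix \<omega> assume \<omega>: "\<omega> \<in> ?D"
      then have "0 \<le> age u \<omega>" "age u \<omega> < real K" using age_nonneg[of \<omega> u] by auto
      then obtain j where "j < K * m" "age u \<omega> \<in> cell m j" by (rule cell_cover[OF _ _ m])
      with \<omega> show "\<omega> \<in> (\<Union>j<K * m. ?E m j)" by auto
    qed
    then have "prob ?D \<le> prob (\<Union>j<K * m. ?E m j)" by (intro finite_measure_mono) measurable
    also have "\<dots> \<le> (\<Sum>j<K * m. prob (?E m j))"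
      by (rule finite_measure_subadditive_finite) (auto intro!: sets.sets_into_space)
    finally show ?thesis .
  qed
  have "\<exists>c. \<forall>m>2 * K. prob ?D \<le> c / real m"
  proof (cases "length u \<le> length v'")
    case True
    have "prob ?D \<le> real K / real m" if m: "m > 2 * K" for m
    proof -
      have m0: "0 < m" using m by simp
      have "prob ?D \<le> (\<Sum>j<K * m. prob (?E m j))" by (rule le[OF m0])
      also have "\<dots> \<le> (\<Sum>j<K * m. real K / real m * prob {\<omega> \<in> space M. u \<in> dom (H \<omega>) \<and> age u \<omega> \<in> cell m j})"
      proof (rule sum_mono)
        fix j assume "j \<in> {..<K * m}"
        then show "prob (?E m j) \<le> real K / real m * prob {\<omega> \<in> space M. u \<in> dom (H \<omega>) \<and> age u \<omega> \<in> cell m j}"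
          unfolding v using m m0 True by (intro same_cell_ancestor cell_sets cell_intensity) auto
      qed
      also have "\<dots> = real K / real m * prob (\<Union>j<K * m. {\<omega> \<in> space M. u \<in> dom (H \<omega>) \<and> age u \<omega> \<in> cell m j})"
      proof (subst finite_measure_finite_Union)
        show "disjoint_family_on (\<lambda>j. {\<omega> \<in> space M. u \<in> dom (H \<omega>) \<and> age u \<omega> \<in> cell m j}) {..<K * m}"
          using disjoint_cells[OF m0, of "{..<K * m}"] unfolding disjoint_family_on_def by blast
      qed (auto simp: sum_distrib_left)
      also have "\<dots> \<le> real K / real m * 1" by (intro mult_left_mono prob_le_1) simp
      finally show ?thesis by simp
    qed
    then show ?thesis by blast
  next
    case False
    then have lu: "length u = Suc (length v')" using uv(2) v by simp
    then obtain u' i' where u: "u = u' @ [i']" by (cases u rule: rev_exhaust) auto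
    have "prob ?D \<le> 4 * real K ^ 3 / real m" if m: "m > 2 * K" for m
    proof -
      have m0: "0 < m" using m by simp
      have "prob ?D \<le> (\<Sum>j<K * m. prob (?E m j))" by (rule le[OF m0])
      also have "\<dots> \<le> (\<Sum>j<K * m. (2 * (real K / real m))\<^sup>2)"
      proof (rule sum_mono)
        fix j assume "j \<in> {..<K * m}"
        then show "prob (?E m j) \<le> (2 * (real K / real m))\<^sup>2"
          unfolding v u using m m0 lu uv(1) u v by (intro same_cell_generation cell_sets cell_intensity) (auto simp: field_simps)
      qed
      also have "\<dots> = 4 * real K ^ 3 / real m"
        using m0 by (simp add: power2_eq_square power3_eq_cube)
      finally show ?thesis .
    qed
    then show ?thesis by blast
  qed
  then obtain c where c: "\<And>m. m > 2 * K \<Longrightarrow> prob ?D \<le> c / real m" by blast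
  have "(\<lambda>m. c / real m) \<longlonglongrightarrow> 0" by (rule lim_const_over_n)
  moreover have "eventually (\<lambda>m. prob ?D \<le> c / real m) sequentially"
    using c by (intro eventually_sequentiallyI[of "Suc (2 * K)"]) auto
  ultimately have "prob ?D \<le> 0" by (rule tendsto_lowerbound) simp
  then show ?thesis using measure_nonneg[of M ?D] by linarith
qed

lemma AE_distinct: "AE \<omega> in M. inj_on (\<lambda>u. age u \<omega>) (dom (H \<omega>))"
proof -
  have short: "AE \<omega> in M. \<not> (u \<in> dom (H \<omega>) \<and> v \<in> dom (H \<omega>) \<and> age u \<omega> = age v \<omega> \<and> age u \<omega> < real K)"
    if "u \<noteq> v" "length u \<le> length v" for u v K
  proof -
    have "emeasure M {\<omega> \<in> space M. \<not> \<not> (u \<in> dom (H \<omega>) \<and> v \<in> dom (H \<omega>) \<and> age u \<omega> = age v \<omega> \<and> age u \<omega> < real K)} = 0"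
      by (simp only: not_not emeasure_eq_measure prob_collision_eq_0[OF that] ennreal_0)
    then show ?thesis by (subst AE_iff_measurable[OF _ refl]) (simp_all, measurable)
  qed
  have "AE \<omega> in M. u \<noteq> v \<longrightarrow> \<not> (u \<in> dom (H \<omega>) \<and> v \<in> dom (H \<omega>) \<and> age u \<omega> = age v \<omega> \<and> age u \<omega> < real K)" for u v K
  proof (cases "u = v")
    case False
    then consider "length u \<le> length v" | "length v \<le> length u" by linarith
    then show ?thesis
    proof cases
      case 1
      show ?thesis using short[OF False 1, of K] by eventually_elim blast
    next
      case 2
      show ?thesis using short[OF False[symmetric] 2, of K] by eventually_elim auto
    qed
  qed simp
  then have "AE \<omega> in M. \<forall>u v K. u \<noteq> v \<longrightarrow> \<not> (u \<in> dom (H \<omega>) \<and> v \<in> dom (H \<omega>) \<and> age u \<omega> = age v \<omega> \<and> age u \<omega> < real K)"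
    by (simp only: AE_all_countable simp_thms)
  then show ?thesis
  proof eventually_elim
    case (elim \<omega>)
    show ?case
    proof (rule inj_onI, rule ccontr)
      fix u v assume uv: "u \<in> dom (H \<omega>)" "v \<in> dom (H \<omega>)" "age u \<omega> = age v \<omega>" "u \<noteq> v"
      obtain K :: nat where "age u \<omega> < real K" using reals_Archimedean2 by blast
      with elim uv show False by blast
    qed
  qed
qed

end

section \<open>Measurability of the sorted ages\<close>

lemma measure_eqI_countable_cover:
  fixes Q :: "'i::countable \<Rightarrow> 'a set"
  assumes sets: "sets N = sets M" and Q: "\<And>i. Q i \<in> sets M"
    and eq: "\<And>i A. A \<in> sets M \<Longrightarrow> A \<subseteq> Q i \<Longrightarrow> emeasure M A = emeasure N A"
    and null: "emeasure M (space M - (\<Union>i. Q i)) = 0" "emeasure N (space M - (\<Union>i. Q i)) = 0"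
  shows "M = N"
proof (rule measure_eqI[OF sets[symmetric]])
  fix A assume A: "A \<in> sets M"
  let ?Q = "\<lambda>n. Q (from_nat n :: 'i)"
  have Un: "(\<Union>i. Q i) = (\<Union>n. ?Q n)"
  proof (intro equalityI subsetI)
    fix x assume "x \<in> (\<Union>i. Q i)"
    then obtain i where "x \<in> Q i" by blast
    then have "x \<in> ?Q (to_nat i)" by simp
    then show "x \<in> (\<Union>n. ?Q n)" by blast
  qed blast
  have QU: "(\<Union>i. Q i) \<in> sets M" unfolding Un using Q by (intro sets.countable_UN) auto
  have dis: "disjointed ?Q n \<in> sets M" for n
    using Q by (intro sets.range_disjointed_sets[THEN subsetD, of ?Q]) auto
  have split: "emeasure K A = (\<Sum>n. emeasure K (A \<inter> disjointed ?Q n))"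
    if K: "sets K = sets M" "emeasure K (space M - (\<Union>i. Q i)) = 0" for K
  proof -
    let ?U = "\<Union>i. Q i"
    have UK: "?U \<in> sets K" and AK: "A \<in> sets K" using QU A K(1) by simp_all
    have "emeasure K (A - ?U) \<le> emeasure K (space M - ?U)"
    proof (rule emeasure_mono)
      show "A - ?U \<subseteq> space M - ?U" using sets.sets_into_space[OF A] by blast
      show "space M - ?U \<in> sets K" using sets.compl_sets[OF QU] K(1) by simp
    qed
    then have zero: "emeasure K (A - ?U) = 0" using K(2) by simp
    have "emeasure K (A \<inter> ?U) + emeasure K (A - ?U) = emeasure K ((A \<inter> ?U) \<union> (A - ?U))"
      by (rule plus_emeasure[OF sets.Int[OF AK UK] sets.Diff[OF AK UK]]) blast
    moreover have "(A \<inter> ?U) \<union> (A - ?U) = A" by (rule Int_Diff_Un)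
    ultimately have "emeasure K A = emeasure K (A \<inter> ?U)" using zero by simp
    also have "A \<inter> ?U = (\<Union>n. A \<inter> disjointed ?Q n)"
      unfolding Un UN_disjointed_eq[of ?Q, symmetric] by (rule Int_UN_distrib)
    also have "emeasure K (\<Union>n. A \<inter> disjointed ?Q n) = (\<Sum>n. emeasure K (A \<inter> disjointed ?Q n))"
    proof (rule suminf_emeasure[symmetric])
      show "range (\<lambda>n. A \<inter> disjointed ?Q n) \<subseteq> sets K" using A dis K(1) by auto
      show "disjoint_family (\<lambda>n. A \<inter> disjointed ?Q n)"
        using disjoint_family_disjointed[of ?Q] unfolding disjoint_family_on_def by blast
    qed
    finally show ?thesis .
  qed
  have "emeasure M (A \<inter> disjointed ?Q n) = emeasure N (A \<inter> disjointed ?Q n)" for n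
    by (rule eq[of _ "from_nat n"]) (use A dis disjointed_subset[of ?Q n] in auto)
  then show "emeasure M A = emeasure N A"
    using split[OF refl null(1)] split[OF sets null(2)] by simp
qed

lemma sorted_nth_le_iff:
  fixes xs :: "'a::linorder list"
  assumes "sorted xs" "j < length xs"
  shows "xs ! j \<le> x \<longleftrightarrow> j < length (filter (\<lambda>y. y \<le> x) xs)"
  using assms
proof (induction xs arbitrary: j)
  case (Cons y ys)
  show ?case
  proof (cases "y \<le> x")
    case True
    then show ?thesis using Cons by (cases j) auto
  next
    case False
    then have "filter (\<lambda>z. z \<le> x) ys = []" using Cons.prems(1) by (force simp: filter_empty_conv)
    moreover have "\<not> (y # ys) ! j \<le> x"
      using Cons.prems False nth_mem[of j "y # ys"] by fastforce
    ultimately show ?thesis using False by simp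
  qed
qed simp

text \<open>
Order statistics are described by counts, and a count of vertices is an existential statement about lists of vertices,
of which there are countably many.
\<close>

lemma sorted_ages_le_iff:
  fixes t :: "nat list \<rightharpoonup> real"
  assumes i: "i \<in> {1..k}" and fin: "finite (dom t)" and card: "i \<le> card (dom t)"
  shows "sorted_ages k t i \<le> x \<longleftrightarrow> i \<le> card {u \<in> dom t. the (t u) \<le> x}"
proof -
  let ?m = "image_mset (\<lambda>u. the (t u)) (mset_set (dom t))"
  let ?xs = "sorted_list_of_multiset ?m"
  have len: "length ?xs = card (dom t)"
    by (metis mset_sorted_list_of_multiset size_image_mset size_mset size_mset_set)
  have "length (filter (\<lambda>y. y \<le> x) ?xs) = size (filter_mset (\<lambda>y. y \<le> x) ?m)"
    by (metis mset_filter mset_sorted_list_of_multiset size_mset)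
  also have "\<dots> = card {u \<in> dom t. the (t u) \<le> x}"
    using fin by (simp add: filter_mset_image_mset)
  finally have f: "length (filter (\<lambda>y. y \<le> x) ?xs) = card {u \<in> dom t. the (t u) \<le> x}" .
  have "i - 1 < length ?xs" using i card len by auto
  then have "?xs ! (i - 1) \<le> x \<longleftrightarrow> i - 1 < card {u \<in> dom t. the (t u) \<le> x}"
    unfolding f[symmetric] by (intro sorted_nth_le_iff sorted_sorted_list_of_multiset)
  then show ?thesis
    using i \<open>i - 1 < length ?xs\<close> by (auto simp: sorted_ages_def nth_default_nth)
qed

lemma card_ge_iff_list:
  assumes "finite A"
  shows "n \<le> card A \<longleftrightarrow> (\<exists>xs. distinct xs \<and> length xs = n \<and> set xs \<subseteq> A)"
proof
  assume "n \<le> card A"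
  then obtain B where "B \<subseteq> A" "card B = n" "finite B" using obtain_subset_with_card_n by blast
  then show "\<exists>xs. distinct xs \<and> length xs = n \<and> set xs \<subseteq> A"
    using finite_distinct_list[of B] distinct_card by metis
next
  assume "\<exists>xs. distinct xs \<and> length xs = n \<and> set xs \<subseteq> A"
  then show "n \<le> card A" using assms distinct_card card_mono by metis
qed

lemma sorted_ages_default:
  assumes i: "i \<in> {1..k}" and n: "\<not> (finite (dom t) \<and> i \<le> card (dom t))"
  shows "sorted_ages k t i = 0"
proof -
  let ?m = "image_mset (\<lambda>u. the (t u)) (mset_set (dom t))"
  have "length (sorted_list_of_multiset ?m) = card (dom t)"
    by (metis mset_sorted_list_of_multiset size_image_mset size_mset size_mset_set)
  moreover have "card (dom t) < i" using i n by (cases "finite (dom t)") auto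
  ultimately show ?thesis using i by (auto simp: sorted_ages_def nth_default_def)
qed

lemma Collect_eq_image_iff:
  "{g u c | u c. P u c} = f ` T \<longleftrightarrow> (\<forall>u c. P u c \<longrightarrow> (\<exists>e\<in>T. g u c = f e)) \<and> (\<forall>e\<in>T. \<exists>u c. P u c \<and> g u c = f e)"
proof
  assume eq: "{g u c | u c. P u c} = f ` T"
  have "\<exists>e\<in>T. g u c = f e" if "P u c" for u c
  proof -
    have "g u c \<in> {g u c | u c. P u c}" using that by blast
    then have "g u c \<in> f ` T" by (simp only: eq)
    then show ?thesis by blast
  qed
  moreover have "\<exists>u c. P u c \<and> g u c = f e" if "e \<in> T" for e
  proof -
    have "f e \<in> {g u c | u c. P u c}" unfolding eq using that by (rule imageI)
    then obtain u c where "f e = g u c" "P u c" by blast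
    then show ?thesis by metis
  qed
  ultimately show "(\<forall>u c. P u c \<longrightarrow> (\<exists>e\<in>T. g u c = f e)) \<and> (\<forall>e\<in>T. \<exists>u c. P u c \<and> g u c = f e)"
    by simp
next
  assume r: "(\<forall>u c. P u c \<longrightarrow> (\<exists>e\<in>T. g u c = f e)) \<and> (\<forall>e\<in>T. \<exists>u c. P u c \<and> g u c = f e)"
  show "{g u c | u c. P u c} = f ` T"
  proof (intro equalityI subsetI)
    fix z assume "z \<in> {g u c | u c. P u c}"
    then obtain u c where "z = g u c" "P u c" by blast
    with r show "z \<in> f ` T" by (metis imageI)
  next
    fix z assume "z \<in> f ` T"
    then obtain e where "z = f e" "e \<in> T" by blast
    with r obtain u c where "P u c" "g u c = z" by metis
    then show "z \<in> {g u c | u c. P u c}" by blast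
  qed
qed

lemma finite_iff_list: "finite A \<longleftrightarrow> (\<exists>xs. \<forall>x. x \<in> A \<longleftrightarrow> x \<in> set xs)"
  by (metis List.finite_set finite_list set_eqI)

lemma sorted_ages_extensional: "sorted_ages k t \<in> extensional {1..k}"
  by (simp add: sorted_ages_def)

abbreviation (input) age_space :: "nat \<Rightarrow> (nat \<Rightarrow> real) measure" where
  "age_space k \<equiv> PiM {1..k} (\<lambda>_. lborel)"

text \<open>
The chamber with \<open>0 \<le> a 1\<close> in place of \<open>0 < a 1\<close>: it contains the sorted ages of every tree with distinct ages.  The
two differ by a null set (\<open>AE_weak_chamber\<close>).
\<close>

definition weak_chamber :: "nat \<Rightarrow> (nat \<Rightarrow> real) set" where
  "weak_chamber k = {a \<in> space (age_space k). \<forall>i\<in>{1..k}. 0 \<le> a i \<and> (\<forall>j\<in>{1..k}. i < j \<longrightarrow> a i < a j)}"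

lemma measurable_age_coordinate [measurable (raw)]: "i \<in> {1..k} \<Longrightarrow> (\<lambda>a. a i) \<in> borel_measurable (age_space k)"
  using measurable_component_singleton[of i "{1..k}" "\<lambda>_. lborel :: real measure"] by simp

lemma sets_weak_chamber [measurable]: "weak_chamber k \<in> sets (age_space k)"
proof -
  have "Measurable.pred (age_space k) (\<lambda>a. \<forall>i\<in>{1..k}. 0 \<le> a i \<and> (\<forall>j\<in>{1..k}. i < j \<longrightarrow> a i < a j))"
  proof (intro pred_intros_finite(3) pred_intros_logic(3) pred_intros_imp'; (rule finite_atLeastAtMost)?)
    fix i assume i: "i \<in> {1..k}"
    note [measurable] = measurable_age_coordinate[OF i]
    show "Measurable.pred (age_space k) (\<lambda>a. 0 \<le> a i)" by measurable
    fix j assume "j \<in> {1..k}"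
    note [measurable] = measurable_age_coordinate[OF this]
    show "Measurable.pred (age_space k) (\<lambda>a. a i < a j)" by measurable
  qed
  then show ?thesis by (simp add: weak_chamber_def pred_def)
qed

lemma measurable_tree_weight [measurable]:
  assumes T: "spanning_tree_on {1..k} T"
  shows "(\<lambda>a. tree_weight a T) \<in> borel_measurable (age_space k)"
proof -
  have "(\<lambda>a. Min (a ` e)) \<in> borel_measurable (age_space k)" if "e \<in> T" for e
  proof -
    obtain x y where xy: "e = {x, y}" "x \<in> {1..k}" "y \<in> {1..k}" using T \<open>e \<in> T\<close> unfolding spanning_tree_on_def by blast
    note [measurable] = measurable_age_coordinate[OF xy(2)] measurable_age_coordinate[OF xy(3)]
    have "(\<lambda>a. min (a x) (a y)) \<in> borel_measurable (age_space k)" by measurable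
    then show ?thesis by (simp add: xy(1))
  qed
  then show ?thesis unfolding tree_weight_def by (intro borel_measurable_prod)
qed

lemma measurable_exp_ages [measurable]: "(\<lambda>a. \<Prod>i=1..k. exp (- a i)) \<in> borel_measurable (age_space k)"
  by (intro borel_measurable_prod measurable_compose[OF measurable_age_coordinate]) auto

lemma measurable_tree_density [measurable]:
  assumes T: "spanning_tree_on {1..k} T"
  shows "tree_density k T \<in> borel_measurable (age_space k)"
  unfolding tree_density_def using measurable_tree_weight[OF T] by measurable

context age_galton_watson
begin

lemma measurable_sorted_ages [measurable]: "(\<lambda>\<omega>. sorted_ages k (H \<omega>)) \<in> measurable M (age_space k)"
proof (rule measurable_PiM_single')
  fix i assume i: "i \<in> {1..k}"
  let ?fin = "\<lambda>\<omega>. \<exists>us::nat list list. \<forall>u. u \<in> dom (H \<omega>) \<longleftrightarrow> u \<in> set us"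
  let ?many = "\<lambda>\<omega>. \<exists>us::nat list list. distinct us \<and> length us = i \<and> (\<forall>u\<in>set us. u \<in> dom (H \<omega>))"
  let ?low = "\<lambda>x \<omega>. \<exists>us::nat list list. distinct us \<and> length us = i \<and> (\<forall>u\<in>set us. u \<in> dom (H \<omega>) \<and> age u \<omega> \<le> x)"
  have iff: "sorted_ages k (H \<omega>) i \<le> x \<longleftrightarrow> (if ?fin \<omega> \<and> ?many \<omega> then ?low x \<omega> else 0 \<le> x)" for x \<omega>
  proof (cases "finite (dom (H \<omega>))")
    case True
    have many: "?many \<omega> \<longleftrightarrow> i \<le> card (dom (H \<omega>))"
      unfolding card_ge_iff_list[OF True] subset_code(1) by (rule refl)
    have fin: "?fin \<omega>" using True unfolding finite_iff_list .
    have fin': "finite {u \<in> dom (H \<omega>). age u \<omega> \<le> x}" using True by simp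
    have low: "?low x \<omega> \<longleftrightarrow> i \<le> card {u \<in> dom (H \<omega>). age u \<omega> \<le> x}"
      unfolding card_ge_iff_list[OF fin'] subset_code(1) mem_Collect_eq by (rule refl)
    show ?thesis
    proof (cases "i \<le> card (dom (H \<omega>))")
      case c: True
      show ?thesis using fin many low c sorted_ages_le_iff[OF i True c, of x] by (simp only: if_True simp_thms)
    next
      case False
      then show ?thesis using many sorted_ages_default[OF i, of "H \<omega>"] by (simp only: if_False simp_thms)
    qed
  next
    case False
    then have "\<not> ?fin \<omega>" unfolding finite_iff_list .
    moreover have "sorted_ages k (H \<omega>) i = 0" by (rule sorted_ages_default[OF i]) (use False in blast)
    ultimately show ?thesis by (simp only: if_False simp_thms)
  qed
  have "(\<lambda>\<omega>. sorted_ages k (H \<omega>) i) \<in> borel_measurable M"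
    unfolding borel_measurable_iff_le iff
  proof
    fix x
    have fin: "Measurable.pred M ?fin" and many: "Measurable.pred M ?many" and low: "Measurable.pred M (?low x)"
      by measurable
    note some = pred_intros_logic(3)[OF fin many]
    have "Measurable.pred M (\<lambda>\<omega>. if ?fin \<omega> \<and> ?many \<omega> then ?low x \<omega> else 0 \<le> x)"
      unfolding if_bool_eq_disj
      by (intro pred_intros_logic(5) pred_intros_logic(3)[OF some low] pred_intros_logic(3)[OF pred_intros_logic(2)[OF some]]) measurable
    then show "{\<omega> \<in> space M. if ?fin \<omega> \<and> ?many \<omega> then ?low x \<omega> else 0 \<le> x} \<in> sets M" by (simp only: pred_def)
  qed
  then show "(\<lambda>\<omega>. sorted_ages k (H \<omega>) i) \<in> measurable M lborel" by simp
next
  show "(\<lambda>\<omega>. sorted_ages k (H \<omega>)) \<in> space M \<rightarrow> (\<Pi>\<^sub>E i\<in>{1..k}. space lborel)"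
    using sorted_ages_extensional by (auto simp: PiE_def)
qed

lemma measurable_sorted_age: "i \<in> {1..k} \<Longrightarrow> (\<lambda>\<omega>. sorted_ages k (H \<omega>) i) \<in> borel_measurable M"
  by (rule measurable_compose[OF measurable_sorted_ages measurable_age_coordinate])

lemma sets_card_vertices:
  assumes "1 \<le> k"
  shows "{\<omega> \<in> space M. card (dom (H \<omega>)) = k} \<in> sets M"
proof -
  have "card (dom (H \<omega>)) = k \<longleftrightarrow> (\<exists>us::nat list list. distinct us \<and> length us = k \<and> (\<forall>u. u \<in> dom (H \<omega>) \<longleftrightarrow> u \<in> set us))" for \<omega>
  proof
    assume c: "card (dom (H \<omega>)) = k"
    then have "finite (dom (H \<omega>))" using assms by (intro card_ge_0_finite) simp
    from finite_distinct_list[OF this] obtain us where "set us = dom (H \<omega>)" "distinct us" by blast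
    then show "\<exists>us. distinct us \<and> length us = k \<and> (\<forall>u. u \<in> dom (H \<omega>) \<longleftrightarrow> u \<in> set us)"
      using c distinct_card[of us] by (intro exI[of _ us]) simp
  next
    assume "\<exists>us. distinct us \<and> length us = k \<and> (\<forall>u. u \<in> dom (H \<omega>) \<longleftrightarrow> u \<in> set us)"
    then obtain us where "distinct us" "length us = k" "dom (H \<omega>) = set us" by blast
    then show "card (dom (H \<omega>)) = k" using distinct_card[of us] by simp
  qed
  moreover have "Measurable.pred M (\<lambda>\<omega>. \<exists>us::nat list list. distinct us \<and> length us = k \<and> (\<forall>u. u \<in> dom (H \<omega>) \<longleftrightarrow> u \<in> set us))"
    by measurable
  ultimately show ?thesis by (simp only: pred_def)
qed

lemma sets_edges_event:
  assumes T: "spanning_tree_on {1..k} T"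
  shows "{\<omega> \<in> space M. tree_edges (H \<omega>) = (\<lambda>e. sorted_ages k (H \<omega>) ` e) ` T} \<in> sets M"
proof -
  have finT: "finite T"
    using T finite_subset[of T "Pow {1..k}"] unfolding spanning_tree_on_def by fastforce
  let ?eq = "\<lambda>u c e \<omega>. {age u \<omega>, age (u @ [c]) \<omega>} = sorted_ages k (H \<omega>) ` e"
  have eqm [measurable]: "Measurable.pred M (?eq u c e)" if e: "e \<in> T" for u c e
  proof -
    obtain x y where xy: "e = {x, y}" "x \<in> {1..k}" "y \<in> {1..k}" using T e unfolding spanning_tree_on_def by blast
    note [measurable] = measurable_sorted_age[OF xy(2)] measurable_sorted_age[OF xy(3)]
    have "Measurable.pred M (\<lambda>\<omega>. age u \<omega> = sorted_ages k (H \<omega>) x \<and> age (u @ [c]) \<omega> = sorted_ages k (H \<omega>) y \<or>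
        age u \<omega> = sorted_ages k (H \<omega>) y \<and> age (u @ [c]) \<omega> = sorted_ages k (H \<omega>) x)" by measurable
    then show ?thesis unfolding xy(1) image_insert image_empty doubleton_eq_iff .
  qed
  have iff: "tree_edges (H \<omega>) = (\<lambda>e. sorted_ages k (H \<omega>) ` e) ` T \<longleftrightarrow>
     (\<forall>u c. u @ [c] \<in> dom (H \<omega>) \<longrightarrow> (\<exists>e\<in>T. ?eq u c e \<omega>)) \<and> (\<forall>e\<in>T. \<exists>u c. u @ [c] \<in> dom (H \<omega>) \<and> ?eq u c e \<omega>)" for \<omega>
    unfolding tree_edges_def by (rule Collect_eq_image_iff)
  have "Measurable.pred M (\<lambda>\<omega>. (\<forall>u c. u @ [c] \<in> dom (H \<omega>) \<longrightarrow> (\<exists>e\<in>T. ?eq u c e \<omega>)) \<and> (\<forall>e\<in>T. \<exists>u c. u @ [c] \<in> dom (H \<omega>) \<and> ?eq u c e \<omega>))"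
    by (rule pred_intros_logic(3); intro pred_intros_countable(1,2) pred_intros_finite(3,4) pred_intros_logic(4) pred_intros_logic(3) finT eqm measurable_vertex; assumption)
  then show ?thesis unfolding iff pred_def .
qed

lemma sets_distinct_ages:
  assumes "1 \<le> k"
  shows "distinct_ages k \<in> sets M"
proof -
  have "Measurable.pred M (\<lambda>\<omega>. \<forall>u v. u \<in> dom (H \<omega>) \<longrightarrow> v \<in> dom (H \<omega>) \<longrightarrow> age u \<omega> = age v \<omega> \<longrightarrow> u = v)"
    by measurable
  then have "{\<omega> \<in> space M. inj_on (\<lambda>u. age u \<omega>) (dom (H \<omega>))} \<in> sets M"
    unfolding pred_def inj_on_def Ball_def by (simp only: imp_conjL all_simps)
  moreover have "distinct_ages k = {\<omega> \<in> space M. card (dom (H \<omega>)) = k} \<inter> {\<omega> \<in> space M. inj_on (\<lambda>u. age u \<omega>) (dom (H \<omega>))}"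
    by (auto simp only: distinct_ages_def)
  ultimately show ?thesis using sets_card_vertices[OF assms] by (simp only: sets.Int)
qed

lemma sets_tree_event:
  assumes "1 \<le> k" "spanning_tree_on {1..k} T"
  shows "tree_event k T \<in> sets M"
proof -
  have "tree_event k T = distinct_ages k \<inter> {\<omega> \<in> space M. tree_edges (H \<omega>) = (\<lambda>e. sorted_ages k (H \<omega>) ` e) ` T}"
    by (auto simp only: tree_event_def distinct_ages_def)
  then show ?thesis using sets_distinct_ages[OF assms(1)] sets_edges_event[OF assms(2)] by (simp only: sets.Int)
qed

end

section \<open>The joint law of the ages and the tree\<close>

text \<open>
The side \<open>i\<close> is the interval between the entries \<open>i - 1\<close> and \<open>i\<close> of \<open>q\<close>, so a sorted \<open>q\<close> gives consecutive
intervals.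
\<close>

definition rational_box :: "nat \<Rightarrow> rat list \<Rightarrow> nat \<Rightarrow> real set" where
  "rational_box k q i = {0..} \<inter> {real_of_rat (q ! (i - 1)) ..< real_of_rat (q ! i)}"

lemma rational_box_sets: "rational_box k q i \<in> sets age_law"
  by (auto simp: rational_box_def sets_age_law)

lemma rational_box_ordered:
  assumes q: "length q = Suc k" "sorted q" and ij: "i \<in> {1..k}" "j \<in> {1..k}" "i < j"
    and xy: "x \<in> rational_box k q i" "y \<in> rational_box k q j"
  shows "x < y"
proof -
  have "q ! i \<le> q ! (j - 1)" using q ij by (intro sorted_nth_mono) auto
  then have "real_of_rat (q ! i) \<le> real_of_rat (q ! (j - 1))" by (simp add: of_rat_less_eq)
  then show ?thesis using xy by (auto simp: rational_box_def)
qed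

lemma rational_box_cover:
  assumes a: "a \<in> weak_chamber k"
  shows "\<exists>q. length q = Suc k \<and> sorted q \<and> (\<forall>i\<in>{1..k}. a i \<in> rational_box k q i)"
proof -
  have pos: "0 \<le> a i" if "i \<in> {1..k}" for i using a that by (simp add: weak_chamber_def)
  have mono: "a i < a j" if "i \<in> {1..k}" "j \<in> {1..k}" "i < j" for i j using a that unfolding weak_chamber_def by blast
  have "\<exists>c::rat. (1 \<le> i \<and> i \<le> k \<longrightarrow> a i < real_of_rat c) \<and> (i < k \<longrightarrow> real_of_rat c \<le> a (Suc i))" for i
  proof -
    consider "i = 0" | "1 \<le> i" "i < k" | "1 \<le> i" "k \<le> i" by linarith
    then show ?thesis
    proof cases
      case 1
      then show ?thesis using pos[of 1] by (intro exI[of _ 0]) auto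
    next
      case 2
      then obtain c where "a i < real_of_rat c" "real_of_rat c < a (Suc i)"
        using of_rat_dense[OF mono[of i "Suc i"]] by auto
      then show ?thesis by (intro exI[of _ c]) auto
    next
      case 3
      obtain c where "a i < real_of_rat c" using of_rat_dense[of "a i" "a i + 1"] by auto
      then show ?thesis using 3 by (intro exI[of _ c]) auto
    qed
  qed
  then obtain f :: "nat \<Rightarrow> rat" where f: "\<And>i. 1 \<le> i \<Longrightarrow> i \<le> k \<Longrightarrow> a i < real_of_rat (f i)" "\<And>i. i < k \<Longrightarrow> real_of_rat (f i) \<le> a (Suc i)"
    by metis
  let ?q = "map f [0..<Suc k]"
  have nth: "?q ! i = f i" if "i \<le> k" for i using that by (simp del: upt_Suc)
  have "sorted ?q"
    unfolding sorted_iff_nth_Suc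
  proof (intro allI impI)
    fix i assume "Suc i < length ?q"
    then have i: "i < k" by (simp del: upt_Suc)
    have "real_of_rat (f i) < real_of_rat (f (Suc i))"
      using f(2)[OF i] f(1)[of "Suc i"] i by auto
    then show "?q ! i \<le> ?q ! Suc i" using i nth[of i] nth[of "Suc i"] by (simp add: of_rat_less del: upt_Suc)
  qed
  moreover have "a i \<in> rational_box k ?q i" if i: "i \<in> {1..k}" for i
  proof -
    have "i - 1 \<le> k" "i \<le> k" using i by auto
    then have "?q ! (i - 1) = f (i - 1)" "?q ! i = f i" by (simp_all only: nth)
    moreover have "a i < real_of_rat (f i)" "real_of_rat (f (i - 1)) \<le> a i"
      using i f(1)[of i] f(2)[of "i - 1"] by auto
    ultimately show ?thesis using pos[OF i] unfolding rational_box_def by simp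
  qed
  ultimately show ?thesis by (intro exI[of _ ?q]) (simp del: upt_Suc)
qed

context age_galton_watson
begin

lemma distinct_ages_props:
  assumes \<omega>: "\<omega> \<in> distinct_ages k" and k: "1 \<le> k"
  shows "sorted_ages k (H \<omega>) \<in> weak_chamber k"
    and "(\<Sum>u\<in>dom (H \<omega>). age u \<omega>) = (\<Sum>i=1..k. sorted_ages k (H \<omega>) i)"
    and "\<exists>T. spanning_tree_on {1..k} T \<and> \<omega> \<in> tree_event k T"
    and "inj_on (sorted_ages k (H \<omega>)) {1..k}"
proof -
  have \<omega>M: "\<omega> \<in> space M" and card: "card (dom (H \<omega>)) = k" and inj: "inj_on (\<lambda>u. age u \<omega>) (dom (H \<omega>))"
    using \<omega> by (auto simp only: distinct_ages_def)
  have fin: "finite (dom (H \<omega>))" using card k by (intro card_ge_0_finite) simp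
  obtain \<phi> where bij: "bij_betw \<phi> {1..k} (dom (H \<omega>))" and mono: "strict_mono_on {1..k} (\<lambda>i. age (\<phi> i) \<omega>)"
    by (rule exists_sorting_placement[OF fin card inj])
  let ?a = "\<lambda>i. age (\<phi> i) \<omega>"
  have sa: "sorted_ages k (H \<omega>) i = ?a i" if "i \<in> {1..k}" for i by (rule sorted_ages_placement[OF bij mono that])
  have dom: "dom (H \<omega>) = \<phi> ` {1..k}" using bij by (simp add: bij_betw_def)
  show "sorted_ages k (H \<omega>) \<in> weak_chamber k"
    unfolding weak_chamber_def
  proof (intro CollectI conjI ballI impI)
    show "sorted_ages k (H \<omega>) \<in> space (age_space k)"
      using sorted_ages_extensional by (auto simp: space_PiM PiE_def)
    fix i assume i: "i \<in> {1..k}"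
    then show "0 \<le> sorted_ages k (H \<omega>) i" using age_nonneg[OF \<omega>M, of "\<phi> i"] dom sa by simp
    fix j assume "j \<in> {1..k}" "i < j"
    then show "sorted_ages k (H \<omega>) i < sorted_ages k (H \<omega>) j"
      using strict_mono_onD[OF mono i] sa i by simp
  qed
  have "(\<Sum>u\<in>dom (H \<omega>). age u \<omega>) = (\<Sum>i=1..k. ?a i)"
    by (rule sum.reindex_bij_betw[OF bij, symmetric])
  also have "\<dots> = (\<Sum>i=1..k. sorted_ages k (H \<omega>) i)" using sa by (intro sum.cong refl) simp
  finally show "(\<Sum>u\<in>dom (H \<omega>). age u \<omega>) = (\<Sum>i=1..k. sorted_ages k (H \<omega>) i)" .
  have "inj_on ?a {1..k}" by (rule strict_mono_on_imp_inj_on[OF mono])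
  then show "inj_on (sorted_ages k (H \<omega>)) {1..k}" using sa by (subst inj_on_cong[where g = ?a]) auto
  have "\<exists>r\<in>{1..k}. \<phi> r = [] \<and> (\<exists>p\<in>parent_maps ({1..k} - {r}) r. \<forall>j\<in>{1..k} - {r}. \<exists>c. \<phi> j = \<phi> (p j) @ [c])"
    by (rule placement_parent_map[OF bij finite_atLeastAtMost root_mem[OF \<omega>M] parent_mem[OF \<omega>M]])
  then obtain r p where r: "r \<in> {1..k}" "\<phi> r = []" and p: "p \<in> parent_maps ({1..k} - {r}) r"
    and step: "\<And>j. j \<in> {1..k} - {r} \<Longrightarrow> \<exists>c. \<phi> j = \<phi> (p j) @ [c]"
    by blast
  have ins: "insert r ({1..k} - {r}) = {1..k}" using r by auto
  let ?T = "parent_edges ({1..k} - {r}) p"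
  have T: "spanning_tree_on {1..k} ?T"
    using spanning_tree_parent_edges[OF p] unfolding ins by simp
  have "tree_edges (H \<omega>) = (\<lambda>e. ?a ` e) ` ?T"
    by (rule tree_edges_placement[OF _ r(2) step]) (simp_all only: ins dom)
  also have "\<dots> = (\<lambda>e. sorted_ages k (H \<omega>) ` e) ` ?T"
  proof -
    have "e \<subseteq> {1..k}" if "e \<in> ?T" for e using T that unfolding spanning_tree_on_def by fastforce
    then show ?thesis by (intro image_cong[OF refl] sa[symmetric]) blast
  qed
  finally have "\<omega> \<in> tree_event k ?T" using \<omega> by (simp only: tree_event_def mem_Collect_eq)
  with T show "\<exists>T. spanning_tree_on {1..k} T \<and> \<omega> \<in> tree_event k T" by blast
qed

lemma tree_event_unique:
  assumes "\<omega> \<in> tree_event k T" "\<omega> \<in> tree_event k T'" and k: "1 \<le> k"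
    and T: "spanning_tree_on {1..k} T" "spanning_tree_on {1..k} T'"
  shows "T = T'"
proof -
  have "inj_on (\<lambda>e. sorted_ages k (H \<omega>) ` e) (Pow {1..k})"
    using assms(1) distinct_ages_props(4)[OF _ k] by (intro inj_on_image_Pow) (simp only: tree_event_def mem_Collect_eq)
  moreover have "T \<subseteq> Pow {1..k}" "T' \<subseteq> Pow {1..k}" using T unfolding spanning_tree_on_def by fastforce+
  moreover have "(\<lambda>e. sorted_ages k (H \<omega>) ` e) ` T = (\<lambda>e. sorted_ages k (H \<omega>) ` e) ` T'"
    using assms(1,2) by (simp only: tree_event_def mem_Collect_eq)
  ultimately show ?thesis by (simp only: inj_on_image_eq_iff)
qed

text \<open>
The chamber is covered by countably many rational boxes with ordered sides.  On the measurable subsets of one box both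
measures agree, because they agree on sub-boxes by \<open>ordered_box_law\<close>.
\<close>

lemma tree_event_law:
  assumes k: "1 \<le> k" and T: "spanning_tree_on {1..k} T"
  shows "distr (density M (indicator (tree_event k T))) (age_space k) (\<lambda>\<omega>. sorted_ages k (H \<omega>)) =
    density (age_space k) (\<lambda>a. indicator (weak_chamber k) a * ennreal (tree_density k T a))"
    (is "?\<mu> = ?\<nu>")
proof -
  let ?S = "tree_event k T" and ?ages = "\<lambda>\<omega>. sorted_ages k (H \<omega>)"
  let ?R = "age_space k"
  note [measurable] = sets_tree_event[OF k T] measurable_tree_density[OF T]
  have setsS: "sets ?\<mu> = sets ?R" "sets ?\<nu> = sets ?R" by simp_all
  have \<mu>: "emeasure ?\<mu> A = emeasure M {\<omega> \<in> ?S. ?ages \<omega> \<in> A}" if A: "A \<in> sets ?R" for A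
  proof -
    have B: "?ages -` A \<inter> space M \<in> sets M" by (rule measurable_sets[OF measurable_sorted_ages A])
    have "?ages \<in> measurable (density M (indicator ?S)) ?R"
      unfolding measurable_density_eq1 by (rule measurable_sorted_ages)
    from emeasure_distr[OF this A]
    have "emeasure ?\<mu> A = emeasure (density M (indicator ?S)) (?ages -` A \<inter> space M)"
      unfolding space_density .
    also have "\<dots> = (\<integral>\<^sup>+\<omega>. indicator ?S \<omega> * indicator (?ages -` A \<inter> space M) \<omega> \<partial>M)"
      by (rule emeasure_density) (use B in measurable)
    also have "\<dots> = (\<integral>\<^sup>+\<omega>. indicator (?S \<inter> (?ages -` A \<inter> space M)) \<omega> \<partial>M)"
      by (intro nn_integral_cong) (simp add: indicator_inter_arith)
    also have "\<dots> = emeasure M (?S \<inter> (?ages -` A \<inter> space M))"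
      by (rule nn_integral_indicator) (use B in measurable)
    also have "?S \<inter> (?ages -` A \<inter> space M) = {\<omega> \<in> ?S. ?ages \<omega> \<in> A}"
      by (auto simp: tree_event_def distinct_ages_def)
    finally show ?thesis .
  qed
  have \<nu>: "emeasure ?\<nu> A = (\<integral>\<^sup>+a. indicator (weak_chamber k) a * ennreal (tree_density k T a) * indicator A a \<partial>?R)"
    if "A \<in> sets ?R" for A
    by (rule emeasure_density) (use that in measurable)
  define Q where "Q q = (if length q = Suc k \<and> sorted q then PiE {1..k} (rational_box k q) else {})" for q
  have Q_True: "Q q = PiE {1..k} (rational_box k q)" if "length q = Suc k \<and> sorted q" for q
    unfolding Q_def using that by (rule if_P)
  have box: "PiE {1..k} A \<in> sets ?R" if "\<And>i. i \<in> {1..k} \<Longrightarrow> A i \<in> sets borel" for A :: "nat \<Rightarrow> real set"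
    by (rule sets_PiM_I_finite) (use that in simp_all)
  have rb: "rational_box k q i \<in> sets borel" for q i using rational_box_sets[of k q i] by (simp add: sets_age_law)
  have Q: "Q q \<in> sets ?R" for q 
  proof -
    have "PiE {1..k} (rational_box k q) \<in> sets ?R" by (rule box[OF rb])
    then show ?thesis unfolding Q_def by (simp only: sets.empty_sets split: if_split) simp
  qed
  define U where "U = (\<Union>q. Q q)"
  show ?thesis
  proof (rule measure_eqI_countable_cover[where Q = Q])
    show "sets ?\<nu> = sets ?\<mu>" by simp
    show "Q q \<in> sets ?\<mu>" for q unfolding setsS by (rule Q)
    have cover: "weak_chamber k \<subseteq> (\<Union>q. Q q)"
    proof
      fix a assume a: "a \<in> weak_chamber k"
      from rational_box_cover[OF a] obtain q where q: "length q = Suc k" "sorted q" "\<forall>i\<in>{1..k}. a i \<in> rational_box k q i" by blast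
      have "a \<in> extensional {1..k}" using a by (auto simp: weak_chamber_def space_PiM PiE_def)
      then have "a \<in> PiE {1..k} (rational_box k q)" using q(3) by (auto simp: PiE_def)
      then have "a \<in> Q q" using Q_True q by blast
      then show "a \<in> (\<Union>q. Q q)" by blast
    qed
    have UR: "space ?\<mu> - U \<in> sets ?R"
    proof -
      have "U \<in> sets ?R" unfolding U_def using Q by (intro sets.countable_UN'') simp_all
      then show ?thesis using sets.compl_sets[of U ?R] by simp
    qed
    have coverU: "weak_chamber k \<subseteq> U" using cover unfolding U_def .
    have "{\<omega> \<in> ?S. ?ages \<omega> \<in> space ?\<mu> - U} = {}"
      using distinct_ages_props(1)[OF _ k] coverU by (auto simp only: tree_event_def)
    then show "emeasure ?\<mu> (space ?\<mu> - (\<Union>q. Q q)) = 0"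
      unfolding U_def[symmetric] \<mu>[OF UR] by (simp only: emeasure_empty)
    have zero: "indicator (weak_chamber k) a * ennreal (tree_density k T a) * indicator (space ?\<mu> - U) a = 0" for a
      using coverU by (cases "a \<in> weak_chamber k") auto
    show "emeasure ?\<nu> (space ?\<mu> - (\<Union>q. Q q)) = 0"
      unfolding U_def[symmetric] \<nu>[OF UR] zero by (rule nn_integral_const[THEN trans]) simp
    fix q A assume "A \<in> sets ?\<mu>" and AQ: "A \<subseteq> Q q"
    then have A: "A \<in> sets ?R" by simp
    show "emeasure ?\<mu> A = emeasure ?\<nu> A"
    proof (cases "length q = Suc k \<and> sorted q")
      case False
      then have "A = {}" using AQ unfolding Q_def by (simp only: if_False subset_empty)
      then show ?thesis by simp
    next
      case q: True
      let ?J = "PiE {1..k} (rational_box k q)"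
      have AJ: "A \<subseteq> ?J" using AQ unfolding Q_True[OF q] .
      have J: "?J \<in> sets ?R" by (rule box[OF rb])
      have restr: "emeasure (density K (indicator ?J)) B = emeasure K (B \<inter> ?J)" if "sets K = sets ?R" "B \<in> sets ?R" for K B
      proof -
        have "emeasure (density K (indicator ?J)) B = (\<integral>\<^sup>+a. indicator ?J a * indicator B a \<partial>K)"
          by (rule emeasure_density) (use that J in simp_all)
        also have "\<dots> = (\<integral>\<^sup>+a. indicator (B \<inter> ?J) a \<partial>K)"
          by (intro nn_integral_cong) (simp add: indicator_inter_arith mult.commute)
        also have "\<dots> = emeasure K (B \<inter> ?J)" by (rule nn_integral_indicator) (use that J in simp)
        finally show ?thesis .
      qed
      have "density ?\<mu> (indicator ?J) = density ?\<nu> (indicator ?J)"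
      proof (rule measure_eqI_PiM_finite)
        show "sets (density ?\<mu> (indicator ?J)) = ?R" "sets (density ?\<nu> (indicator ?J)) = ?R" by simp_all
        fix B :: "nat \<Rightarrow> real set" assume B: "\<And>i. i \<in> {1..k} \<Longrightarrow> B i \<in> sets lborel"
        define I where "I i = (if i \<in> {1..k} then B i \<inter> rational_box k q i else {})" for i
        have I_in: "I i = B i \<inter> rational_box k q i" if "i \<in> {1..k}" for i unfolding I_def using that by (rule if_P)
        have I: "I i \<in> sets age_law" for i
          unfolding I_def using B[of i] rational_box_sets[of k q i] by (auto simp: sets_age_law)
        have BR: "PiE {1..k} B \<in> sets ?R" by (rule box) (use B in simp)
        have IR: "PiE {1..k} I \<in> sets ?R" by (rule box) (use I in \<open>simp add: sets_age_law\<close>)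
        have BJ: "PiE {1..k} B \<inter> ?J = PiE {1..k} I" unfolding PiE_Int by (rule PiE_cong) (simp only: I_in)
        have ordered: "\<forall>i\<in>{1..k}. \<forall>j\<in>{1..k}. i < j \<longrightarrow> (\<forall>x\<in>I i. \<forall>y\<in>I j. x < y)"
        proof (intro ballI impI)
          fix i j x y assume ij: "i \<in> {1..k}" "j \<in> {1..k}" "i < j" and xy: "x \<in> I i" "y \<in> I j"
          show "x < y" by (rule rational_box_ordered[OF conjunct1[OF q] conjunct2[OF q] ij]) (use xy ij in \<open>simp_all only: I_in Int_iff\<close>)
        qed
        have mem: "a \<in> PiE {1..k} I \<longleftrightarrow> (\<forall>i\<in>{1..k}. a i \<in> I i)" if "a \<in> extensional {1..k}" for a
          using that by (simp only: PiE_def Pi_def Int_iff mem_Collect_eq Ball_def simp_thms)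
        have "emeasure ?\<mu> (PiE {1..k} I) = emeasure M {\<omega> \<in> ?S. \<forall>i\<in>{1..k}. ?ages \<omega> i \<in> I i}"
          unfolding \<mu>[OF IR] mem[OF sorted_ages_extensional] ..
        also have "\<dots> = (\<integral>\<^sup>+a. (\<Prod>i\<in>{1..k}. indicator (I i) (a i)) * ennreal (tree_density k T a) \<partial>?R)"
          by (rule ordered_box_law[OF ordered I k T])
        also have "\<dots> = (\<integral>\<^sup>+a. indicator (weak_chamber k) a * ennreal (tree_density k T a) * indicator (PiE {1..k} I) a \<partial>?R)"
        proof (rule nn_integral_cong)
          fix a assume a: "a \<in> space ?R"
          then have ext: "a \<in> extensional {1..k}" by (auto simp: space_PiM PiE_def)
          show "(\<Prod>i\<in>{1..k}. indicator (I i) (a i)) * ennreal (tree_density k T a) =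
              indicator (weak_chamber k) a * ennreal (tree_density k T a) * indicator (PiE {1..k} I) a"
          proof (cases "\<forall>i\<in>{1..k}. a i \<in> I i")
            case True
            then have p: "(\<Prod>i\<in>{1..k}. indicator (I i) (a i) :: ennreal) = 1"
              by (intro prod.neutral ballI) (simp only: indicator_simps)
            have "0 \<le> a i" if i: "i \<in> {1..k}" for i
            proof -
              have "a i \<in> I i" using True i by blast
              then show ?thesis using i by (simp only: I_in Int_iff rational_box_def atLeast_iff)
            qed
            moreover have "a i < a j" if "i \<in> {1..k}" "j \<in> {1..k}" "i < j" for i j
              using ordered True that by blast
            ultimately have "a \<in> weak_chamber k" using a unfolding weak_chamber_def by blast
            moreover have "a \<in> PiE {1..k} I" using mem[OF ext] True by blast
            ultimately show ?thesis unfolding p by (simp only: indicator_simps mult_1 mult_1_right)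
          next
            case False
            then obtain i where i: "i \<in> {1..k}" "a i \<notin> I i" by blast
            then have p: "(\<Prod>i\<in>{1..k}. indicator (I i) (a i) :: ennreal) = 0"
              by (intro prod_zero bexI[of _ i] finite_atLeastAtMost) simp_all
            have "a \<notin> PiE {1..k} I" using mem[OF ext] False by blast
            then show ?thesis unfolding p by simp
          qed
        qed
        also have "\<dots> = emeasure ?\<nu> (PiE {1..k} I)" by (rule \<nu>[OF IR, symmetric])
        finally show "emeasure (density ?\<mu> (indicator ?J)) (PiE {1..k} B) = emeasure (density ?\<nu> (indicator ?J)) (PiE {1..k} B)"
          unfolding restr[OF setsS(1) BR] restr[OF setsS(2) BR] BJ .
      next
        show "range (\<lambda>_::nat. space ?R) \<subseteq> prod_algebra {1..k} (\<lambda>_. lborel)"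
          by (auto simp: space_PiM intro!: prod_algebraI_finite)
        show "(\<Union>i::nat. space ?R) = space ?R" by simp
        show "emeasure (density ?\<mu> (indicator ?J)) (space ?R) \<noteq> \<infinity>" for i :: nat
          unfolding restr[OF setsS(1) sets.top] using \<mu>[of "space ?R \<inter> ?J"] J by simp
      qed simp
      then have "emeasure (density ?\<mu> (indicator ?J)) A = emeasure (density ?\<nu> (indicator ?J)) A" by (rule arg_cong)
      moreover have "A \<inter> ?J = A" using AJ by blast
      ultimately show ?thesis unfolding restr[OF setsS(1) A] restr[OF setsS(2) A] by simp
    qed
  qed
qed

end

section \<open>The density of the ages\<close>

definition ages_density :: "nat \<Rightarrow> (nat \<Rightarrow> real) \<Rightarrow> real" where
  "ages_density k a = indicator (age_chamber k) a * ((1 / 2) ^ k *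
     (\<Prod>j=1..k-1. real (k - j + 1) * a j + (\<Sum>m=1..j-1. a m)) * (\<Prod>i=1..k. exp (- a i)))"

lemma age_chamber_iff:
  assumes "a \<in> space (age_space k)"
  shows "a \<in> age_chamber k \<longleftrightarrow> a \<in> weak_chamber k \<and> (\<forall>i\<in>{1..k}. 0 < a i)"
proof
  assume a: "a \<in> age_chamber k"
  then have "\<forall>i\<in>{1..k}. 0 < a i" "\<And>i j. i \<in> {1..k} \<Longrightarrow> j \<in> {1..k} \<Longrightarrow> i < j \<Longrightarrow> a i < a j"
    by (auto simp only: age_chamber_def mem_Collect_eq dest: strict_mono_onD)
  then show "a \<in> weak_chamber k \<and> (\<forall>i\<in>{1..k}. 0 < a i)"
    using assms unfolding weak_chamber_def by (auto simp: less_imp_le)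
next
  assume a: "a \<in> weak_chamber k \<and> (\<forall>i\<in>{1..k}. 0 < a i)"
  then have "strict_mono_on {1..k} a" unfolding weak_chamber_def by (intro strict_mono_onI) blast
  with a show "a \<in> age_chamber k" unfolding age_chamber_def by blast
qed

lemma measurable_indicator_age_chamber [measurable]:
  "(\<lambda>a. indicator (age_chamber k) a :: real) \<in> borel_measurable (age_space k)"
proof -
  have "Measurable.pred (age_space k) (\<lambda>a. \<forall>i\<in>{1..k}. 0 < a i)"
  proof (rule pred_intros_finite(3))
    fix i assume "i \<in> {1..k}"
    note [measurable] = measurable_age_coordinate[OF this]
    show "Measurable.pred (age_space k) (\<lambda>a. 0 < a i)" by measurable
  qed simp
  then have "weak_chamber k \<inter> {a \<in> space (age_space k). \<forall>i\<in>{1..k}. 0 < a i} \<in> sets (age_space k)"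
    by (intro sets.Int sets_weak_chamber) (simp only: pred_def)
  then have "(\<lambda>a. indicator (weak_chamber k \<inter> {a \<in> space (age_space k). \<forall>i\<in>{1..k}. 0 < a i}) a :: real)
      \<in> borel_measurable (age_space k)" by (rule borel_measurable_indicator)
  then show ?thesis
  proof (rule measurable_cong[THEN iffD1, rotated])
    fix a assume "a \<in> space (age_space k)"
    from age_chamber_iff[OF this] this
    show "indicator (weak_chamber k \<inter> {a \<in> space (age_space k). \<forall>i\<in>{1..k}. 0 < a i}) a = (indicator (age_chamber k) a :: real)"
      by (simp only: indicator_def Int_iff mem_Collect_eq simp_thms)
  qed
qed

lemma measurable_sum_ages [measurable]: "(\<lambda>a. \<Sum>i=1..k. a i) \<in> borel_measurable (age_space k)"
  by (rule borel_measurable_sum) (rule measurable_age_coordinate)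

lemma measurable_chamber_polynomial [measurable]:
  "(\<lambda>a. \<Prod>j=1..k-1. real (k - j + 1) * a j + (\<Sum>m=1..j-1. a m)) \<in> borel_measurable (age_space k)"
  by (intro borel_measurable_prod borel_measurable_add borel_measurable_times borel_measurable_const
      borel_measurable_sum measurable_age_coordinate) auto

lemma measurable_ages_density [measurable]: "ages_density k \<in> borel_measurable (age_space k)"
  unfolding ages_density_def by measurable

lemma chamber_polynomial_pos:
  assumes "a \<in> age_chamber k"
  shows "0 < (\<Prod>j=1..k-1. real (k - j + 1) * a j + (\<Sum>m=1..j-1. a m))"
proof (rule prod_pos)
  fix j assume j: "j \<in> {1..k-1}"
  have pos: "0 < a i" if "i \<in> {1..k}" for i using assms that by (simp add: age_chamber_def)
  have "0 < real (k - j + 1) * a j" using pos[of j] j by auto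
  moreover have "0 \<le> (\<Sum>m=1..j-1. a m)" using j by (intro sum_nonneg less_imp_le pos) auto
  ultimately show "0 < real (k - j + 1) * a j + (\<Sum>m=1..j-1. a m)" by linarith
qed

lemma ages_density_pos:
  assumes "a \<in> age_chamber k"
  shows "0 < ages_density k a"
proof -
  have "0 < (\<Prod>i=1..k. exp (- a i))" by (intro prod_pos) simp
  then show ?thesis using chamber_polynomial_pos[OF assms] assms by (simp add: ages_density_def)
qed

lemma tree_weight_nonneg:
  assumes "spanning_tree_on {1..k} T" "\<And>i. i \<in> {1..k} \<Longrightarrow> 0 \<le> a i"
  shows "0 \<le> tree_weight a T"
  unfolding tree_weight_def
proof (rule prod_nonneg)
  fix e assume "e \<in> T"
  then obtain x y where "e = {x, y}" "x \<in> {1..k}" "y \<in> {1..k}" using assms(1) unfolding spanning_tree_on_def by blast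
  then show "0 \<le> Min (a ` e)" using assms(2) by simp
qed

lemma sum_tree_weight_pos:
  assumes k: "1 \<le> k" and a: "a \<in> age_chamber k"
  shows "0 < (\<Sum>T | spanning_tree_on {1..k} T. tree_weight a T)"
    and "ages_density k a = real k * ((1 / 2) ^ k * (\<Prod>i=1..k. exp (- a i)) * (\<Sum>T | spanning_tree_on {1..k} T. tree_weight a T))"
proof -
  have pos: "0 < a i" if "i \<in> {1..k}" for i using a that by (simp add: age_chamber_def)
  have mono: "a i \<le> a j" if "1 \<le> i" "i \<le> j" "j \<le> k" for i j
    using a that strict_mono_onD[of "{1..k}" a i j] by (cases "i = j") (auto simp: age_chamber_def)
  have s: "real k * (\<Sum>T | spanning_tree_on {1..k} T. tree_weight a T) =
      (\<Prod>j=1..k-1. real (k - j + 1) * a j + (\<Sum>m=1..j-1. a m))"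
    by (rule sum_tree_weight[OF k]) (rule pos mono, assumption+)+
  have "0 < real k * (\<Sum>T | spanning_tree_on {1..k} T. tree_weight a T)"
    unfolding s by (rule chamber_polynomial_pos[OF a])
  then show "0 < (\<Sum>T | spanning_tree_on {1..k} T. tree_weight a T)" by (simp add: zero_less_mult_iff)
  show "ages_density k a = real k * ((1 / 2) ^ k * (\<Prod>i=1..k. exp (- a i)) * (\<Sum>T | spanning_tree_on {1..k} T. tree_weight a T))"
    unfolding ages_density_def s[symmetric] using a by (simp only: indicator_simps mult_1 mult_ac)
qed

lemma AE_first_age_nonzero:
  assumes k: "1 \<le> k"
  shows "AE a in age_space k. a 1 \<noteq> 0"
proof -
  interpret lb: product_sigma_finite "\<lambda>_::nat. lborel :: real measure" ..
  let ?N = "PiE {1..k} (\<lambda>i. if i = 1 then {0} else UNIV :: real set)"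
  have "emeasure (age_space k) ?N = (\<Prod>i\<in>{1..k}. emeasure lborel (if i = 1 then {0} else UNIV :: real set))"
    by (rule lb.emeasure_PiM) auto
  also have "\<dots> = 0" using k by (intro prod_zero bexI[of _ 1]) auto
  finally have "emeasure (age_space k) ?N = 0" .
  moreover have "?N \<in> sets (age_space k)" by (rule sets_PiM_I_finite) auto
  ultimately have "?N \<in> null_sets (age_space k)" by blast
  then show ?thesis
  proof (rule AE_I')
    show "{a \<in> space (age_space k). \<not> a 1 \<noteq> 0} \<subseteq> ?N" by (auto simp: space_PiM PiE_def)
  qed
qed

lemma AE_weak_chamber:
  assumes k: "1 \<le> k"
  shows "AE a in age_space k. a \<in> weak_chamber k \<longleftrightarrow> a \<in> age_chamber k"
  using AE_first_age_nonzero[OF k] AE_space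
proof eventually_elim
  case (elim a)
  have "0 < a i" if a: "a \<in> weak_chamber k" and i: "i \<in> {1..k}" for i
  proof -
    have "0 \<le> a 1" using a k by (simp add: weak_chamber_def)
    then have a1: "0 < a 1" using elim(1) by simp
    have "a 1 < a i" if "1 < i" using a i k that unfolding weak_chamber_def by auto
    then show ?thesis using a1 i by (cases "i = 1") auto
  qed
  then show ?case using age_chamber_iff[OF elim(2)] by blast
qed

text \<open>
Here the sum over spanning trees is evaluated by \<open>sum_tree_weight\<close>.
\<close>

lemma AE_ages_density:
  assumes k: "1 \<le> k"
  shows "AE a in age_space k. (\<Sum>T | spanning_tree_on {1..k} T. indicator (weak_chamber k) a * ennreal (tree_density k T a)) =
    ennreal (ages_density k a)"
  using AE_weak_chamber[OF k]
proof eventually_elim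
  case (elim a)
  show ?case
  proof (cases "a \<in> age_chamber k")
    case True
    then have pos: "0 \<le> a i" if "i \<in> {1..k}" for i using that by (simp add: age_chamber_def less_imp_le)
    have e: "0 \<le> (\<Prod>i=1..k. exp (- a i))" by (intro prod_nonneg) simp
    have "(\<Sum>T | spanning_tree_on {1..k} T. indicator (weak_chamber k) a * ennreal (tree_density k T a)) =
       (\<Sum>T | spanning_tree_on {1..k} T. ennreal (tree_density k T a))"
      using True elim by simp
    also have "\<dots> = ennreal (\<Sum>T | spanning_tree_on {1..k} T. tree_density k T a)"
    proof (rule sum_ennreal)
      fix T assume "T \<in> {T. spanning_tree_on {1..k} T}"
      then have "0 \<le> tree_weight a T" using tree_weight_nonneg[of k T a] pos by blast
      then show "0 \<le> tree_density k T a" unfolding tree_density_def by (intro mult_nonneg_nonneg e) simp_all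
    qed
    also have "(\<Sum>T | spanning_tree_on {1..k} T. tree_density k T a) = ages_density k a"
      unfolding sum_tree_weight_pos(2)[OF k True] tree_density_def by (simp only: sum_distrib_left)
    finally show ?thesis .
  next
    case False
    then have "a \<notin> weak_chamber k" using elim by blast
    with False show ?thesis by (simp add: ages_density_def)
  qed
qed

context age_galton_watson
begin

lemma nn_integral_tree_event:
  assumes k: "1 \<le> k" and T: "spanning_tree_on {1..k} T" and F: "F \<in> borel_measurable (age_space k)"
  shows "(\<integral>\<^sup>+\<omega>. F (sorted_ages k (H \<omega>)) * indicator (tree_event k T) \<omega> \<partial>M) =
    (\<integral>\<^sup>+a. F a * (indicator (weak_chamber k) a * ennreal (tree_density k T a)) \<partial>age_space k)"
proof -
  let ?S = "tree_event k T" and ?ages = "\<lambda>\<omega>. sorted_ages k (H \<omega>)"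
  have Fa: "(\<lambda>\<omega>. F (?ages \<omega>)) \<in> borel_measurable M" by (rule measurable_compose[OF measurable_sorted_ages F])
  have S: "(indicator ?S :: 'w \<Rightarrow> ennreal) \<in> borel_measurable M"
    by (rule borel_measurable_indicator[OF sets_tree_event[OF k T]])
  have d: "(\<lambda>a. indicator (weak_chamber k) a * ennreal (tree_density k T a)) \<in> borel_measurable (age_space k)"
    using measurable_tree_density[OF T] sets_weak_chamber[of k] by measurable
  have "(\<integral>\<^sup>+\<omega>. F (?ages \<omega>) * indicator ?S \<omega> \<partial>M) = (\<integral>\<^sup>+\<omega>. indicator ?S \<omega> * F (?ages \<omega>) \<partial>M)"
    by (simp only: mult.commute)
  also have "\<dots> = (\<integral>\<^sup>+\<omega>. F (?ages \<omega>) \<partial>density M (indicator ?S))"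
    by (rule nn_integral_density[symmetric, OF S Fa])
  also have "\<dots> = (\<integral>\<^sup>+a. F a \<partial>distr (density M (indicator ?S)) (age_space k) ?ages)"
    by (rule nn_integral_distr[symmetric]) (simp_all only: measurable_density_eq1 measurable_sorted_ages measurable_distr_eq1 F)
  also have "\<dots> = (\<integral>\<^sup>+a. indicator (weak_chamber k) a * ennreal (tree_density k T a) * F a \<partial>age_space k)"
    unfolding tree_event_law[OF k T] by (rule nn_integral_density[OF d F])
  finally show ?thesis by (simp only: mult.commute)
qed

lemma AE_tree_event:
  assumes k: "1 \<le> k"
  shows "AE \<omega> in M. \<omega> \<in> space M \<and> (card (dom (H \<omega>)) = k \<longleftrightarrow> \<omega> \<in> distinct_ages k) \<and>
    indicator {\<omega> \<in> space M. card (dom (H \<omega>)) = k} \<omega> = (\<Sum>T | spanning_tree_on {1..k} T. indicator (tree_event k T) \<omega> :: ennreal)"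
  using AE_distinct AE_space
proof eventually_elim
  case (elim \<omega>)
  then have iff: "card (dom (H \<omega>)) = k \<longleftrightarrow> \<omega> \<in> distinct_ages k" by (simp only: distinct_ages_def mem_Collect_eq simp_thms)
  have fin: "finite {T. spanning_tree_on {1..k} T}" by (rule finite_spanning_trees) simp
  have "indicator {\<omega> \<in> space M. card (dom (H \<omega>)) = k} \<omega> = (\<Sum>T | spanning_tree_on {1..k} T. indicator (tree_event k T) \<omega> :: ennreal)"
  proof (cases "\<omega> \<in> distinct_ages k")
    case True
    then obtain T where T: "spanning_tree_on {1..k} T" "\<omega> \<in> tree_event k T" using distinct_ages_props(3)[OF True k] by blast
    have "(\<Sum>T' | spanning_tree_on {1..k} T'. indicator (tree_event k T') \<omega> :: ennreal) = (\<Sum>T'\<in>{T}. indicator (tree_event k T') \<omega>)"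
    proof (rule sum.mono_neutral_right[OF fin])
      show "\<forall>T'\<in>{T. spanning_tree_on {1..k} T} - {T}. indicator (tree_event k T') \<omega> = (0 :: ennreal)"
      proof
        fix T' assume "T' \<in> {T. spanning_tree_on {1..k} T} - {T}"
        then have "\<omega> \<notin> tree_event k T'" using tree_event_unique[OF T(2) _ k T(1)] by blast
        then show "indicator (tree_event k T') \<omega> = (0 :: ennreal)" by simp
      qed
    qed (use T in simp)
    then show ?thesis using True T elim iff by simp
  next
    case False
    then have "indicator (tree_event k T) \<omega> = (0 :: ennreal)" for T by (simp add: tree_event_def)
    then show ?thesis using False iff by simp
  qed
  with iff elim show ?case by blast
qed

lemma nn_integral_card_event:
  assumes k: "1 \<le> k" and F: "F \<in> borel_measurable (age_space k)"
  shows "(\<integral>\<^sup>+\<omega>. F (sorted_ages k (H \<omega>)) * indicator {\<omega> \<in> space M. card (dom (H \<omega>)) = k} \<omega> \<partial>M) =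
    (\<integral>\<^sup>+a. F a * ennreal (ages_density k a) \<partial>age_space k)"
proof -
  let ?ST = "{T. spanning_tree_on {1..k} T}" and ?ages = "\<lambda>\<omega>. sorted_ages k (H \<omega>)"
  have Fa: "(\<lambda>\<omega>. F (?ages \<omega>)) \<in> borel_measurable M" by (rule measurable_compose[OF measurable_sorted_ages F])
  have "(\<integral>\<^sup>+\<omega>. F (?ages \<omega>) * indicator {\<omega> \<in> space M. card (dom (H \<omega>)) = k} \<omega> \<partial>M) =
     (\<integral>\<^sup>+\<omega>. (\<Sum>T\<in>?ST. F (?ages \<omega>) * indicator (tree_event k T) \<omega>) \<partial>M)"
    by (rule nn_integral_cong_AE) (use AE_tree_event[OF k] in eventually_elim, simp only: sum_distrib_left)
  also have "\<dots> = (\<Sum>T\<in>?ST. \<integral>\<^sup>+\<omega>. F (?ages \<omega>) * indicator (tree_event k T) \<omega> \<partial>M)"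
    by (rule nn_integral_sum) (intro borel_measurable_times_ennreal Fa borel_measurable_indicator sets_tree_event[OF k], simp)
  also have "\<dots> = (\<Sum>T\<in>?ST. \<integral>\<^sup>+a. F a * (indicator (weak_chamber k) a * ennreal (tree_density k T a)) \<partial>age_space k)"
    by (rule sum.cong[OF refl], rule nn_integral_tree_event[OF k _ F]) simp
  also have "\<dots> = (\<integral>\<^sup>+a. (\<Sum>T\<in>?ST. F a * (indicator (weak_chamber k) a * ennreal (tree_density k T a))) \<partial>age_space k)"
  proof (rule nn_integral_sum[symmetric])
    fix T assume "T \<in> ?ST"
    then have T: "spanning_tree_on {1..k} T" by simp
    show "(\<lambda>a. F a * (indicator (weak_chamber k) a * ennreal (tree_density k T a))) \<in> borel_measurable (age_space k)"
      using measurable_tree_density[OF T] sets_weak_chamber[of k] F by measurable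
  qed
  also have "\<dots> = (\<integral>\<^sup>+a. F a * ennreal (ages_density k a) \<partial>age_space k)"
    by (rule nn_integral_cong_AE) (use AE_ages_density[OF k] in eventually_elim, simp only: sum_distrib_left[symmetric])
  finally show ?thesis .
qed

lemma distributed_sorted_ages:
  assumes k: "1 \<le> k"
  defines "E \<equiv> {\<omega> \<in> space M. card (dom (H \<omega>)) = k}"
  shows "distributed (restrict_space M E) (age_space k) (\<lambda>\<omega>. sorted_ages k (H \<omega>)) (\<lambda>a. ennreal (ages_density k a))"
  unfolding distributed_def
proof (intro conjI)
  let ?ages = "\<lambda>\<omega>. sorted_ages k (H \<omega>)"
  have E: "E \<in> sets M" unfolding E_def by (rule sets_card_vertices[OF k])
  then have Esub: "E \<inter> space M \<in> sets M" "E \<subseteq> space M" using sets.sets_into_space[OF E] by simp_all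
  show m: "?ages \<in> measurable (restrict_space M E) (age_space k)"
    by (rule measurable_restrict_space1[OF measurable_sorted_ages])
  show "(\<lambda>a. ennreal (ages_density k a)) \<in> borel_measurable (age_space k)" by measurable
  show "distr (restrict_space M E) (age_space k) ?ages = density (age_space k) (\<lambda>a. ennreal (ages_density k a))"
  proof (rule measure_eqI)
    fix A assume "A \<in> sets (distr (restrict_space M E) (age_space k) ?ages)"
    then have A: "A \<in> sets (age_space k)" by simp
    have AM: "?ages -` A \<inter> space M \<in> sets M" by (rule measurable_sets[OF measurable_sorted_ages A])
    have eq: "?ages -` A \<inter> space (restrict_space M E) = (?ages -` A \<inter> space M) \<inter> E"
      using Esub by (auto simp: space_restrict_space)
    have "emeasure (distr (restrict_space M E) (age_space k) ?ages) A = emeasure (restrict_space M E) ((?ages -` A \<inter> space M) \<inter> E)"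
      using emeasure_distr[OF m A] unfolding eq .
    also have "\<dots> = emeasure M ((?ages -` A \<inter> space M) \<inter> E)"
      by (rule emeasure_restrict_space[OF Esub(1)]) simp
    also have "\<dots> = (\<integral>\<^sup>+\<omega>. indicator ((?ages -` A \<inter> space M) \<inter> E) \<omega> \<partial>M)"
      by (rule nn_integral_indicator[symmetric, OF sets.Int[OF AM E]])
    also have "\<dots> = (\<integral>\<^sup>+\<omega>. indicator A (?ages \<omega>) * indicator E \<omega> \<partial>M)"
      by (rule nn_integral_cong) (simp add: indicator_def)
    also have "\<dots> = (\<integral>\<^sup>+a. indicator A a * ennreal (ages_density k a) \<partial>age_space k)"
      unfolding E_def by (rule nn_integral_card_event[OF k borel_measurable_indicator[OF A]])
    also have "\<dots> = (\<integral>\<^sup>+a. ennreal (ages_density k a) * indicator A a \<partial>age_space k)" by (simp only: mult.commute)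
    also have "\<dots> = emeasure (density (age_space k) (\<lambda>a. ennreal (ages_density k a))) A"
      by (rule emeasure_density[symmetric, OF _ A]) measurable
    finally show "emeasure (distr (restrict_space M E) (age_space k) ?ages) A = emeasure (density (age_space k) (\<lambda>a. ennreal (ages_density k a))) A" .
  qed simp
qed

text \<open>
The density is positive on the chamber, which contains the box with sides \<open>(i, i + 1)\<close> of volume one.
\<close>

lemma emeasure_card_event_pos:
  assumes k: "1 \<le> k"
  shows "emeasure M {\<omega> \<in> space M. card (dom (H \<omega>)) = k} \<noteq> 0"
proof
  assume z: "emeasure M {\<omega> \<in> space M. card (dom (H \<omega>)) = k} = 0"
  interpret lb: product_sigma_finite "\<lambda>_::nat. lborel :: real measure" ..
  have "emeasure M {\<omega> \<in> space M. card (dom (H \<omega>)) = k} =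
      (\<integral>\<^sup>+\<omega>. 1 * indicator {\<omega> \<in> space M. card (dom (H \<omega>)) = k} \<omega> \<partial>M)"
    using nn_integral_indicator[OF sets_card_vertices[OF k]] by (simp only: mult_1)
  also have "\<dots> = (\<integral>\<^sup>+a. 1 * ennreal (ages_density k a) \<partial>age_space k)"
    by (rule nn_integral_card_event[OF k]) simp
  finally have "(\<integral>\<^sup>+a. ennreal (ages_density k a) \<partial>age_space k) = 0" using z by simp
  then have "AE a in age_space k. ennreal (ages_density k a) = 0"
    by (subst (asm) nn_integral_0_iff_AE) measurable
  let ?B = "PiE {1..k} (\<lambda>i. {real i <..< real (Suc i)})"
  have "?B \<subseteq> age_chamber k"
  proof
    fix a assume "a \<in> ?B"
    then have a: "real i < a i" "a i < real (Suc i)" if "i \<in> {1..k}" for i using that by (auto simp: PiE_def Pi_def)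
    have "0 < a i" if "i \<in> {1..k}" for i using a(1)[OF that] by linarith
    moreover have "strict_mono_on {1..k} a"
    proof (rule strict_mono_onI)
      fix i j assume ij: "i \<in> {1..k}" "j \<in> {1..k}" "i < j"
      then have "real (Suc i) \<le> real j" by simp
      with a(2)[OF ij(1)] a(1)[OF ij(2)] show "a i < a j" by linarith
    qed
    ultimately show "a \<in> age_chamber k" unfolding age_chamber_def by blast
  qed
  moreover have Bs: "?B \<in> sets (age_space k)" by (rule sets_PiM_I_finite) auto
  moreover have "AE a in age_space k. a \<notin> ?B"
    using \<open>AE a in age_space k. ennreal (ages_density k a) = 0\<close>
  proof eventually_elim
    case (elim a)
    then have "ages_density k a \<le> 0" by (simp add: ennreal_eq_0_iff)
    then have "a \<notin> age_chamber k" using ages_density_pos[of a k] by linarith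
    then show ?case using \<open>?B \<subseteq> age_chamber k\<close> by blast
  qed
  ultimately have "emeasure (age_space k) ?B = 0"
    using AE_iff_measurable[OF Bs, of "\<lambda>a. a \<notin> ?B"] sets.sets_into_space[OF Bs] by (simp add: Int_absorb1 Collect_conj_eq)
  moreover have "emeasure (age_space k) ?B = (\<Prod>i\<in>{1..k}. emeasure lborel {real i <..< real (Suc i)})"
    by (rule lb.emeasure_PiM) auto
  moreover have "\<dots> = 1" by (intro prod.neutral ballI) simp
  ultimately show False by simp
qed

end

section \<open>The sum of the ages\<close>

lemma age_space_scale:
  assumes t: "0 < t"
  shows "age_space k = density (distr (age_space k) (age_space k) (\<lambda>a. \<lambda>i\<in>{1..k}. t * a i)) (\<lambda>_. ennreal (t ^ k))"
proof -
  interpret lb: product_sigma_finite "\<lambda>_::nat. lborel :: real measure" ..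
  let ?sc = "\<lambda>a. \<lambda>i\<in>{1..k}. t * a i"
  have sc: "?sc \<in> measurable (age_space k) (age_space k)"
  proof (rule measurable_restrict)
    fix i assume "i \<in> {1..k}"
    note [measurable] = measurable_age_coordinate[OF this]
    show "(\<lambda>a. t * a i) \<in> measurable (age_space k) lborel" unfolding measurable_lborel1 by measurable
  qed
  have "density (distr (age_space k) (age_space k) ?sc) (\<lambda>_. ennreal (t ^ k)) = age_space k"
  proof (rule lb.PiM_eqI)
    show "sets (density (distr (age_space k) (age_space k) ?sc) (\<lambda>_. ennreal (t ^ k))) = age_space k" by simp
    fix A :: "nat \<Rightarrow> real set" assume A: "\<And>i. i \<in> {1..k} \<Longrightarrow> A i \<in> sets lborel"
    have box: "PiE {1..k} A \<in> sets (age_space k)" by (rule sets_PiM_I_finite) (use A in simp_all)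
    have pre: "?sc -` PiE {1..k} A \<inter> space (age_space k) = PiE {1..k} (\<lambda>i. (\<lambda>x. t * x) -` A i)"
      by (auto simp: space_PiM PiE_def Pi_def)
    have preA: "(\<lambda>x. t * x) -` A i \<in> sets lborel" if "i \<in> {1..k}" for i
    proof -
      have "A i \<in> sets borel" using A[OF that] by simp
      from measurable_sets[of "\<lambda>x. t * x" borel borel, OF _ this] show ?thesis by simp
    qed
    have one: "ennreal t * emeasure lborel ((\<lambda>x. t * x) -` A i) = emeasure lborel (A i)" if i: "i \<in> {1..k}" for i
    proof -
      have Ab: "A i \<in> sets borel" using A[OF i] by simp
      have "emeasure lborel (A i) = emeasure (density (distr lborel borel ((*) t)) (\<lambda>_. ennreal \<bar>t\<bar>)) (A i)"
        using lborel_distr_mult'[of t] t by simp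
      also have "\<dots> = ennreal \<bar>t\<bar> * emeasure (distr lborel borel ((*) t)) (A i)"
        by (rule emeasure_density_const) (use Ab in simp)
      also have "emeasure (distr lborel borel ((*) t)) (A i) = emeasure lborel ((*) t -` A i)"
        using Ab by (subst emeasure_distr) simp_all
      finally show ?thesis using t by simp
    qed
    have "emeasure (density (distr (age_space k) (age_space k) ?sc) (\<lambda>_. ennreal (t ^ k))) (PiE {1..k} A) =
        ennreal (t ^ k) * emeasure (distr (age_space k) (age_space k) ?sc) (PiE {1..k} A)"
      by (rule emeasure_density_const) (use box in \<open>simp only: sets_distr\<close>)
    also have "emeasure (distr (age_space k) (age_space k) ?sc) (PiE {1..k} A) = emeasure (age_space k) (PiE {1..k} (\<lambda>i. (\<lambda>x. t * x) -` A i))"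
      unfolding emeasure_distr[OF sc box] pre ..
    also have "\<dots> = (\<Prod>i\<in>{1..k}. emeasure lborel ((\<lambda>x. t * x) -` A i))"
      by (rule lb.emeasure_PiM[OF finite_atLeastAtMost preA])
    also have "ennreal (t ^ k) * \<dots> = (\<Prod>i\<in>{1..k}. ennreal t * emeasure lborel ((\<lambda>x. t * x) -` A i))"
      using t by (simp add: prod.distrib ennreal_power)
    also have "\<dots> = (\<Prod>i\<in>{1..k}. emeasure lborel (A i))" by (intro prod.cong refl one)
    finally show "emeasure (density (distr (age_space k) (age_space k) ?sc) (\<lambda>_. ennreal (t ^ k))) (PiE {1..k} A) = (\<Prod>i\<in>{1..k}. emeasure lborel (A i))" .
  qed simp
  then show ?thesis ..
qed

lemma nn_integral_age_space_scale:
  assumes t: "0 < t" and F: "F \<in> borel_measurable (age_space k)"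
  shows "(\<integral>\<^sup>+a. F a \<partial>age_space k) = ennreal (t ^ k) * (\<integral>\<^sup>+a. F (\<lambda>i\<in>{1..k}. t * a i) \<partial>age_space k)"
proof -
  let ?sc = "\<lambda>a. \<lambda>i\<in>{1..k}. t * a i" and ?R = "age_space k"
  have sc: "?sc \<in> measurable ?R ?R"
  proof (rule measurable_restrict)
    fix i assume "i \<in> {1..k}"
    note [measurable] = measurable_age_coordinate[OF this]
    show "(\<lambda>a. t * a i) \<in> measurable ?R lborel" unfolding measurable_lborel1 by measurable
  qed
  have F': "F \<in> borel_measurable (distr ?R ?R ?sc)" using F by (simp only: measurable_distr_eq1)
  have "(\<integral>\<^sup>+a. F a \<partial>?R) = (\<integral>\<^sup>+a. F a \<partial>density (distr ?R ?R ?sc) (\<lambda>_. ennreal (t ^ k)))"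
    by (rule arg_cong[OF age_space_scale[OF t]])
  also have "\<dots> = (\<integral>\<^sup>+a. ennreal (t ^ k) * F a \<partial>distr ?R ?R ?sc)"
    by (rule nn_integral_density) (simp, rule F')
  also have "\<dots> = ennreal (t ^ k) * (\<integral>\<^sup>+a. F a \<partial>distr ?R ?R ?sc)" by (rule nn_integral_cmult[OF F'])
  also have "(\<integral>\<^sup>+a. F a \<partial>distr ?R ?R ?sc) = (\<integral>\<^sup>+a. F (?sc a) \<partial>?R)" by (rule nn_integral_distr[OF sc F'])
  finally show ?thesis .
qed

lemma emeasure_power_density:
  assumes "0 \<le> t"
  shows "(\<integral>\<^sup>+x. ennreal (real (Suc n) * x ^ n * indicator {0..} x) * indicator {..t} x \<partial>lborel) = ennreal (t ^ Suc n)"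
proof -
  have "(\<integral>\<^sup>+x. ennreal (real (Suc n) * x ^ n * indicator {0..} x) * indicator {..t} x \<partial>lborel) =
     (\<integral>\<^sup>+x. ennreal (real (Suc n) * x ^ n) * indicator {0..t} x \<partial>lborel)"
    by (intro nn_integral_cong) (auto split: split_indicator)
  also have "\<dots> = ennreal (t ^ Suc n - 0 ^ Suc n)"
  proof (rule nn_integral_FTC_Icc)
    fix x :: real
    show "((\<lambda>x. x ^ Suc n) has_real_derivative real (Suc n) * x ^ n) (at x)"
      using DERIV_pow[of "Suc n" x UNIV] by (simp del: power_Suc)
  qed (use assms in auto)
  finally show ?thesis by simp
qed

lemma erlang_density_as_power:
  "ennreal (exp (- x)) * ennreal (real (Suc n) * x ^ n * indicator {0..} x) = ennreal (fact (Suc n)) * ennreal (erlang_density n 1 x)"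
proof -
  have "ennreal (exp (- x)) * ennreal (real (Suc n) * x ^ n * indicator {0..} x) =
      ennreal (exp (- x) * (real (Suc n) * x ^ n * indicator {0..} x))"
    by (rule ennreal_mult'[symmetric]) simp
  also have "exp (- x) * (real (Suc n) * x ^ n * indicator {0..} x) = fact (Suc n) * erlang_density n 1 x"
    by (simp add: erlang_density_def indicator_def)
  also have "ennreal \<dots> = ennreal (fact (Suc n)) * ennreal (erlang_density n 1 x)"
    by (rule ennreal_mult') simp
  finally show ?thesis .
qed

text \<open>
Let \<open>\<rho>\<close> be the image under the sum of the measure with density \<open>g\<close>.  Scaling by \<open>t\<close> multiplies Lebesgue measure by
\<open>t\<^sup>k\<close> and \<open>g\<close> by \<open>t\<^sup>l\<close>, so \<open>\<rho>\<close> gives the half-line up to \<open>t\<close> the mass \<open>C t\<^sup>k\<^sup>+\<^sup>l\<close>.  Hence \<open>\<rho>\<close> has a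
density proportional to \<open>x\<^sup>n\<close>, and the exponential factor depends on the sum only.  The factor makes the integral
finite, which is what bounds \<open>C\<close>.
\<close>

lemma homogeneous_sum_law:
  fixes g :: "(nat \<Rightarrow> real) \<Rightarrow> real"
  assumes g: "g \<in> borel_measurable (age_space k)" "\<And>a. 0 \<le> g a"
    and hom: "\<And>t a. 0 < t \<Longrightarrow> g (\<lambda>i\<in>{1..k}. t * a i) = t ^ l * g a"
    and supp: "\<And>a. g a \<noteq> 0 \<Longrightarrow> 0 < (\<Sum>i=1..k. a i)"
    and n: "Suc n = k + l"
    and fin: "(\<integral>\<^sup>+a. ennreal (exp (- (\<Sum>i=1..k. a i)) * g a) \<partial>age_space k) < \<infinity>"
  shows "\<exists>c. \<forall>B\<in>sets borel. (\<integral>\<^sup>+a. indicator B (\<Sum>i=1..k. a i) * ennreal (exp (- (\<Sum>i=1..k. a i)) * g a) \<partial>age_space k) =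
     c * (\<integral>\<^sup>+x. ennreal (erlang_density n 1 x) * indicator B x \<partial>lborel)"
proof -
  let ?R = "age_space k" and ?s = "\<lambda>a::nat \<Rightarrow> real. \<Sum>i=1..k. a i"
  let ?pow = "\<lambda>x::real. ennreal (real (Suc n) * x ^ n * indicator {0..} x)"
  define \<rho> where "\<rho> = distr (density ?R (\<lambda>a. ennreal (g a))) borel ?s"
  define C where "C = (\<integral>\<^sup>+a. ennreal (g a) * indicator {..1} (?s a) \<partial>?R)"
  have gm: "(\<lambda>a. ennreal (g a)) \<in> borel_measurable ?R" using g(1) by measurable
  have sm: "?s \<in> borel_measurable ?R" by (rule measurable_sum_ages)
  have sets\<rho>: "sets \<rho> = sets borel" by (simp add: \<rho>_def)
  have int\<rho>: "(\<integral>\<^sup>+x. F x \<partial>\<rho>) = (\<integral>\<^sup>+a. ennreal (g a) * F (?s a) \<partial>?R)" if F: "F \<in> borel_measurable borel" for F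
  proof -
    have "(\<integral>\<^sup>+x. F x \<partial>\<rho>) = (\<integral>\<^sup>+a. F (?s a) \<partial>density ?R (\<lambda>a. ennreal (g a)))"
      unfolding \<rho>_def by (rule nn_integral_distr) (simp_all only: measurable_density_eq1 sm measurable_distr_eq1 F)
    also have "\<dots> = (\<integral>\<^sup>+a. ennreal (g a) * F (?s a) \<partial>?R)"
      by (rule nn_integral_density[OF gm measurable_compose[OF sm F]])
    finally show ?thesis .
  qed
  have cdf: "emeasure \<rho> {..t} = (\<integral>\<^sup>+a. ennreal (g a) * indicator {..t} (?s a) \<partial>?R)" for t
  proof -
    have "emeasure \<rho> {..t} = (\<integral>\<^sup>+x. indicator {..t} x \<partial>\<rho>)" by (rule nn_integral_indicator[symmetric]) (simp add: sets\<rho>)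
    also have "\<dots> = (\<integral>\<^sup>+a. ennreal (g a) * indicator {..t} (?s a) \<partial>?R)" by (rule int\<rho>) simp
    finally show ?thesis .
  qed
  have cdf_pos: "emeasure \<rho> {..t} = C * ennreal (t ^ Suc n)" if t: "0 < t" for t
  proof -
    have m: "(\<lambda>a. ennreal (g a) * indicator {..t} (?s a)) \<in> borel_measurable ?R"
      using gm sm by measurable
    have "emeasure \<rho> {..t} = ennreal (t ^ k) * (\<integral>\<^sup>+a. ennreal (g (\<lambda>i\<in>{1..k}. t * a i)) * indicator {..t} (?s (\<lambda>i\<in>{1..k}. t * a i)) \<partial>?R)"
      unfolding cdf by (rule nn_integral_age_space_scale[OF t m])
    also have "(\<integral>\<^sup>+a. ennreal (g (\<lambda>i\<in>{1..k}. t * a i)) * indicator {..t} (?s (\<lambda>i\<in>{1..k}. t * a i)) \<partial>?R) =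
       (\<integral>\<^sup>+a. ennreal (t ^ l) * (ennreal (g a) * indicator {..1} (?s a)) \<partial>?R)"
    proof (rule nn_integral_cong)
      fix a
      have "?s (\<lambda>i\<in>{1..k}. t * a i) = t * ?s a" by (simp add: sum_distrib_left)
      moreover have "t * ?s a \<le> t \<longleftrightarrow> ?s a \<le> 1" using t by simp
      ultimately have "(indicator {..t} (?s (\<lambda>i\<in>{1..k}. t * a i)) :: ennreal) = indicator {..1} (?s a)"
        by (simp only: indicator_def atMost_iff)
      moreover have "ennreal (g (\<lambda>i\<in>{1..k}. t * a i)) = ennreal (t ^ l) * ennreal (g a)"
        unfolding hom[OF t] using t by (intro ennreal_mult') simp
      ultimately show "ennreal (g (\<lambda>i\<in>{1..k}. t * a i)) * indicator {..t} (?s (\<lambda>i\<in>{1..k}. t * a i)) =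
          ennreal (t ^ l) * (ennreal (g a) * indicator {..1} (?s a))" by (simp only: mult.assoc)
    qed
    also have "\<dots> = ennreal (t ^ l) * C"
      unfolding C_def by (rule nn_integral_cmult) (use gm sm in measurable)
    also have "ennreal (t ^ k) * (ennreal (t ^ l) * C) = C * ennreal (t ^ Suc n)"
      using t by (simp add: n power_add ennreal_mult' mult_ac del: power_Suc)
    finally show ?thesis .
  qed
  have cdf_neg: "emeasure \<rho> {..t} = 0" if t: "t \<le> 0" for t
  proof -
    have zero: "ennreal (g a) * indicator {..t} (?s a) = 0" for a
      using supp[of a] t by (cases "g a = 0") (auto simp: indicator_def)
    show ?thesis unfolding cdf zero by simp
  qed
  have C_fin: "C < \<infinity>"
  proof -
    have "C \<le> (\<integral>\<^sup>+a. ennreal (exp 1) * ennreal (exp (- ?s a) * g a) \<partial>?R)"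
      unfolding C_def
    proof (rule nn_integral_mono)
      fix a
      show "ennreal (g a) * indicator {..1} (?s a) \<le> ennreal (exp 1) * ennreal (exp (- ?s a) * g a)"
      proof (cases "?s a \<le> 1")
        case True
        have "1 * g a \<le> exp (1 - ?s a) * g a" using True g(2) by (intro mult_right_mono) auto
        also have "\<dots> = exp 1 * (exp (- ?s a) * g a)" by (simp add: exp_diff exp_minus field_simps)
        finally have "ennreal (g a) \<le> ennreal (exp 1 * (exp (- ?s a) * g a))" by (intro ennreal_leI) simp
        then show ?thesis using True by (simp add: ennreal_mult' indicator_def)
      qed (simp add: indicator_def)
    qed
    also have "\<dots> = ennreal (exp 1) * (\<integral>\<^sup>+a. ennreal (exp (- ?s a) * g a) \<partial>?R)"
      by (rule nn_integral_cmult) (use g(1) sm in measurable)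
    also have "\<dots> < \<infinity>" using fin by (simp add: ennreal_mult_less_top)
    finally show ?thesis .
  qed
  have "\<rho> = density lborel (\<lambda>x. C * ?pow x)"
  proof (rule measure_eqI_generator_eq[where E = "range atMost" and \<Omega> = UNIV and A = "\<lambda>i. {..real i}"])
    show "Int_stable (range (atMost :: real \<Rightarrow> real set))" by (auto simp: Int_stable_def)
    fix X :: "real set" assume "X \<in> range atMost"
    then obtain t where X: "X = {..t}" by blast
    have D: "emeasure (density lborel (\<lambda>x. C * ?pow x)) {..t} = C * (\<integral>\<^sup>+x. ?pow x * indicator {..t} x \<partial>lborel)"
    proof -
      have "emeasure (density lborel (\<lambda>x. C * ?pow x)) {..t} = (\<integral>\<^sup>+x. C * ?pow x * indicator {..t} x \<partial>lborel)"
        by (rule emeasure_density) simp_all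
      also have "\<dots> = (\<integral>\<^sup>+x. C * (?pow x * indicator {..t} x) \<partial>lborel)" by (simp only: mult.assoc)
      also have "\<dots> = C * (\<integral>\<^sup>+x. ?pow x * indicator {..t} x \<partial>lborel)" by (rule nn_integral_cmult) simp
      finally show ?thesis .
    qed
    show "emeasure \<rho> X = emeasure (density lborel (\<lambda>x. C * ?pow x)) X"
    proof (cases "0 < t")
      case True
      then show ?thesis unfolding X D cdf_pos[OF True] by (simp only: emeasure_power_density less_imp_le)
    next
      case False
      have "AE x in lborel. ?pow x * indicator {..t} x = 0"
        using AE_lborel_singleton[of 0] by eventually_elim (use False in \<open>auto simp: indicator_def\<close>)
      then have "(\<integral>\<^sup>+x. ?pow x * indicator {..t} x \<partial>lborel) = (\<integral>\<^sup>+x. 0 \<partial>(lborel :: real measure))" by (rule nn_integral_cong_AE)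
      then show ?thesis unfolding X D using cdf_neg[of t] False by simp
    qed
  next
    have "sets (borel :: real measure) = sets (sigma UNIV (range atMost))" by (rule arg_cong[OF borel_eq_atMost])
    also have "\<dots> = sigma_sets UNIV (range atMost)" by (rule sets_measure_of) simp
    finally have b: "sets (borel :: real measure) = sigma_sets UNIV (range atMost)" .
    show "sets \<rho> = sigma_sets UNIV (range atMost)" using b sets\<rho> by simp
    show "sets (density lborel (\<lambda>x. C * ?pow x)) = sigma_sets UNIV (range atMost)" using b by simp
    show "(\<Union>i. {..real i}) = UNIV" using real_arch_simple by auto
    show "emeasure \<rho> {..real i} \<noteq> \<infinity>" for i
    proof (cases "i = 0")
      case False
      then show ?thesis using cdf_pos[of "real i"] C_fin by (simp add: ennreal_mult_eq_top_iff less_top[symmetric])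
    qed (simp add: cdf_neg)
  qed auto
  note \<rho>_eq = this
  have "(\<integral>\<^sup>+a. indicator B (?s a) * ennreal (exp (- ?s a) * g a) \<partial>?R) =
      C * ennreal (fact (Suc n)) * (\<integral>\<^sup>+x. ennreal (erlang_density n 1 x) * indicator B x \<partial>lborel)" if B: "B \<in> sets borel" for B
  proof -
    have "(\<integral>\<^sup>+a. indicator B (?s a) * ennreal (exp (- ?s a) * g a) \<partial>?R) =
       (\<integral>\<^sup>+a. ennreal (g a) * (indicator B (?s a) * ennreal (exp (- ?s a))) \<partial>?R)"
    proof (rule nn_integral_cong)
      fix a
      have "ennreal (exp (- ?s a) * g a) = ennreal (exp (- ?s a)) * ennreal (g a)" by (rule ennreal_mult') simp
      then show "indicator B (?s a) * ennreal (exp (- ?s a) * g a) = ennreal (g a) * (indicator B (?s a) * ennreal (exp (- ?s a)))"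
        by (simp only: mult_ac)
    qed
    also have "\<dots> = (\<integral>\<^sup>+x. indicator B x * ennreal (exp (- x)) \<partial>\<rho>)"
      by (rule int\<rho>[symmetric]) (use B in measurable)
    also have "\<dots> = (\<integral>\<^sup>+x. C * ?pow x * (indicator B x * ennreal (exp (- x))) \<partial>lborel)"
      unfolding \<rho>_eq by (rule nn_integral_density) (use B in measurable)
    also have "\<dots> = (\<integral>\<^sup>+x. C * ennreal (fact (Suc n)) * (ennreal (erlang_density n 1 x) * indicator B x) \<partial>lborel)"
    proof (rule nn_integral_cong)
      fix x :: real
      have "C * ?pow x * (indicator B x * ennreal (exp (- x))) = C * (ennreal (exp (- x)) * ?pow x) * indicator B x"
        by (simp only: mult_ac)
      then show "C * ?pow x * (indicator B x * ennreal (exp (- x))) = C * ennreal (fact (Suc n)) * (ennreal (erlang_density n 1 x) * indicator B x)"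
        unfolding erlang_density_as_power by (simp only: mult_ac)
    qed
    also have "\<dots> = C * ennreal (fact (Suc n)) * (\<integral>\<^sup>+x. ennreal (erlang_density n 1 x) * indicator B x \<partial>lborel)"
      by (rule nn_integral_cmult) (use B in measurable)
    finally show ?thesis .
  qed
  then show ?thesis by blast
qed

lemma ages_density_sum_law:
  assumes k: "1 \<le> k" and fin: "(\<integral>\<^sup>+a. ennreal (ages_density k a) \<partial>age_space k) < \<infinity>"
  shows "\<exists>c. \<forall>B\<in>sets borel. (\<integral>\<^sup>+a. indicator B (\<Sum>i=1..k. a i) * ennreal (ages_density k a) \<partial>age_space k) =
     c * (\<integral>\<^sup>+x. ennreal (erlang_density (2 * k - 2) 1 x) * indicator B x \<partial>lborel)"
proof -
  let ?poly = "\<lambda>a. \<Prod>j=1..k-1. real (k - j + 1) * a j + (\<Sum>m=1..j-1. a m)"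
  define g where "g a = indicator (age_chamber k) a * ((1 / 2) ^ k * ?poly a)" for a
  have dens: "ages_density k a = exp (- (\<Sum>i=1..k. a i)) * g a" for a
    by (simp add: ages_density_def g_def sum_negf[symmetric] exp_sum mult_ac)
  have chamber: "(\<lambda>i\<in>{1..k}. t * a i) \<in> age_chamber k \<longleftrightarrow> a \<in> age_chamber k" if t: "0 < t" for t a
    unfolding age_chamber_def strict_mono_on_def using t by (simp add: zero_less_mult_iff)
  have poly: "?poly (\<lambda>i\<in>{1..k}. t * a i) = t ^ (k - 1) * ?poly a" for t a
  proof -
    have "?poly (\<lambda>i\<in>{1..k}. t * a i) = (\<Prod>j=1..k-1. t * (real (k - j + 1) * a j + (\<Sum>m=1..j-1. a m)))"
    proof (rule prod.cong[OF refl])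
      fix j assume j: "j \<in> {1..k-1}"
      then have "(\<Sum>m=1..j-1. (\<lambda>i\<in>{1..k}. t * a i) m) = t * (\<Sum>m=1..j-1. a m)"
        unfolding sum_distrib_left by (intro sum.cong refl) auto
      moreover have "j \<in> {1..k}" using j by auto
      ultimately show "real (k - j + 1) * (\<lambda>i\<in>{1..k}. t * a i) j + (\<Sum>m=1..j-1. (\<lambda>i\<in>{1..k}. t * a i) m) =
         t * (real (k - j + 1) * a j + (\<Sum>m=1..j-1. a m))"
        by (simp add: algebra_simps)
    qed
    then show ?thesis by (simp add: prod.distrib)
  qed
  have "\<exists>c. \<forall>B\<in>sets borel. (\<integral>\<^sup>+a. indicator B (\<Sum>i=1..k. a i) * ennreal (exp (- (\<Sum>i=1..k. a i)) * g a) \<partial>age_space k) =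
     c * (\<integral>\<^sup>+x. ennreal (erlang_density (2 * k - 2) 1 x) * indicator B x \<partial>lborel)"
  proof (rule homogeneous_sum_law[where l = "k - 1"])
    show "g \<in> borel_measurable (age_space k)" unfolding g_def by measurable
    show "0 \<le> g a" for a using chamber_polynomial_pos[of a k] unfolding g_def by (cases "a \<in> age_chamber k") (simp_all add: less_imp_le)
    show "g (\<lambda>i\<in>{1..k}. t * a i) = t ^ (k - 1) * g a" if "0 < t" for t a
      unfolding g_def poly using chamber[OF that, of a] by (simp add: indicator_def)
    show "0 < (\<Sum>i=1..k. a i)" if "g a \<noteq> 0" for a
    proof (rule sum_pos)
      have "a \<in> age_chamber k" using that by (cases "a \<in> age_chamber k") (simp_all add: g_def)
      then show "0 < a i" if "i \<in> {1..k}" for i using that by (simp add: age_chamber_def)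
    qed (use k in simp_all)
    show "Suc (2 * k - 2) = k + (k - 1)" using k by simp
    show "(\<integral>\<^sup>+a. ennreal (exp (- (\<Sum>i=1..k. a i)) * g a) \<partial>age_space k) < \<infinity>" using fin unfolding dens .
  qed
  then show ?thesis unfolding dens .
qed

section \<open>The conditional law of the tree\<close>

context age_galton_watson
begin

lemma measurable_total_age [measurable]: "(\<lambda>\<omega>. \<Sum>u\<in>dom (H \<omega>). age u \<omega>) \<in> borel_measurable M"
proof (rule measurableI)
  fix B :: "real set" assume B: "B \<in> sets borel"
  let ?fin = "\<lambda>\<omega>. \<exists>us::nat list list. \<forall>u. u \<in> dom (H \<omega>) \<longleftrightarrow> u \<in> set us"
  let ?sum = "\<lambda>\<omega>. \<exists>us::nat list list. (\<forall>u. u \<in> dom (H \<omega>) \<longleftrightarrow> u \<in> set us) \<and> (\<Sum>u\<in>set us. age u \<omega>) \<in> B"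
  have iff: "(\<Sum>u\<in>dom (H \<omega>). age u \<omega>) \<in> B \<longleftrightarrow> ?sum \<omega> \<or> (\<not> ?fin \<omega> \<and> 0 \<in> B)" for \<omega>
  proof (cases "finite (dom (H \<omega>))")
    case True
    then have fin: "?fin \<omega>" unfolding finite_iff_list .
    have "?sum \<omega> \<longleftrightarrow> (\<Sum>u\<in>dom (H \<omega>). age u \<omega>) \<in> B"
    proof
      assume "?sum \<omega>"
      then obtain us where us: "\<forall>u. u \<in> dom (H \<omega>) \<longleftrightarrow> u \<in> set us" "(\<Sum>u\<in>set us. age u \<omega>) \<in> B" by blast
      then have "dom (H \<omega>) = set us" by blast
      with us(2) show "(\<Sum>u\<in>dom (H \<omega>). age u \<omega>) \<in> B" by (simp only:)
    next
      assume s: "(\<Sum>u\<in>dom (H \<omega>). age u \<omega>) \<in> B"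
      from fin obtain us where us: "\<forall>u. u \<in> dom (H \<omega>) \<longleftrightarrow> u \<in> set us" by blast
      then have "dom (H \<omega>) = set us" by blast
      with s have "(\<Sum>u\<in>set us. age u \<omega>) \<in> B" by (simp only:)
      with us show "?sum \<omega>" by blast
    qed
    then show ?thesis using fin by blast
  next
    case False
    then have nfin: "\<not> ?fin \<omega>" unfolding finite_iff_list .
    then have "\<not> ?sum \<omega>" by blast
    moreover have "(\<Sum>u\<in>dom (H \<omega>). age u \<omega>) = 0" using False by (rule sum.infinite)
    ultimately show ?thesis using nfin by (simp only: simp_thms)
  qed
  have "Measurable.pred M ?sum"
  proof (rule pred_intros_countable(2), rule pred_intros_logic(3))
    fix us :: "nat list list"
    have "(\<lambda>\<omega>. \<Sum>u\<in>set us. age u \<omega>) \<in> borel_measurable M" by (intro borel_measurable_sum measurable_age)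
    from measurable_sets[OF this B] show "Measurable.pred M (\<lambda>\<omega>. (\<Sum>u\<in>set us. age u \<omega>) \<in> B)"
      by (simp add: pred_def vimage_def Int_def conj_commute)
    show "Measurable.pred M (\<lambda>\<omega>. \<forall>u. u \<in> dom (H \<omega>) \<longleftrightarrow> u \<in> set us)" by measurable
  qed
  moreover have "Measurable.pred M ?fin" by measurable
  ultimately have "Measurable.pred M (\<lambda>\<omega>. ?sum \<omega> \<or> (\<not> ?fin \<omega> \<and> 0 \<in> B))" by measurable
  then show "(\<lambda>\<omega>. \<Sum>u\<in>dom (H \<omega>). age u \<omega>) -` B \<inter> space M \<in> sets M"
    unfolding iff[symmetric] by (simp only: pred_def vimage_def Int_def mem_Collect_eq conj_commute)
qed simp

lemma measurable_uniform_measure: "measurable (uniform_measure M A) K = measurable M K"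
  by (rule measurable_cong_sets) simp_all

lemma uniform_card_event:
  assumes k: "1 \<le> k"
  defines "E \<equiv> {\<omega> \<in> space M. card (dom (H \<omega>)) = k}"
  shows "E \<in> sets M" "emeasure M E \<noteq> 0" "emeasure M E \<noteq> \<infinity>" "prob_space (uniform_measure M E)"
proof -
  show E: "E \<in> sets M" unfolding E_def by (rule sets_card_vertices[OF k])
  show nz: "emeasure M E \<noteq> 0" unfolding E_def by (rule emeasure_card_event_pos[OF k])
  show fin: "emeasure M E \<noteq> \<infinity>" by simp
  show "prob_space (uniform_measure M E)" by (rule prob_space_uniform_measure[OF nz fin])
qed

lemma distributed_total_age:
  assumes k: "1 \<le> k"
  defines "E \<equiv> {\<omega> \<in> space M. card (dom (H \<omega>)) = k}"
  shows "distributed (uniform_measure M E) lborel (\<lambda>\<omega>. \<Sum>u\<in>dom (H \<omega>). age u \<omega>)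
    (\<lambda>x. ennreal (erlang_density (2 * k - 2) 1 x))"
  unfolding distributed_def
proof (intro conjI)
  let ?S = "\<lambda>\<omega>. \<Sum>u\<in>dom (H \<omega>). age u \<omega>" and ?n = "2 * k - 2"
  note E = uniform_card_event[OF k, folded E_def]
  show "(\<lambda>x. ennreal (erlang_density ?n 1 x)) \<in> borel_measurable lborel" by simp
  show S: "?S \<in> measurable (uniform_measure M E) lborel"
    unfolding measurable_lborel1 measurable_uniform_measure by (rule measurable_total_age)
  have total: "(\<integral>\<^sup>+a. ennreal (ages_density k a) \<partial>age_space k) = emeasure M E"
  proof -
    have "emeasure M E = (\<integral>\<^sup>+\<omega>. 1 * indicator E \<omega> \<partial>M)" using nn_integral_indicator[OF E(1)] by (simp only: mult_1)
    also have "\<dots> = (\<integral>\<^sup>+a. 1 * ennreal (ages_density k a) \<partial>age_space k)"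
      unfolding E_def by (rule nn_integral_card_event[OF k]) simp
    finally show ?thesis by (simp only: mult_1)
  qed
  then have "(\<integral>\<^sup>+a. ennreal (ages_density k a) \<partial>age_space k) < \<infinity>" using E(3) unfolding infinity_ennreal_def less_top by (simp only:)
  from ages_density_sum_law[OF k this] obtain c where
    c: "\<And>B. B \<in> sets borel \<Longrightarrow> (\<integral>\<^sup>+a. indicator B (\<Sum>i=1..k. a i) * ennreal (ages_density k a) \<partial>age_space k) =
       c * (\<integral>\<^sup>+x. ennreal (erlang_density ?n 1 x) * indicator B x \<partial>lborel)" by blast
  have erlang: "emeasure (density lborel (\<lambda>x. ennreal (erlang_density ?n 1 x))) B =
      (\<integral>\<^sup>+x. ennreal (erlang_density ?n 1 x) * indicator B x \<partial>lborel)" if "B \<in> sets borel" for B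
    by (rule emeasure_density) (use that in simp_all)
  have "emeasure (density lborel (\<lambda>x. ennreal (erlang_density ?n 1 x))) UNIV = 1"
    using prob_space.emeasure_space_1[OF prob_space_erlang_density[of 1 ?n]] by simp
  \<comment> \<open>Taking the whole line identifies the constant, since the Gamma density integrates to one.\<close>
  then have "emeasure M E = c"
    using c[of UNIV] erlang[of UNIV] total by simp
  have law: "emeasure M (E \<inter> (?S -` B \<inter> space M)) = emeasure M E * (\<integral>\<^sup>+x. ennreal (erlang_density ?n 1 x) * indicator B x \<partial>lborel)"
    if B: "B \<in> sets borel" for B
  proof -
    have SB: "?S -` B \<inter> space M \<in> sets M" by (rule measurable_sets[OF measurable_total_age B])
    have "emeasure M (E \<inter> (?S -` B \<inter> space M)) = (\<integral>\<^sup>+\<omega>. indicator (E \<inter> (?S -` B \<inter> space M)) \<omega> \<partial>M)"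
      by (rule nn_integral_indicator[symmetric, OF sets.Int[OF E(1) SB]])
    also have "\<dots> = (\<integral>\<^sup>+\<omega>. indicator B (\<Sum>i=1..k. sorted_ages k (H \<omega>) i) * indicator E \<omega> \<partial>M)"
    proof (rule nn_integral_cong_AE)
      show "AE \<omega> in M. indicator (E \<inter> (?S -` B \<inter> space M)) \<omega> =
          (indicator B (\<Sum>i=1..k. sorted_ages k (H \<omega>) i) * indicator E \<omega> :: ennreal)"
        using AE_tree_event[OF k]
      proof eventually_elim
        case (elim \<omega>)
        show ?case
        proof (cases "\<omega> \<in> E")
          case True
          then have "\<omega> \<in> distinct_ages k" using elim by (simp add: E_def)
          from distinct_ages_props(2)[OF this k] True elim show ?thesis by (simp add: indicator_def)
        qed (simp add: indicator_def)
      qed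
    qed
    also have "\<dots> = (\<integral>\<^sup>+a. indicator B (\<Sum>i=1..k. a i) * ennreal (ages_density k a) \<partial>age_space k)"
      unfolding E_def
      by (rule nn_integral_card_event[OF k measurable_compose[OF measurable_sum_ages borel_measurable_indicator[OF B]]])
    finally show ?thesis unfolding c[OF B] \<open>emeasure M E = c\<close> .
  qed
  show "distr (uniform_measure M E) lborel ?S = density lborel (\<lambda>x. ennreal (erlang_density ?n 1 x))"
  proof (rule measure_eqI)
    fix B assume "B \<in> sets (distr (uniform_measure M E) lborel ?S)"
    then have B: "B \<in> sets borel" by simp
    then have B': "B \<in> sets lborel" by simp
    have SB: "?S -` B \<inter> space M \<in> sets M" by (rule measurable_sets[OF measurable_total_age B])
    have "emeasure (distr (uniform_measure M E) lborel ?S) B = emeasure (uniform_measure M E) (?S -` B \<inter> space M)"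
      using emeasure_distr[OF S B'] by (simp only: space_uniform_measure)
    also have "\<dots> = emeasure M (E \<inter> (?S -` B \<inter> space M)) / emeasure M E"
      by (rule emeasure_uniform_measure[OF E(1) SB])
    also have "\<dots> = (\<integral>\<^sup>+x. ennreal (erlang_density ?n 1 x) * indicator B x \<partial>lborel)"
      unfolding law[OF B] mult.commute[of "emeasure M E"]
      by (rule mult_divide_eq_ennreal[OF E(2)]) simp
    also have "\<dots> = emeasure (density lborel (\<lambda>x. ennreal (erlang_density ?n 1 x))) B" by (rule erlang[OF B, symmetric])
    finally show "emeasure (distr (uniform_measure M E) lborel ?S) B = emeasure (density lborel (\<lambda>x. ennreal (erlang_density ?n 1 x))) B" .
  qed simp
qed

text \<open>
Over an event that the ages lie in \<open>A'\<close>, the indicator integrates to the integral of \<open>tree_density k T\<close> over \<open>A'\<close>, and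
the ratio of tree weights integrates to that of the ratio times the density of the ages; the two integrands agree by
\<open>sum_tree_weight_pos\<close>.
\<close>

lemma conditional_tree_law:
  assumes k: "1 \<le> k" and T: "spanning_tree_on {1..k} T"
  defines "E \<equiv> {\<omega> \<in> space M. card (dom (H \<omega>)) = k}"
    and "F \<equiv> vimage_algebra (space M) (\<lambda>\<omega>. sorted_ages k (H \<omega>)) (age_space k)"
  shows "AE \<omega> in uniform_measure M E.
    real_cond_exp (uniform_measure M E) F
      (indicator {\<omega> \<in> space M. tree_edges (H \<omega>) = (\<lambda>e. sorted_ages k (H \<omega>) ` e) ` T}) \<omega> =
    tree_weight (sorted_ages k (H \<omega>)) T / (\<Sum>T' | spanning_tree_on {1..k} T'. tree_weight (sorted_ages k (H \<omega>)) T')"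
proof -
  let ?N = "uniform_measure M E" and ?ages = "\<lambda>\<omega>. sorted_ages k (H \<omega>)"
  let ?X = "{\<omega> \<in> space M. tree_edges (H \<omega>) = (\<lambda>e. sorted_ages k (H \<omega>) ` e) ` T}"
  let ?ST = "{T. spanning_tree_on {1..k} T}"
  define p where "p a = tree_weight a T / (\<Sum>T'\<in>?ST. tree_weight a T')" for a
  note E = uniform_card_event[OF k, folded E_def]
  interpret N: prob_space ?N by (rule E(4))
  have agesM: "?ages \<in> space M \<rightarrow> space (age_space k)"
    using measurable_space[OF measurable_sorted_ages] by blast
  have setsF: "sets F = {?ages -` A \<inter> space M | A. A \<in> sets (age_space k)}"
    unfolding F_def by (rule sets_vimage_algebra2[OF agesM])
  have sub: "subalgebra ?N F"
    unfolding subalgebra_def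
  proof
    show "space F = space ?N" by (simp add: F_def)
    show "sets F \<subseteq> sets ?N"
      unfolding setsF sets_uniform_measure using measurable_sets[OF measurable_sorted_ages] by blast
  qed
  interpret finite_measure_subalgebra ?N F by unfold_locales (rule sub)
  have finST: "finite ?ST" by (rule finite_spanning_trees) simp
  have p_meas: "p \<in> borel_measurable (age_space k)"
    unfolding p_def by (intro borel_measurable_divide borel_measurable_sum measurable_tree_weight T) simp
  have X: "?X \<in> sets M" by (rule sets_edges_event[OF T])
  have pF: "(\<lambda>\<omega>. p (?ages \<omega>)) \<in> borel_measurable F"
    unfolding F_def by (rule measurable_compose[OF measurable_vimage_algebra1[OF agesM] p_meas])
  have pM: "(\<lambda>\<omega>. p (?ages \<omega>)) \<in> borel_measurable M"
    by (rule measurable_compose[OF measurable_sorted_ages p_meas])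
  have p_bounds: "0 \<le> p a \<and> p a \<le> 1" if a: "a \<in> weak_chamber k" for a
  proof -
    have w: "0 \<le> tree_weight a T'" if "spanning_tree_on {1..k} T'" for T'
      using tree_weight_nonneg[OF that, of a] a unfolding weak_chamber_def by blast
    have "tree_weight a T \<le> (\<Sum>T'\<in>?ST. tree_weight a T')"
      using T w by (intro member_le_sum finST) auto
    moreover have "0 \<le> tree_weight a T" by (rule w[OF T])
    ultimately show ?thesis unfolding p_def by (auto simp: divide_le_eq_1)
  qed
  have AE_N: "AE \<omega> in ?N. \<omega> \<in> distinct_ages k"
  proof -
    have "AE \<omega> in M. \<omega> \<in> E \<longrightarrow> \<omega> \<in> distinct_ages k"
      using AE_tree_event[OF k] by eventually_elim (simp add: E_def)
    then show ?thesis by (rule AE_uniform_measureI[OF E(1)])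
  qed
  have AE_p: "AE \<omega> in ?N. 0 \<le> p (?ages \<omega>) \<and> p (?ages \<omega>) \<le> 1"
    using AE_N by eventually_elim (rule p_bounds[OF distinct_ages_props(1)[OF _ k]])
  have ip: "integrable ?N (\<lambda>\<omega>. p (?ages \<omega>))"
    by (rule N.integrable_const_bound[where B = 1]) (use AE_p pM in \<open>auto simp: measurable_uniform_measure\<close>)
  have iX: "integrable ?N (indicator ?X :: 'w \<Rightarrow> real)"
    using X by (intro integrable_real_indicator) (auto simp: less_top[symmetric])
  have key: "(\<integral>\<^sup>+\<omega>. ennreal (indicator ?X \<omega>) * indicator A \<omega> \<partial>?N) = (\<integral>\<^sup>+\<omega>. ennreal (p (?ages \<omega>)) * indicator A \<omega> \<partial>?N)"
    if A: "A \<in> sets F" for A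
  proof -
    obtain A' where A': "A' \<in> sets (age_space k)" "A = ?ages -` A' \<inter> space M" using A setsF by auto
    have AM: "A \<in> sets M" unfolding A'(2) by (rule measurable_sets[OF measurable_sorted_ages A'(1)])
    have mX: "(\<lambda>\<omega>. ennreal (indicator ?X \<omega>) * indicator A \<omega>) \<in> borel_measurable M" using X AM by measurable
    have mp: "(\<lambda>\<omega>. ennreal (p (?ages \<omega>)) * indicator A \<omega>) \<in> borel_measurable M" using pM AM by measurable
    have "(\<integral>\<^sup>+\<omega>. ennreal (indicator ?X \<omega>) * indicator A \<omega> * indicator E \<omega> \<partial>M) =
      (\<integral>\<^sup>+\<omega>. indicator A' (?ages \<omega>) * indicator (tree_event k T) \<omega> \<partial>M)"
    proof (rule nn_integral_cong_AE)
      show "AE \<omega> in M. ennreal (indicator ?X \<omega>) * indicator A \<omega> * indicator E \<omega> =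
          indicator A' (?ages \<omega>) * indicator (tree_event k T) \<omega>"
        using AE_tree_event[OF k]
      proof eventually_elim
        case (elim \<omega>)
        have "\<omega> \<in> tree_event k T \<longleftrightarrow> \<omega> \<in> ?X \<and> \<omega> \<in> E"
          using elim by (auto simp only: tree_event_def E_def mem_Collect_eq)
        moreover have "\<omega> \<in> A \<longleftrightarrow> ?ages \<omega> \<in> A'" using elim A'(2) by simp
        ultimately show ?case by (simp add: indicator_def)
      qed
    qed
    also have "\<dots> = (\<integral>\<^sup>+a. indicator A' a * (indicator (weak_chamber k) a * ennreal (tree_density k T a)) \<partial>age_space k)"
      by (rule nn_integral_tree_event[OF k T borel_measurable_indicator[OF A'(1)]])
    also have "\<dots> = (\<integral>\<^sup>+a. indicator A' a * ennreal (p a) * ennreal (ages_density k a) \<partial>age_space k)"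
    proof (rule nn_integral_cong_AE)
      show "AE a in age_space k. indicator A' a * (indicator (weak_chamber k) a * ennreal (tree_density k T a)) =
          indicator A' a * ennreal (p a) * ennreal (ages_density k a)"
        using AE_weak_chamber[OF k]
      proof eventually_elim
        case (elim a)
        show ?case
        proof (cases "a \<in> age_chamber k")
          case True
          then have "p a * ages_density k a = tree_density k T a"
            using sum_tree_weight_pos[OF k True] unfolding p_def tree_density_def by (simp only: sum_tree_weight_pos(2)[OF k True]) (simp add: field_simps)
          moreover have "0 \<le> p a" using p_bounds[of a] elim True by blast
          ultimately have "ennreal (p a) * ennreal (ages_density k a) = ennreal (tree_density k T a)"
            by (simp only: ennreal_mult'[symmetric])
          then show ?thesis using True elim by (simp add: mult.assoc)
        next
          case False
          then have "a \<notin> weak_chamber k" using elim by blast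
          then show ?thesis using False by (simp add: ages_density_def)
        qed
      qed
    qed
    also have "\<dots> = (\<integral>\<^sup>+\<omega>. indicator A' (?ages \<omega>) * ennreal (p (?ages \<omega>)) * indicator E \<omega> \<partial>M)"
      unfolding E_def
      by (rule nn_integral_card_event[OF k, symmetric])
        (intro borel_measurable_times_ennreal borel_measurable_indicator A'(1) measurable_compose[OF p_meas] measurable_ennreal)
    also have "\<dots> = (\<integral>\<^sup>+\<omega>. ennreal (p (?ages \<omega>)) * indicator A \<omega> * indicator E \<omega> \<partial>M)"
      by (rule nn_integral_cong) (simp add: A'(2) indicator_def)
    finally show ?thesis
      unfolding nn_integral_uniform_measure[OF mX E(1)] nn_integral_uniform_measure[OF mp E(1)] by simp
  qed
  have "AE \<omega> in ?N. real_cond_exp ?N F (indicator ?X) \<omega> = p (?ages \<omega>)"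
  proof (rule real_cond_exp_charact[OF _ iX ip pF])
    fix A assume A: "A \<in> sets F"
    have AN: "A \<in> sets ?N" using A sub by (auto simp: subalgebra_def)
    have XN: "(indicator ?X :: 'w \<Rightarrow> real) \<in> borel_measurable ?N" "(\<lambda>\<omega>. p (?ages \<omega>)) \<in> borel_measurable ?N"
      using X pM by (simp_all add: measurable_uniform_measure)
    have "(\<integral>\<omega>\<in>A. indicator ?X \<omega> \<partial>?N) = enn2real (\<integral>\<^sup>+\<omega>. ennreal (indicator A \<omega> *\<^sub>R indicator ?X \<omega>) \<partial>?N)"
      unfolding set_lebesgue_integral_def
    proof (rule integral_eq_nn_integral)
      show "(\<lambda>\<omega>. indicator A \<omega> *\<^sub>R indicator ?X \<omega> :: real) \<in> borel_measurable ?N"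
        by (intro borel_measurable_scaleR borel_measurable_indicator AN XN(1))
    qed simp
    also have "(\<integral>\<^sup>+\<omega>. ennreal (indicator A \<omega> *\<^sub>R indicator ?X \<omega>) \<partial>?N) = (\<integral>\<^sup>+\<omega>. ennreal (indicator ?X \<omega>) * indicator A \<omega> \<partial>?N)"
      by (rule nn_integral_cong) (simp add: indicator_def)
    also have "\<dots> = (\<integral>\<^sup>+\<omega>. ennreal (p (?ages \<omega>)) * indicator A \<omega> \<partial>?N)" by (rule key[OF A])
    also have "\<dots> = (\<integral>\<^sup>+\<omega>. ennreal (indicator A \<omega> *\<^sub>R p (?ages \<omega>)) \<partial>?N)"
      by (rule nn_integral_cong) (simp add: indicator_def)
    also have "enn2real \<dots> = (\<integral>\<omega>\<in>A. p (?ages \<omega>) \<partial>?N)"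
      unfolding set_lebesgue_integral_def
    proof (rule integral_eq_nn_integral[symmetric])
      show "(\<lambda>\<omega>. indicator A \<omega> *\<^sub>R p (?ages \<omega>)) \<in> borel_measurable ?N" using AN XN(2) by simp
      show "AE \<omega> in ?N. 0 \<le> indicator A \<omega> *\<^sub>R p (?ages \<omega>)"
        using AE_p by eventually_elim (simp add: indicator_def)
    qed
    finally show "(\<integral>\<omega>\<in>A. indicator ?X \<omega> \<partial>?N) = (\<integral>\<omega>\<in>A. p (?ages \<omega>) \<partial>?N)" .
  qed
  then show ?thesis unfolding p_def .
qed

end

theorem lemma25:
  fixes M :: "'w measure" and H :: "'w \<Rightarrow> nat list \<rightharpoonup> real" and k :: nat
  assumes "poisson_galton_watson M age_law age_intensity H" and "1 \<le> k"
  shows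
    "let E = {\<omega> \<in> space M. card (dom (H \<omega>)) = k};
         ages = (\<lambda>\<omega>. sorted_ages k (H \<omega>));
         R = (\<Pi>\<^sub>M i\<in>{1..k}. lborel)
     in E \<in> sets M \<and>
        distributed (restrict_space M E) R ages
          (\<lambda>a. ennreal (indicator (age_chamber k) a *
             ((1 / 2) ^ k *
              (\<Prod>j=1..k-1. real (k - j + 1) * a j + (\<Sum>m=1..j-1. a m)) *
              (\<Prod>i=1..k. exp (- a i))))) \<and>
        distributed (uniform_measure M E) lborel
          (\<lambda>\<omega>. \<Sum>u\<in>dom (H \<omega>). the (H \<omega> u))
          (\<lambda>x. ennreal (erlang_density (2 * k - 2) 1 x)) \<and>
        (\<forall>T. spanning_tree_on {1..k} T \<longrightarrow>
           (AE \<omega> in uniform_measure M E.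
              real_cond_exp (uniform_measure M E) (vimage_algebra (space M) ages R)
                (indicator {\<omega> \<in> space M. tree_edges (H \<omega>) = (\<lambda>e. ages \<omega> ` e) ` T}) \<omega>
              = tree_weight (ages \<omega>) T /
                (\<Sum>T' | spanning_tree_on {1..k} T'. tree_weight (ages \<omega>) T')))"
proof -
  interpret age_galton_watson M H by unfold_locales (rule assms(1))
  note k = assms(2)
  show ?thesis
    unfolding Let_def
  proof (intro conjI allI impI)
    show "{\<omega> \<in> space M. card (dom (H \<omega>)) = k} \<in> sets M" by (rule sets_card_vertices[OF k])
  qed (rule distributed_sorted_ages[OF k, unfolded ages_density_def] distributed_total_age[OF k]
      conditional_tree_law[OF k], assumption?)+
qed

end
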